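(* Let $T>0$, let $\Omega\subset\mathbb{R}^N$ be a (sufficiently smooth) bounded domain, $\Omega_T=(0,T)\times\Omega$, and let $(k,l)\in\mathcal{PC}$. Let $u_0\in L_2(\Omega)$, $f\in L_2(\Omega_T)$, $u\in L_2(\Omega_T)$ and $k\ast u\in C([0,T];L_2(\Omega))$ such that $(k\ast u)|_{t=0}=0$. Assume that one of the following conditions is satisfied. (D) $w\in L_2((0,T);\mathring{H}^1_2(\Omega))$, $w\ge0$, and for all $\psi\in\mathring{H}^1_2(\Omega)$ with $\psi\ge0$ and all $n\in\mathbb{N}$, $$\int_\Omega\Big(\psi\,\partial_t\big(k_n\ast[u-u_0]\big)+(h_n\ast\nabla w)\cdot\nabla\psi\Big)\,dx\le\int_\Omega(h_n\ast f)\,\psi\,dx\quad\text{for a.a. }t\in(0,T).\qquad(\star)$$ (N) $w\in L_2((0,T);H^1_2(\Omega))$, $w\ge0$, and $(\star)$ holds for all $\psi\in H^1_2(\Omega)$ with $\psi\ge0$ and all $n\in\mathbb{N}$. Then, for every $n\in\mathbb{N}$, $$\begin{aligned}&\int_0^T\!\!\int_\Omega w\,(h_n\ast u)\,dx\,dt+\frac12\int_0^T\!\!\int_\Omega\big[k_n(T-t)+k_n(t)\big]\,|l\overset{T}{\ast}\nabla w|^2\,dx\,dt\\&\quad+\frac12\int_0^T\!\!\int_0^t\!\!\int_\Omega[-\dot k_n(s)]\,\big|(l\overset{T}{\ast}\nabla w)(t,x)-(l\overset{T}{\ast}\nabla w)(t-s,x)\big|^2\,dx\,ds\,dt\\&\le\int_0^T\!\!\int_\Omega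 w\,u_0\,(1\ast h_n)\,dx\,dt+\int_0^T\!\!\int_\Omega(h_n\ast f)(l\overset{T}{\ast}w)\,dx\,dt\\&\quad+\int_0^T\!\!\int_\Omega\big[(h_n\overset{T}{\ast}\nabla w)-(h_n\ast\nabla w)\big]\cdot(l\overset{T}{\ast}\nabla w)\,dx\,dt.\end{aligned}$$
   Context: Condition $\mathcal{PC}$: $(k,l)\in\mathcal{PC}$ means that $k\in L_{1,loc}([0,\infty))$ is nonnegative and nonincreasing and $l\in L_{1,loc}([0,\infty))$ satisfies $k\ast l=1$ on $(0,\infty)$ (such $l$ is automatically nonnegative). Convolutions in time: $(k\ast v)(t)=\int_0^t k(t-\tau)v(\tau)\,d\tau$ and $(l\overset{T}{\ast}g)(t)=\int_t^T l(\tau-t)g(\tau)\,d\tau$ for $t\in(0,T)$. In $k_n\ast[u-u_0]$ the function $u_0=u_0(x)$ is regarded as constant in time. Regularized kernels: for $n\in\mathbb{N}$, $h_n\in L_{1,loc}([0,\infty))$ is the unique solution of $h_n(t)+n(h_n\ast l)(t)=n\,l(t)$, $t>0$, and $k_n=k\ast h_n$. Known facts: $h_n\ge0$, $k_n$ is nonnegative, nonincreasing and locally absolutely continuous on $[0,\infty)$ with locally integrable derivative $\dot k_n$; $h_n\ast g\to g$ in $L_p((0,T))$ as $n\to\infty$ for $g\in L_p((0,T))$, $1\le p<\infty$. Spaces: $H^1_2(\Omega)=W^{1,2}(\Omega)$ and $\mathring{H}^1_2(\Omega)$ is the closure of $C_0^\infty(\Omega)$ in $H^1_2(\Omega)$.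 The inequality $(\star)$ is the time-regularized weak formulation of $\partial_t(k\ast[u-u_0])-\Delta w\le f$. *)

theory Defs
  imports "HOL-Analysis.Analysis"
begin

text \<open>
  Elements of Lebesgue spaces are given by Borel representatives, and functions of time and space
  are curried, \<open>u t x\<close>. All pointwise conditions on such representatives are imposed almost
  everywhere.
\<close>

definition L1_loc :: "(real \<Rightarrow> real) \<Rightarrow> bool" where
  "L1_loc k \<longleftrightarrow> (\<forall>b>0. set_integrable lborel {0<..<b} k)"

definition L2_on :: "'a::euclidean_space set \<Rightarrow> ('a \<Rightarrow> 'b::euclidean_space) \<Rightarrow> bool" where
  "L2_on A f \<longleftrightarrow>
     set_borel_measurable lborel A f \<and> set_integrable lborel A (\<lambda>x. (norm (f x))\<^sup>2)"

text \<open>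
  Convolution over \<open>(0, t)\<close> and its backward version over \<open>(t, T)\<close>. For functions of time and space
  they are applied to \<open>\<lambda>\<tau>. v \<tau> x\<close> at fixed \<open>x\<close>.
\<close>

definition conv :: "(real \<Rightarrow> real) \<Rightarrow> (real \<Rightarrow> 'b::euclidean_space) \<Rightarrow> real \<Rightarrow> 'b" where
  "conv k v t = (LINT \<tau>:{0<..<t}|lborel. k (t - \<tau>) *\<^sub>R v \<tau>)"

definition bconv :: "real \<Rightarrow> (real \<Rightarrow> real) \<Rightarrow> (real \<Rightarrow> 'b::euclidean_space) \<Rightarrow> real \<Rightarrow> 'b" where
  "bconv T l g t = (LINT \<tau>:{t<..<T}|lborel. l (\<tau> - t) *\<^sub>R g \<tau>)"

text \<open>
  Monotonicity is required on \<open>(0, \<infinity>)\<close> only: the kernels of interest are unbounded at \<open>0\<close>, so the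
  value \<open>k 0\<close> carries no information.
\<close>

definition PC :: "((real \<Rightarrow> real) \<times> (real \<Rightarrow> real)) set" where
  "PC = {(k, l). L1_loc k \<and> (\<forall>t>0. 0 \<le> k t) \<and> antimono_on {0<..} k \<and>
                 L1_loc l \<and> (AE t\<in>{0<..} in lborel. conv k l t = 1)}"

definition reg_kernel :: "(real \<Rightarrow> real) \<Rightarrow> nat \<Rightarrow> (real \<Rightarrow> real) \<Rightarrow> bool" where
  "reg_kernel l n h \<longleftrightarrow>
     L1_loc h \<and> (AE t\<in>{0<..} in lborel. h t + real n * conv h l t = real n * l t)"

text \<open>
  \<open>f\<close> agrees almost everywhere on \<open>(0, \<infinity>)\<close> with a function that is locally absolutely continuous on
  \<open>[0, \<infinity>)\<close> and has the locally integrable derivative \<open>f'\<close>. The representative matters because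
  a convolution such as \<open>k * h\<close> is determined only almost everywhere.
\<close>

definition loc_ac_deriv :: "(real \<Rightarrow> real) \<Rightarrow> (real \<Rightarrow> real) \<Rightarrow> bool" where
  "loc_ac_deriv f f' \<longleftrightarrow>
     L1_loc f' \<and> (\<exists>c. AE t\<in>{0<..} in lborel. f t = c + (LINT s:{0<..<t}|lborel. f' s))"

text \<open>
  A nonempty connected open set is Lipschitz if near each boundary point it is, in suitable
  orthonormal coordinates, the region above the graph of a Lipschitz function; \<open>y - (y \<bullet> e) e\<close> is the
  projection of \<open>y\<close> onto the hyperplane orthogonal to the unit vector \<open>e\<close>.
\<close>

definition bounded_lipschitz_domain :: "'a::euclidean_space set \<Rightarrow> bool" where
  "bounded_lipschitz_domain \<Omega> \<longleftrightarrow>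
     open \<Omega> \<and> connected \<Omega> \<and> \<Omega> \<noteq> {} \<and> bounded \<Omega> \<and>
     (\<forall>x\<in>frontier \<Omega>. \<exists>r>0. \<exists>e \<gamma> L. norm e = 1 \<and> L-lipschitz_on UNIV \<gamma> \<and>
        \<Omega> \<inter> ball x r = {y \<in> ball x r. \<gamma> (y - (y \<bullet> e) *\<^sub>R e) < y \<bullet> e})"

primrec Ck :: "nat \<Rightarrow> ('a::euclidean_space \<Rightarrow> real) \<Rightarrow> bool" where
  "Ck 0 f \<longleftrightarrow> continuous_on UNIV f"
| "Ck (Suc m) f \<longleftrightarrow>
     (\<exists>f'. (\<forall>x. (f has_derivative f' x) (at x)) \<and> (\<forall>v. Ck m (\<lambda>x. f' x v)))"

definition test_fun :: "'a::euclidean_space set \<Rightarrow> ('a \<Rightarrow> real) \<Rightarrow> bool" where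
  "test_fun \<Omega> \<phi> \<longleftrightarrow>
     (\<forall>m. Ck m \<phi>) \<and> compact (closure {x. \<phi> x \<noteq> 0}) \<and> closure {x. \<phi> x \<noteq> 0} \<subseteq> \<Omega>"

definition grad :: "('a::euclidean_space \<Rightarrow> real) \<Rightarrow> 'a \<Rightarrow> 'a" where
  "grad \<phi> x = (\<Sum>b\<in>Basis. frechet_derivative \<phi> (at x) b *\<^sub>R b)"

definition weak_grad :: "'a::euclidean_space set \<Rightarrow> ('a \<Rightarrow> real) \<Rightarrow> ('a \<Rightarrow> 'a) \<Rightarrow> bool" where
  "weak_grad \<Omega> v g \<longleftrightarrow>
     (\<forall>\<phi>. test_fun \<Omega> \<phi> \<longrightarrow>
        (LINT x:\<Omega>|lborel. v x *\<^sub>R grad \<phi> x) = - (LINT x:\<Omega>|lborel. \<phi> x *\<^sub>R g x))"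

text \<open>
  \<open>H1 \<Omega> v g\<close>: the function \<open>v\<close> belongs to \<open>W\<^sup>1\<^sup>,\<^sup>2(\<Omega>)\<close> and \<open>g\<close> represents its weak gradient.
  In \<open>H1_0\<close> the function is moreover a limit of test functions in the norm of \<open>W\<^sup>1\<^sup>,\<^sup>2(\<Omega>)\<close>.
\<close>

definition H1 :: "'a::euclidean_space set \<Rightarrow> ('a \<Rightarrow> real) \<Rightarrow> ('a \<Rightarrow> 'a) \<Rightarrow> bool" where
  "H1 \<Omega> v g \<longleftrightarrow> L2_on \<Omega> v \<and> L2_on \<Omega> g \<and> weak_grad \<Omega> v g"

definition H1_0 :: "'a::euclidean_space set \<Rightarrow> ('a \<Rightarrow> real) \<Rightarrow> ('a \<Rightarrow> 'a) \<Rightarrow> bool" where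
  "H1_0 \<Omega> v g \<longleftrightarrow> H1 \<Omega> v g \<and>
     (\<exists>\<phi>. (\<forall>j. test_fun \<Omega> (\<phi> j)) \<and>
        (\<lambda>j::nat. (LINT x:\<Omega>|lborel. (\<phi> j x - v x)\<^sup>2) +
                  (LINT x:\<Omega>|lborel. (norm (grad (\<phi> j) x - g x))\<^sup>2)) \<longlonglongrightarrow> 0)"

text \<open>
  \<open>w \<in> L\<^sub>2((0,T); X)\<close> with spatial gradient \<open>gw\<close>, where \<open>X\<close> is \<open>H1 \<Omega>\<close> or \<open>H1_0 \<Omega>\<close>. As these are
  closed subspaces of \<open>L\<^sub>2(\<Omega>) \<times> L\<^sub>2(\<Omega>)\<^sup>N\<close> via \<open>(v, \<nabla>v)\<close>, Bochner measurability and square integrability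
  amount to those of \<open>w\<close> and \<open>gw\<close> on the space-time cylinder.
\<close>

definition L2_time ::
  "real \<Rightarrow> 'a::euclidean_space set \<Rightarrow> (('a \<Rightarrow> real) \<Rightarrow> ('a \<Rightarrow> 'a) \<Rightarrow> bool) \<Rightarrow>
   (real \<Rightarrow> 'a \<Rightarrow> real) \<Rightarrow> (real \<Rightarrow> 'a \<Rightarrow> 'a) \<Rightarrow> bool" where
  "L2_time T \<Omega> X w gw \<longleftrightarrow>
     L2_on ({0<..<T} \<times> \<Omega>) (\<lambda>(t, x). w t x) \<and> L2_on ({0<..<T} \<times> \<Omega>) (\<lambda>(t, x). gw t x) \<and>
     (AE t\<in>{0<..<T} in lborel. X (w t) (gw t))"

definition cont_L2 :: "real \<Rightarrow> 'a::euclidean_space set \<Rightarrow> (real \<Rightarrow> 'a \<Rightarrow> real) \<Rightarrow> bool" where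
  "cont_L2 T \<Omega> U \<longleftrightarrow>
     (\<forall>t\<in>{0..T}. L2_on \<Omega> (U t) \<and>
        ((\<lambda>s. LINT x:\<Omega>|lborel. (U s x - U t x)\<^sup>2) \<longlongrightarrow> 0) (at t within {0..T}))"

text \<open>
  The class of \<open>V\<close> has a representative in \<open>C([0,T]; L\<^sub>2(\<Omega>))\<close> that vanishes at \<open>t = 0\<close>.
\<close>

definition cont_L2_null_at_0 ::
  "real \<Rightarrow> 'a::euclidean_space set \<Rightarrow> (real \<Rightarrow> 'a \<Rightarrow> real) \<Rightarrow> bool" where
  "cont_L2_null_at_0 T \<Omega> V \<longleftrightarrow>
     (\<exists>U. cont_L2 T \<Omega> U \<and> (AE t\<in>{0<..<T} in lborel. AE x\<in>\<Omega> in lborel. U t x = V t x) \<and>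
          (AE x\<in>\<Omega> in lborel. U 0 x = 0))"

text \<open>
  \<open>D \<in> L\<^sub>2((0,T); L\<^sub>2(\<Omega>))\<close> is the weak derivative of the \<open>L\<^sub>2(\<Omega>)\<close>-valued function \<open>V\<close>; the identity
  between the two integrals is one in \<open>L\<^sub>2(\<Omega>)\<close>.
\<close>

definition weak_time_deriv ::
  "real \<Rightarrow> 'a::euclidean_space set \<Rightarrow> (real \<Rightarrow> 'a \<Rightarrow> real) \<Rightarrow> (real \<Rightarrow> 'a \<Rightarrow> real) \<Rightarrow> bool" where
  "weak_time_deriv T \<Omega> V D \<longleftrightarrow>
     L2_on ({0<..<T} \<times> \<Omega>) (\<lambda>(t, x). D t x) \<and>
     (\<forall>\<phi>. test_fun {0<..<T} \<phi> \<longrightarrow>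
        (AE x\<in>\<Omega> in lborel.
           (LINT t:{0<..<T}|lborel. deriv \<phi> t * V t x) =
           - (LINT t:{0<..<T}|lborel. \<phi> t * D t x)))"

text \<open>
  The time-regularized weak form of \<open>\<partial>\<^sub>t (k * [u - u0]) - \<Delta>w \<le> f\<close>, tested with all nonnegative
  elements of the space \<open>X\<close>; \<open>D\<close> is \<open>\<partial>\<^sub>t (k\<^sub>n * [u - u0])\<close> with \<open>k\<^sub>n = k * h\<^sub>n\<close>, which is unique
  almost everywhere.
\<close>

definition weak_ineq ::
  "real \<Rightarrow> 'a::euclidean_space set \<Rightarrow> (('a \<Rightarrow> real) \<Rightarrow> ('a \<Rightarrow> 'a) \<Rightarrow> bool) \<Rightarrow>
   (real \<Rightarrow> real) \<Rightarrow> (nat \<Rightarrow> real \<Rightarrow> real) \<Rightarrow> ('a \<Rightarrow> real) \<Rightarrow> (real \<Rightarrow> 'a \<Rightarrow> real) \<Rightarrow>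
   (real \<Rightarrow> 'a \<Rightarrow> real) \<Rightarrow> (real \<Rightarrow> 'a \<Rightarrow> 'a) \<Rightarrow> bool" where
  "weak_ineq T \<Omega> X k h u0 u f gw \<longleftrightarrow>
     (\<forall>n\<ge>1. \<exists>D.
        weak_time_deriv T \<Omega> (\<lambda>t x. conv (conv k (h n)) (\<lambda>\<tau>. u \<tau> x - u0 x) t) D \<and>
        (\<forall>\<psi> g\<psi>. X \<psi> g\<psi> \<longrightarrow> (AE x\<in>\<Omega> in lborel. 0 \<le> \<psi> x) \<longrightarrow>
           (AE t\<in>{0<..<T} in lborel.
              (LINT x:\<Omega>|lborel. \<psi> x * D t x + conv (h n) (\<lambda>\<tau>. gw \<tau> x) t \<bullet> g\<psi> x)
              \<le> (LINT x:\<Omega>|lborel. conv (h n) (\<lambda>\<tau>. f \<tau> x) t * \<psi> x))))"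

end

theory Submission
  imports Defs
begin

text \<open>
  Formally one tests the weak inequality with \<open>\<psi> = l *\<^sup>T w\<close>, which is admissible because \<open>l\<close> and \<open>w\<close> are
  nonnegative, and integrates over time. Since the exceptional set of times depends on the test
  function, the proof tests instead with \<open>\<psi> = w(t)\<close> for fixed \<open>t\<close>, multiplies the inequality at the time
  \<open>s < t\<close> by \<open>l(t - s) \<ge> 0\<close> and integrates over \<open>0 < s < t < T\<close>
  (\<open>conv_form_tested_inequality\<close>); by Fubini this has the same effect. Three identities then turn
  the result into the claim.

  \<^item> With \<open>v = u - u\<^sub>0\<close>: convolving \<open>h + n h * l = n l\<close> with \<open>k\<close> and using \<open>k * l = 1\<close> gives
    \<open>k\<^sub>n = n (1 - 1 * h)\<close>, so \<open>\<partial>\<^sub>t (k\<^sub>n * v) = n (v - h * v)\<close>, and convolving with \<open>l\<close> yields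
    \<open>(n l - n l * h) * v = h * v\<close>. This produces the terms with \<open>u\<close> and \<open>u\<^sub>0\<close>
    (\<open>regularized_kernel_eq\<close>, \<open>weak_time_derivative_eq\<close>, \<open>time_derivative_term\<close>).

  \<^item> With \<open>G = l *\<^sup>T \<nabla>w\<close>: the equation for \<open>h\<close> gives \<open>h *\<^sup>T \<nabla>w = n (G - h *\<^sup>T G)\<close>. Adding and subtracting
    \<open>(h *\<^sup>T \<nabla>w) \<cdot> G\<close> replaces \<open>(h * \<nabla>w) \<cdot> G\<close> by \<open>n (|G|\<^sup>2 - (h *\<^sup>T G) \<cdot> G)\<close> and the commutator on the right
    (\<open>gradient_term\<close>).

  \<^item> As \<open>- k\<^sub>n' = n h\<close>, expanding the square \<open>|G(t) - G(t - s)|\<^sup>2\<close> shows that the integral of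
    \<open>n (|G|\<^sup>2 - (h *\<^sup>T G) \<cdot> G)\<close> is the quadratic form on the left (\<open>energy_identity\<close>).

  The one property of the kernels that is not algebra is \<open>l \<ge> 0\<close>; it follows from a minimum principle
  (\<open>resolvent_nonneg\<close>).

  All functions are extended by zero outside \<open>(0, T)\<close>, respectively \<open>(0, T) \<times> \<Omega>\<close>, and convolutions are
  taken over the whole line. Every term of the claim is then a value of one trilinear form,
  \<open>\<integral>\<integral>\<integral> a(t - s) p(s, x) \<cdot> q(t, x)\<close>, which converges absolutely for integrable \<open>a\<close> and square-integrable
  \<open>p\<close> and \<open>q\<close> by Young's inequality.
\<close>

section \<open>Convolution on the real line\<close>

lemma nn_integral_reflect_shift:
  fixes f :: "real \<Rightarrow> ennreal"
  assumes "f \<in> borel_measurable borel"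
  shows "(\<integral>\<^sup>+s. f (t - s) \<partial>lborel) = (\<integral>\<^sup>+s. f s \<partial>lborel)"
  using nn_integral_real_affine[OF assms, of "-1" t] by simp

lemma nn_integral_shift:
  fixes f :: "real \<Rightarrow> ennreal"
  assumes "f \<in> borel_measurable borel"
  shows "(\<integral>\<^sup>+s. f (s - t) \<partial>lborel) = (\<integral>\<^sup>+s. f s \<partial>lborel)"
  using nn_integral_real_affine[OF assms, of 1 "- t"] by simp

lemma integral_reflect_shift:
  fixes f :: "real \<Rightarrow> 'b::{banach, second_countable_topology}"
  shows "(LINT s|lborel. f (t - s)) = (LINT s|lborel. f s)"
  using lborel_integral_real_affine[of "-1" f t] by simp

lemma integral_shift:
  fixes f :: "real \<Rightarrow> 'b::{banach, second_countable_topology}"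
  shows "(LINT s|lborel. f (s - t)) = (LINT s|lborel. f s)"
  using lborel_integral_real_affine[of 1 f "- t"] by simp

lemma AE_reflect_shift:
  fixes P :: "real \<Rightarrow> bool"
  assumes "AE s in lborel. P s"
  shows "AE s in lborel. P (t - s)"
proof -
  obtain N where N: "N \<in> null_sets lborel" "{s. \<not> P s} \<subseteq> N"
    using assms by (auto simp: eventually_ae_filter)
  have "AE s in lborel. s \<notin> N"
    by (rule AE_not_in[OF N(1)])
  moreover have "Measurable.pred borel (\<lambda>s. s \<notin> N)"
    using N(1) by (auto simp: null_sets_def)
  ultimately have "AE s in lborel. t + (-1) * s \<notin> N"
    by (intro AE_borel_affine) auto
  then show ?thesis
    by eventually_elim (use N(2) in auto)
qed

lemma Fubini_iterated:
  fixes f :: "'x::euclidean_space \<Rightarrow> 'y::euclidean_space \<Rightarrow> 'c::{banach, second_countable_topology}"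
  assumes [measurable]: "case_prod f \<in> borel_measurable (lborel \<Otimes>\<^sub>M lborel)"
    and fin: "(\<integral>\<^sup>+x. \<integral>\<^sup>+y. norm (f x y) \<partial>lborel \<partial>lborel) < \<infinity>"
  shows "integrable (lborel \<Otimes>\<^sub>M lborel) (case_prod f)"
    and "(LINT x|lborel. LINT y|lborel. f x y) = (LINT y|lborel. LINT x|lborel. f x y)"
    and "integrable lborel (\<lambda>x. LINT y|lborel. f x y)"
    and "AE x in lborel. integrable lborel (\<lambda>y. f x y)"
proof -
  have "(\<integral>\<^sup>+z. norm (case_prod f z) \<partial>(lborel \<Otimes>\<^sub>M lborel)) < \<infinity>"
    using fin by (subst lborel.nn_integral_fst[symmetric]) auto
  then show *: "integrable (lborel \<Otimes>\<^sub>M lborel) (case_prod f)"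
    by (intro integrableI_bounded) auto
  show "(LINT x|lborel. LINT y|lborel. f x y) = (LINT y|lborel. LINT x|lborel. f x y)"
    using lborel_pair.Fubini_integral[OF *] by simp
  show "integrable lborel (\<lambda>x. LINT y|lborel. f x y)"
    using lborel_pair.integrable_fst'[OF *] by simp
  show "AE x in lborel. integrable lborel (\<lambda>y. f x y)"
    using lborel_pair.AE_integrable_fst'[OF *] by simp
qed

definition line_conv :: "(real \<Rightarrow> real) \<Rightarrow> (real \<Rightarrow> 'b::euclidean_space) \<Rightarrow> real \<Rightarrow> 'b" where
  "line_conv a p t = (LINT s|lborel. a (t - s) *\<^sub>R p s)"

text \<open>
  The absolute convolution takes values in \<open>[0, \<infinity>]\<close>, so that Tonelli applies to it without
  integrability assumptions; its finiteness at a point is the condition under which \<open>line_conv\<close> can be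
  manipulated at that point.
\<close>

definition abs_conv :: "(real \<Rightarrow> real) \<Rightarrow> (real \<Rightarrow> ennreal) \<Rightarrow> real \<Rightarrow> ennreal" where
  "abs_conv a P t = (\<integral>\<^sup>+s. ennreal \<bar>a (t - s)\<bar> * P s \<partial>lborel)"

lemma abs_conv_measurable [measurable]:
  assumes [measurable]: "a \<in> borel_measurable borel"
    "case_prod P \<in> borel_measurable (M \<Otimes>\<^sub>M lborel)" "g \<in> borel_measurable M"
  shows "(\<lambda>x. abs_conv a (\<lambda>s. P x s) (g x)) \<in> borel_measurable M"
  unfolding abs_conv_def by measurable

lemma line_conv_measurable [measurable]:
  assumes [measurable]: "a \<in> borel_measurable borel"
    "case_prod p \<in> borel_measurable (M \<Otimes>\<^sub>M lborel)" "g \<in> borel_measurable M"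
  shows "(\<lambda>x. line_conv a (\<lambda>s. p x s) (g x)) \<in> borel_measurable M"
  unfolding line_conv_def by measurable

lemma nn_integral_abs_conv:
  assumes [measurable]: "a \<in> borel_measurable borel" "P \<in> borel_measurable borel"
  shows "(\<integral>\<^sup>+t. abs_conv a P t \<partial>lborel) = (\<integral>\<^sup>+s. ennreal \<bar>a s\<bar> \<partial>lborel) * (\<integral>\<^sup>+s. P s \<partial>lborel)"
proof -
  have "(\<integral>\<^sup>+t. abs_conv a P t \<partial>lborel) = (\<integral>\<^sup>+s. \<integral>\<^sup>+t. ennreal \<bar>a (t - s)\<bar> * P s \<partial>lborel \<partial>lborel)"
    unfolding abs_conv_def by (rule lborel_pair.Fubini') measurable
  also have "\<dots> = (\<integral>\<^sup>+s. (\<integral>\<^sup>+t. ennreal \<bar>a t\<bar> \<partial>lborel) * P s \<partial>lborel)"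
    using nn_integral_shift[of "\<lambda>s. ennreal \<bar>a s\<bar>"] by (simp add: nn_integral_multc)
  also have "\<dots> = (\<integral>\<^sup>+s. ennreal \<bar>a s\<bar> \<partial>lborel) * (\<integral>\<^sup>+s. P s \<partial>lborel)"
    by (simp add: nn_integral_cmult)
  finally show ?thesis .
qed

text \<open>
  Young's inequality for \<open>L\<^sup>1 * L\<^sup>2\<close>: by Cauchy and Schwarz with the splitting
  \<open>|a| P = |a|\<^sup>1\<^sup>/\<^sup>2 \<cdot> |a|\<^sup>1\<^sup>/\<^sup>2 P\<close>, the square of \<open>|a| * P\<close> is at most \<open>\<parallel>a\<parallel>\<^sub>1\<close> times \<open>|a| * P\<^sup>2\<close>, to which the case
  of \<open>L\<^sup>1 * L\<^sup>1\<close> applies.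
\<close>

lemma nn_integral_abs_conv_square:
  assumes [measurable]: "a \<in> borel_measurable borel" "P \<in> borel_measurable borel"
  shows "(\<integral>\<^sup>+t. (abs_conv a P t)\<^sup>2 \<partial>lborel)
    \<le> (\<integral>\<^sup>+s. ennreal \<bar>a s\<bar> \<partial>lborel)\<^sup>2 * (\<integral>\<^sup>+s. (P s)\<^sup>2 \<partial>lborel)"
proof -
  define A where "A = (\<integral>\<^sup>+s. ennreal \<bar>a s\<bar> \<partial>lborel)"
  have sq: "(ennreal (sqrt \<bar>r\<bar>))\<^sup>2 = ennreal \<bar>r\<bar>" for r
    by (simp add: ennreal_power)
  have "(abs_conv a P t)\<^sup>2 \<le> A * abs_conv a (\<lambda>s. (P s)\<^sup>2) t" for t
  proof -
    have "abs_conv a P t = (\<integral>\<^sup>+s. ennreal (sqrt \<bar>a (t - s)\<bar>) * (ennreal (sqrt \<bar>a (t - s)\<bar>) * P s) \<partial>lborel)"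
      unfolding abs_conv_def
      by (intro nn_integral_cong) (simp add: sq[symmetric] power2_eq_square mult.assoc)
    also have "\<dots>\<^sup>2 \<le> (\<integral>\<^sup>+s. (ennreal (sqrt \<bar>a (t - s)\<bar>))\<^sup>2 \<partial>lborel)
        * (\<integral>\<^sup>+s. (ennreal (sqrt \<bar>a (t - s)\<bar>) * P s)\<^sup>2 \<partial>lborel)"
      by (rule Cauchy_Schwarz_nn_integral) measurable
    also have "\<dots> = A * abs_conv a (\<lambda>s. (P s)\<^sup>2) t"
      unfolding A_def abs_conv_def sq power_mult_distrib
      by (subst nn_integral_reflect_shift[of "\<lambda>s. ennreal \<bar>a s\<bar>"]) auto
    finally show ?thesis .
  qed
  then have "(\<integral>\<^sup>+t. (abs_conv a P t)\<^sup>2 \<partial>lborel) \<le> (\<integral>\<^sup>+t. A * abs_conv a (\<lambda>s. (P s)\<^sup>2) t \<partial>lborel)"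
    by (intro nn_integral_mono) auto
  also have "\<dots> = A * (\<integral>\<^sup>+t. abs_conv a (\<lambda>s. (P s)\<^sup>2) t \<partial>lborel)"
    by (intro nn_integral_cmult) measurable
  also have "\<dots> = A\<^sup>2 * (\<integral>\<^sup>+s. (P s)\<^sup>2 \<partial>lborel)"
    by (subst nn_integral_abs_conv) (auto simp: A_def power2_eq_square mult.assoc)
  finally show ?thesis
    unfolding A_def .
qed

lemma line_conv_norm_le:
  fixes p :: "real \<Rightarrow> 'b::euclidean_space"
  assumes [measurable]: "a \<in> borel_measurable borel" "p \<in> borel_measurable borel"
  shows "ennreal (norm (line_conv a p t)) \<le> abs_conv a (\<lambda>s. ennreal (norm (p s))) t"
proof (cases "integrable lborel (\<lambda>s. a (t - s) *\<^sub>R p s)")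
  case True
  from integral_norm_bound_ennreal[OF True] show ?thesis
    by (simp add: line_conv_def abs_conv_def ennreal_mult'')
next
  case False
  then show ?thesis
    by (simp add: line_conv_def not_integrable_integral_eq)
qed

lemma line_conv_integrable_at:
  fixes p :: "real \<Rightarrow> 'b::euclidean_space"
  assumes [measurable]: "a \<in> borel_measurable borel" "p \<in> borel_measurable borel"
    and fin: "abs_conv a (\<lambda>s. ennreal (norm (p s))) t < \<infinity>"
  shows "integrable lborel (\<lambda>s. a (t - s) *\<^sub>R p s)"
  using fin by (intro integrableI_bounded) (auto simp: abs_conv_def ennreal_mult'')

text \<open>
  Fubini at the single point \<open>t\<close>. The pointwise form serves both for almost every \<open>t\<close>, with integrable
  factors, and for every \<open>t\<close>, when one factor is bounded.
\<close>

lemma line_conv_assoc_at: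
  fixes p :: "real \<Rightarrow> 'b::euclidean_space"
  assumes [measurable]: "a \<in> borel_measurable borel" "b \<in> borel_measurable borel"
      "p \<in> borel_measurable borel"
    and fin: "abs_conv a (abs_conv b (\<lambda>s. ennreal (norm (p s)))) t < \<infinity>"
  shows "line_conv a (line_conv b p) t = line_conv (line_conv a b) p t"
proof -
  have nrm: "(\<integral>\<^sup>+r. norm ((a (t - s) * b (s - r)) *\<^sub>R p r) \<partial>lborel)
      = ennreal \<bar>a (t - s)\<bar> * abs_conv b (\<lambda>s. ennreal (norm (p s))) s" for s
    unfolding abs_conv_def
    by (subst nn_integral_cmult[symmetric]) (auto simp: abs_mult ennreal_mult'' mult.assoc)
  have fin': "(\<integral>\<^sup>+s. \<integral>\<^sup>+r. norm ((a (t - s) * b (s - r)) *\<^sub>R p r) \<partial>lborel \<partial>lborel) < \<infinity>"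
    unfolding nrm using fin by (simp add: abs_conv_def[of a])
  have meas: "(\<lambda>(s, r). (a (t - s) * b (s - r)) *\<^sub>R p r) \<in> borel_measurable (lborel \<Otimes>\<^sub>M lborel)"
    by measurable
  note F = Fubini_iterated[OF meas fin']
  have swapfin: "(\<integral>\<^sup>+r. \<integral>\<^sup>+s. norm ((a (t - s) * b (s - r)) *\<^sub>R p r) \<partial>lborel \<partial>lborel) < \<infinity>"
    using fin' by (subst lborel_pair.Fubini') auto
  have swapmeas: "(\<lambda>(r, s). (a (t - s) * b (s - r)) *\<^sub>R p r) \<in> borel_measurable (lborel \<Otimes>\<^sub>M lborel)"
    by measurable
  note G = Fubini_iterated[OF swapmeas swapfin]
  have "line_conv a (line_conv b p) t = (LINT s|lborel. LINT r|lborel. (a (t - s) * b (s - r)) *\<^sub>R p r)"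
    unfolding line_conv_def by (simp flip: scaleR_scaleR)
  also have "\<dots> = (LINT r|lborel. LINT s|lborel. (a (t - s) * b (s - r)) *\<^sub>R p r)"
    by (rule F(2))
  also have "\<dots> = (LINT r|lborel. line_conv a b (t - r) *\<^sub>R p r)"
  proof (rule integral_cong_AE)
    show "AE r in lborel. (LINT s|lborel. (a (t - s) * b (s - r)) *\<^sub>R p r) = line_conv a b (t - r) *\<^sub>R p r"
      using G(4)
    proof eventually_elim
      case (elim r)
      have "integrable lborel (\<lambda>s. a (t - s) * b (s - r))" if "p r \<noteq> 0"
        using integrable_inner_left[of "p r /\<^sub>R (norm (p r))\<^sup>2", OF elim] that
        by (simp add: power2_norm_eq_inner)
      then have "(LINT s|lborel. (a (t - s) * b (s - r)) *\<^sub>R p r)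
          = (LINT s|lborel. a (t - s) * b (s - r)) *\<^sub>R p r"
        by (rule integral_scaleR_left)
      also have "(LINT s|lborel. a (t - s) * b (s - r)) = line_conv a b (t - r)"
        using integral_shift[of "\<lambda>s. a (t - r - s) * b s" r]
        by (simp add: line_conv_def algebra_simps)
      finally show ?case .
    qed
  qed measurable
  finally show ?thesis
    by (simp add: line_conv_def[of "line_conv a b"])
qed

lemma line_conv_commute:
  fixes a b :: "real \<Rightarrow> real"
  shows "line_conv a b = line_conv b a"
proof
  fix t
  show "line_conv a b t = line_conv b a t"
    using integral_reflect_shift[of "\<lambda>s. a (t - s) * b s" t] by (simp add: line_conv_def mult.commute)
qed

lemma integrable_line_conv:
  fixes p :: "real \<Rightarrow> 'b::euclidean_space"
  assumes a: "integrable lborel a" and p: "integrable lborel p"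
  shows "integrable lborel (line_conv a p)"
    and "AE t in lborel. abs_conv a (\<lambda>s. ennreal (norm (p s))) t < \<infinity>"
proof -
  have [measurable]: "a \<in> borel_measurable borel" "p \<in> borel_measurable borel"
    using borel_measurable_integrable[OF a] borel_measurable_integrable[OF p] by auto
  have fin: "(\<integral>\<^sup>+t. abs_conv a (\<lambda>s. ennreal (norm (p s))) t \<partial>lborel) < \<infinity>"
    using a p by (subst nn_integral_abs_conv) (auto simp: integrable_iff_bounded ennreal_mult_less_top)
  have "(\<integral>\<^sup>+t. norm (line_conv a p t) \<partial>lborel) \<le> (\<integral>\<^sup>+t. abs_conv a (\<lambda>s. ennreal (norm (p s))) t \<partial>lborel)"
    by (intro nn_integral_mono line_conv_norm_le) auto
  also note fin
  finally show "integrable lborel (line_conv a p)"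
    by (intro integrableI_bounded) auto
  have "AE t in lborel. abs_conv a (\<lambda>s. ennreal (norm (p s))) t \<noteq> \<infinity>"
    using fin by (intro nn_integral_PInf_AE) auto
  then show "AE t in lborel. abs_conv a (\<lambda>s. ennreal (norm (p s))) t < \<infinity>"
    by eventually_elim (simp add: less_top)
qed

lemma line_conv_assoc_AE:
  fixes p :: "real \<Rightarrow> 'b::euclidean_space"
  assumes a: "integrable lborel a" and b: "integrable lborel b" and p: "integrable lborel p"
  shows "AE t in lborel. line_conv a (line_conv b p) t = line_conv (line_conv a b) p t"
proof -
  have [measurable]: "a \<in> borel_measurable borel" "b \<in> borel_measurable borel" "p \<in> borel_measurable borel"
    using borel_measurable_integrable a b p by auto
  have "(\<integral>\<^sup>+t. abs_conv a (abs_conv b (\<lambda>s. ennreal (norm (p s)))) t \<partial>lborel) < \<infinity>"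
    using a b p
    by (subst nn_integral_abs_conv, simp_all)
       (subst nn_integral_abs_conv, auto simp: integrable_iff_bounded ennreal_mult_less_top)
  then have "AE t in lborel. abs_conv a (abs_conv b (\<lambda>s. ennreal (norm (p s)))) t \<noteq> \<infinity>"
    by (intro nn_integral_PInf_AE) auto
  then show ?thesis
    by eventually_elim (rule line_conv_assoc_at, auto simp: less_top)
qed

lemma line_conv_eq_0:
  assumes "\<And>s. s \<le> 0 \<Longrightarrow> a s = 0" "\<And>s. s \<le> 0 \<Longrightarrow> p s = 0" "t \<le> 0"
  shows "line_conv a p t = 0"
proof -
  have "a (t - s) *\<^sub>R p s = 0" for s
    using assms(1)[of "t - s"] assms(2)[of s] assms(3) by (cases "s \<le> 0") auto
  then show ?thesis
    unfolding line_conv_def by (simp only: integral_zero)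
qed

lemma line_conv_cong_AE:
  fixes p :: "real \<Rightarrow> 'b::euclidean_space"
  assumes [measurable]: "a \<in> borel_measurable borel" "p \<in> borel_measurable borel" "q \<in> borel_measurable borel"
    and a: "\<And>s. s \<le> 0 \<Longrightarrow> a s = 0"
    and eq: "AE s in lborel. s < t \<longrightarrow> p s = q s"
  shows "line_conv a p t = line_conv a q t"
  unfolding line_conv_def
proof (rule integral_cong_AE)
  show "AE s in lborel. a (t - s) *\<^sub>R p s = a (t - s) *\<^sub>R q s"
    using eq by eventually_elim (use a in \<open>auto simp: not_less\<close>)
qed measurable

section \<open>Convolution forms on square-integrable functions\<close>

text \<open>
  The square integral is written as an iterated nonnegative integral because all bounds on it come
  from Tonelli's theorem.
\<close>

definition sq_integrable :: "(real \<Rightarrow> 'a::euclidean_space \<Rightarrow> 'b::euclidean_space) \<Rightarrow> bool" where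
  "sq_integrable p \<longleftrightarrow> case_prod p \<in> borel_measurable (lborel \<Otimes>\<^sub>M lborel) \<and>
     (\<integral>\<^sup>+t. \<integral>\<^sup>+x. (ennreal (norm (p t x)))\<^sup>2 \<partial>lborel \<partial>lborel) < \<infinity>"

definition time_conv ::
  "(real \<Rightarrow> real) \<Rightarrow> (real \<Rightarrow> 'a \<Rightarrow> 'b::euclidean_space) \<Rightarrow> real \<Rightarrow> 'a \<Rightarrow> 'b" where
  "time_conv a p t x = line_conv a (\<lambda>s. p s x) t"

definition st_inner ::
  "(real \<Rightarrow> 'a::euclidean_space \<Rightarrow> 'b::euclidean_space) \<Rightarrow> (real \<Rightarrow> 'a \<Rightarrow> 'b) \<Rightarrow> real" where
  "st_inner p q = (LINT t|lborel. LINT x|lborel. p t x \<bullet> q t x)"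

definition conv_form ::
  "(real \<Rightarrow> real) \<Rightarrow> (real \<Rightarrow> 'a::euclidean_space \<Rightarrow> 'b::euclidean_space) \<Rightarrow> (real \<Rightarrow> 'a \<Rightarrow> 'b) \<Rightarrow> real"
  where
  "conv_form a p q = (LINT t|lborel. LINT s|lborel. a (t - s) * (LINT x|lborel. p s x \<bullet> q t x))"

lemma sq_integrable_measurable [measurable_dest]:
  "sq_integrable p \<Longrightarrow> case_prod p \<in> borel_measurable (lborel \<Otimes>\<^sub>M lborel)"
  by (simp add: sq_integrable_def)

lemma sq_integrable_finite:
  "sq_integrable p \<Longrightarrow> (\<integral>\<^sup>+t. \<integral>\<^sup>+x. (ennreal (norm (p t x)))\<^sup>2 \<partial>lborel \<partial>lborel) < \<infinity>"
  by (simp add: sq_integrable_def)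

lemma integrable_measurable_borel:
  "integrable lborel a \<Longrightarrow> a \<in> borel_measurable borel"
  using borel_measurable_integrable by auto

lemma sq_integrable_mono:
  fixes p :: "real \<Rightarrow> 'a::euclidean_space \<Rightarrow> 'b::euclidean_space"
    and q :: "real \<Rightarrow> 'a \<Rightarrow> 'c::euclidean_space"
  assumes q: "sq_integrable q" and p: "case_prod p \<in> borel_measurable (lborel \<Otimes>\<^sub>M lborel)"
    and le: "\<And>t x. norm (p t x) \<le> norm (q t x)"
  shows "sq_integrable p"
proof -
  have "(\<integral>\<^sup>+t. \<integral>\<^sup>+x. (ennreal (norm (p t x)))\<^sup>2 \<partial>lborel \<partial>lborel)
      \<le> (\<integral>\<^sup>+t. \<integral>\<^sup>+x. (ennreal (norm (q t x)))\<^sup>2 \<partial>lborel \<partial>lborel)"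
    by (intro nn_integral_mono power_mono ennreal_leI le) auto
  with sq_integrable_finite[OF q] p show ?thesis
    by (simp add: sq_integrable_def le_less_trans)
qed

lemma sq_integrable_add:
  assumes p: "sq_integrable p" and q: "sq_integrable q"
  shows "sq_integrable (\<lambda>t x. p t x + q t x)"
proof -
  note [measurable] = sq_integrable_measurable[OF p] sq_integrable_measurable[OF q]
  have "(\<integral>\<^sup>+t. \<integral>\<^sup>+x. (ennreal (norm (p t x + q t x)))\<^sup>2 \<partial>lborel \<partial>lborel)
     \<le> (\<integral>\<^sup>+t. \<integral>\<^sup>+x. 2 * (ennreal (norm (p t x)))\<^sup>2 + 2 * (ennreal (norm (q t x)))\<^sup>2 \<partial>lborel \<partial>lborel)"
  proof (intro nn_integral_mono)
    fix t x
    have "(norm (p t x + q t x))\<^sup>2 \<le> (norm (p t x) + norm (q t x))\<^sup>2"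
      by (intro power_mono norm_triangle_ineq) auto
    also have "\<dots> \<le> 2 * (norm (p t x))\<^sup>2 + 2 * (norm (q t x))\<^sup>2"
      using sum_squares_bound[of "norm (p t x)" "norm (q t x)"] by (simp add: power2_sum)
    finally have "ennreal ((norm (p t x + q t x))\<^sup>2)
        \<le> ennreal (2 * (norm (p t x))\<^sup>2 + 2 * (norm (q t x))\<^sup>2)"
      by (rule ennreal_leI)
    also have "\<dots> = 2 * (ennreal (norm (p t x)))\<^sup>2 + 2 * (ennreal (norm (q t x)))\<^sup>2"
      by (simp add: ennreal_plus ennreal_mult ennreal_power)
    finally show "(ennreal (norm (p t x + q t x)))\<^sup>2
        \<le> 2 * (ennreal (norm (p t x)))\<^sup>2 + 2 * (ennreal (norm (q t x)))\<^sup>2"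
      by (simp add: ennreal_power)
  qed
  also have "\<dots> < \<infinity>"
    using sq_integrable_finite[OF p] sq_integrable_finite[OF q]
    by (simp add: nn_integral_add nn_integral_cmult ennreal_mult_less_top)
  finally show ?thesis
    unfolding sq_integrable_def by simp
qed

lemma sq_integrable_scale:
  assumes p: "sq_integrable p"
  shows "sq_integrable (\<lambda>t x. c *\<^sub>R p t x)"
proof -
  note [measurable] = sq_integrable_measurable[OF p]
  have "(\<integral>\<^sup>+t. \<integral>\<^sup>+x. (ennreal (norm (c *\<^sub>R p t x)))\<^sup>2 \<partial>lborel \<partial>lborel)
     = (\<integral>\<^sup>+t. \<integral>\<^sup>+x. (ennreal \<bar>c\<bar>)\<^sup>2 * (ennreal (norm (p t x)))\<^sup>2 \<partial>lborel \<partial>lborel)"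
    by (simp add: ennreal_mult power_mult_distrib)
  also have "\<dots> < \<infinity>"
    using sq_integrable_finite[OF p]
    by (simp add: nn_integral_cmult ennreal_mult_less_top power_less_top_ennreal)
  finally show ?thesis
    unfolding sq_integrable_def by simp
qed

lemma sq_integrable_diff:
  assumes "sq_integrable p" and "sq_integrable q"
  shows "sq_integrable (\<lambda>t x. p t x - q t x)"
  using sq_integrable_add[OF assms(1) sq_integrable_scale[OF assms(2), of "-1"]] by simp

lemma nn_integral_square_abs_conv_le:
  fixes P :: "real \<Rightarrow> 'a::euclidean_space \<Rightarrow> ennreal"
  assumes [measurable]: "a \<in> borel_measurable borel" "case_prod P \<in> borel_measurable (lborel \<Otimes>\<^sub>M lborel)"
  shows "(\<integral>\<^sup>+t. \<integral>\<^sup>+x. (abs_conv a (\<lambda>s. P s x) t)\<^sup>2 \<partial>lborel \<partial>lborel)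
    \<le> (\<integral>\<^sup>+s. ennreal \<bar>a s\<bar> \<partial>lborel)\<^sup>2 * (\<integral>\<^sup>+t. \<integral>\<^sup>+x. (P t x)\<^sup>2 \<partial>lborel \<partial>lborel)"
proof -
  have "(\<integral>\<^sup>+t. \<integral>\<^sup>+x. (abs_conv a (\<lambda>s. P s x) t)\<^sup>2 \<partial>lborel \<partial>lborel)
      = (\<integral>\<^sup>+x. \<integral>\<^sup>+t. (abs_conv a (\<lambda>s. P s x) t)\<^sup>2 \<partial>lborel \<partial>lborel)"
    by (rule lborel_pair.Fubini'[symmetric]) measurable
  also have "\<dots> \<le> (\<integral>\<^sup>+x. (\<integral>\<^sup>+s. ennreal \<bar>a s\<bar> \<partial>lborel)\<^sup>2 * (\<integral>\<^sup>+s. (P s x)\<^sup>2 \<partial>lborel) \<partial>lborel)"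
    by (intro nn_integral_mono nn_integral_abs_conv_square) auto
  also have "\<dots> = (\<integral>\<^sup>+s. ennreal \<bar>a s\<bar> \<partial>lborel)\<^sup>2 * (\<integral>\<^sup>+x. \<integral>\<^sup>+s. (P s x)\<^sup>2 \<partial>lborel \<partial>lborel)"
    by (intro nn_integral_cmult) measurable
  also have "(\<integral>\<^sup>+x. \<integral>\<^sup>+s. (P s x)\<^sup>2 \<partial>lborel \<partial>lborel) = (\<integral>\<^sup>+t. \<integral>\<^sup>+x. (P t x)\<^sup>2 \<partial>lborel \<partial>lborel)"
    by (rule lborel_pair.Fubini') measurable
  finally show ?thesis .
qed

lemma abs_conv_square_finite:
  assumes a: "integrable lborel a"
    and [measurable]: "case_prod P \<in> borel_measurable (lborel \<Otimes>\<^sub>M (lborel :: 'a::euclidean_space measure))"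
    and P: "(\<integral>\<^sup>+t. \<integral>\<^sup>+x. (P t x)\<^sup>2 \<partial>lborel \<partial>lborel) < \<infinity>"
  shows "(\<integral>\<^sup>+t. \<integral>\<^sup>+x. (abs_conv a (\<lambda>s. P s x) t)\<^sup>2 \<partial>lborel \<partial>lborel) < \<infinity>"
proof -
  note [measurable] = integrable_measurable_borel[OF a]
  have "(\<integral>\<^sup>+t. \<integral>\<^sup>+x. (abs_conv a (\<lambda>s. P s x) t)\<^sup>2 \<partial>lborel \<partial>lborel)
    \<le> (\<integral>\<^sup>+s. ennreal \<bar>a s\<bar> \<partial>lborel)\<^sup>2 * (\<integral>\<^sup>+t. \<integral>\<^sup>+x. (P t x)\<^sup>2 \<partial>lborel \<partial>lborel)"
    by (rule nn_integral_square_abs_conv_le) auto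
  also have "\<dots> < \<infinity>"
    using P a by (auto simp: ennreal_mult_less_top power_less_top_ennreal integrable_iff_bounded)
  finally show ?thesis .
qed

lemma AE_AE_finite_of_square:
  fixes F :: "real \<Rightarrow> 'a::euclidean_space \<Rightarrow> ennreal"
  assumes [measurable]: "case_prod F \<in> borel_measurable (lborel \<Otimes>\<^sub>M lborel)"
    and fin: "(\<integral>\<^sup>+t. \<integral>\<^sup>+x. (F t x)\<^sup>2 \<partial>lborel \<partial>lborel) < \<infinity>"
  shows "AE t in lborel. (\<integral>\<^sup>+x. (F t x)\<^sup>2 \<partial>lborel) < \<infinity>"
    and "AE t in lborel. AE x in lborel. F t x < \<infinity>"
proof -
  have "AE t in lborel. (\<integral>\<^sup>+x. (F t x)\<^sup>2 \<partial>lborel) \<noteq> \<infinity>"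
    using fin by (intro nn_integral_PInf_AE) auto
  then show *: "AE t in lborel. (\<integral>\<^sup>+x. (F t x)\<^sup>2 \<partial>lborel) < \<infinity>"
    by (simp add: less_top)
  show "AE t in lborel. AE x in lborel. F t x < \<infinity>"
    using *
  proof eventually_elim
    case (elim t)
    then have "AE x in lborel. (F t x)\<^sup>2 \<noteq> \<infinity>"
      by (intro nn_integral_PInf_AE) auto
    then show ?case
      by eventually_elim (auto simp: less_top power_less_top_ennreal)
  qed
qed

lemma sq_integrable_time_conv:
  assumes a: "integrable lborel a" and p: "sq_integrable p"
  shows "sq_integrable (time_conv a p)"
proof -
  note [measurable] = integrable_measurable_borel[OF a] sq_integrable_measurable[OF p]
  have "(\<integral>\<^sup>+t. \<integral>\<^sup>+x. (ennreal (norm (time_conv a p t x)))\<^sup>2 \<partial>lborel \<partial>lborel)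
     \<le> (\<integral>\<^sup>+t. \<integral>\<^sup>+x. (abs_conv a (\<lambda>s. ennreal (norm (p s x))) t)\<^sup>2 \<partial>lborel \<partial>lborel)"
    unfolding time_conv_def by (intro nn_integral_mono power_mono line_conv_norm_le) auto
  also have "\<dots> < \<infinity>"
    using sq_integrable_finite[OF p] by (intro abs_conv_square_finite a) auto
  finally show ?thesis
    unfolding sq_integrable_def time_conv_def[abs_def] by simp
qed

lemma nn_integral_mult_finite:
  fixes F G :: "real \<Rightarrow> 'a::euclidean_space \<Rightarrow> ennreal"
  assumes [measurable]: "case_prod F \<in> borel_measurable (lborel \<Otimes>\<^sub>M lborel)"
      "case_prod G \<in> borel_measurable (lborel \<Otimes>\<^sub>M lborel)"
    and "(\<integral>\<^sup>+t. \<integral>\<^sup>+x. (F t x)\<^sup>2 \<partial>lborel \<partial>lborel) < \<infinity>"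
      "(\<integral>\<^sup>+t. \<integral>\<^sup>+x. (G t x)\<^sup>2 \<partial>lborel \<partial>lborel) < \<infinity>"
  shows "(\<integral>\<^sup>+t. \<integral>\<^sup>+x. F t x * G t x \<partial>lborel \<partial>lborel) < \<infinity>"
proof -
  have "(\<integral>\<^sup>+t. \<integral>\<^sup>+x. F t x * G t x \<partial>lborel \<partial>lborel)
     \<le> (\<integral>\<^sup>+t. \<integral>\<^sup>+x. (F t x)\<^sup>2 + (G t x)\<^sup>2 \<partial>lborel \<partial>lborel)"
  proof (intro nn_integral_mono)
    fix t x
    have "F t x * G t x \<le> 2 * F t x * G t x"
      using mult_right_mono[of 1 2 "F t x * G t x"] by (simp add: mult.assoc)
    also have "\<dots> \<le> (F t x)\<^sup>2 + (G t x)\<^sup>2"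
      by (rule sum_of_squares_ge_ennreal)
    finally show "F t x * G t x \<le> (F t x)\<^sup>2 + (G t x)\<^sup>2" .
  qed
  also have "\<dots> < \<infinity>"
    using assms by (simp add: nn_integral_add)
  finally show ?thesis .
qed

lemma inner_le_ennreal:
  "ennreal (norm (v \<bullet> w)) \<le> ennreal (norm v) * ennreal (norm w)"
  using Cauchy_Schwarz_ineq2[of v w] by (simp add: ennreal_mult''[symmetric] ennreal_leI)

lemma st_inner_finite:
  assumes p: "sq_integrable p" and q: "sq_integrable q"
  shows "(\<integral>\<^sup>+t. \<integral>\<^sup>+x. norm (p t x \<bullet> q t x) \<partial>lborel \<partial>lborel) < \<infinity>"
proof -
  note [measurable] = sq_integrable_measurable[OF p] sq_integrable_measurable[OF q]
  have "(\<integral>\<^sup>+t. \<integral>\<^sup>+x. norm (p t x \<bullet> q t x) \<partial>lborel \<partial>lborel)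
     \<le> (\<integral>\<^sup>+t. \<integral>\<^sup>+x. ennreal (norm (p t x)) * ennreal (norm (q t x)) \<partial>lborel \<partial>lborel)"
    by (intro nn_integral_mono inner_le_ennreal)
  also have "\<dots> < \<infinity>"
    using p q by (intro nn_integral_mult_finite sq_integrable_finite) auto
  finally show ?thesis .
qed

lemma st_inner_integrable:
  assumes p: "sq_integrable p" and q: "sq_integrable q"
  shows "integrable (lborel \<Otimes>\<^sub>M lborel) (\<lambda>(t, x). p t x \<bullet> q t x)"
proof -
  note [measurable] = sq_integrable_measurable[OF p] sq_integrable_measurable[OF q]
  show ?thesis
    by (rule Fubini_iterated(1)) (use st_inner_finite[OF p q] in auto)
qed

lemma st_inner_eq_integral:
  assumes p: "sq_integrable p" and q: "sq_integrable q"
  shows "st_inner p q = (LINT (t, x)|(lborel \<Otimes>\<^sub>M lborel). p t x \<bullet> q t x)"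
  using lborel_pair.integral_fst'[OF st_inner_integrable[OF p q]] by (simp add: st_inner_def)

lemma st_inner_commute: "st_inner p q = st_inner q p"
  by (simp add: st_inner_def inner_commute)

lemma st_inner_add_right:
  assumes "sq_integrable p" "sq_integrable q" "sq_integrable r"
  shows "st_inner r (\<lambda>t x. p t x + q t x) = st_inner r p + st_inner r q"
  using Bochner_Integration.integral_add[OF st_inner_integrable[OF assms(3,1)] st_inner_integrable[OF assms(3,2)]]
  by (simp add: st_inner_eq_integral assms sq_integrable_add case_prod_beta' inner_add_right)

lemma st_inner_diff_right:
  assumes "sq_integrable p" "sq_integrable q" "sq_integrable r"
  shows "st_inner r (\<lambda>t x. p t x - q t x) = st_inner r p - st_inner r q"
  using Bochner_Integration.integral_diff[OF st_inner_integrable[OF assms(3,1)] st_inner_integrable[OF assms(3,2)]]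
  by (simp add: st_inner_eq_integral assms sq_integrable_diff case_prod_beta' inner_diff_right)

lemma st_inner_cong_AE:
  assumes p: "sq_integrable p" and q: "sq_integrable q" and r: "sq_integrable r"
    and eq: "AE t in lborel. AE x in lborel. p t x \<bullet> r t x = q t x \<bullet> r t x"
  shows "st_inner p r = st_inner q r"
proof -
  note [measurable] = sq_integrable_measurable[OF p] sq_integrable_measurable[OF q]
    sq_integrable_measurable[OF r]
  show ?thesis
    unfolding st_inner_def
  proof (rule integral_cong_AE)
    show "AE t in lborel. (LINT x|lborel. p t x \<bullet> r t x) = (LINT x|lborel. q t x \<bullet> r t x)"
      using eq by eventually_elim (rule integral_cong_AE, auto)
  qed measurable
qed

text \<open>
  Absolute convergence of the form: it is bounded by the product of \<open>|a| * |p|\<close>, which is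
  square-integrable by Young's inequality, with \<open>|q|\<close>.
\<close>

lemma conv_form_finite:
  assumes a: "integrable lborel a" and p: "sq_integrable p" and q: "sq_integrable q"
  shows "(\<integral>\<^sup>+t. \<integral>\<^sup>+s. \<integral>\<^sup>+x. norm (a (t - s) * (p s x \<bullet> q t x)) \<partial>lborel \<partial>lborel \<partial>lborel) < \<infinity>"
proof -
  note [measurable] = integrable_measurable_borel[OF a] sq_integrable_measurable[OF p]
    sq_integrable_measurable[OF q]
  have "(\<integral>\<^sup>+t. \<integral>\<^sup>+s. \<integral>\<^sup>+x. norm (a (t - s) * (p s x \<bullet> q t x)) \<partial>lborel \<partial>lborel \<partial>lborel)
      = (\<integral>\<^sup>+t. \<integral>\<^sup>+x. \<integral>\<^sup>+s. norm (a (t - s) * (p s x \<bullet> q t x)) \<partial>lborel \<partial>lborel \<partial>lborel)"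
    by (intro nn_integral_cong lborel_pair.Fubini'[symmetric]) measurable
  also have "\<dots> \<le> (\<integral>\<^sup>+t. \<integral>\<^sup>+x. abs_conv a (\<lambda>s. ennreal (norm (p s x))) t * ennreal (norm (q t x)) \<partial>lborel \<partial>lborel)"
  proof (intro nn_integral_mono)
    fix t x
    have "(\<integral>\<^sup>+s. norm (a (t - s) * (p s x \<bullet> q t x)) \<partial>lborel)
       \<le> (\<integral>\<^sup>+s. ennreal \<bar>a (t - s)\<bar> * ennreal (norm (p s x)) * ennreal (norm (q t x)) \<partial>lborel)"
      by (intro nn_integral_mono)
         (auto simp: abs_mult ennreal_mult'' mult.assoc intro!: mult_left_mono inner_le_ennreal[simplified])
    also have "\<dots> = abs_conv a (\<lambda>s. ennreal (norm (p s x))) t * ennreal (norm (q t x))"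
      unfolding abs_conv_def by (intro nn_integral_multc) measurable
    finally show "(\<integral>\<^sup>+s. norm (a (t - s) * (p s x \<bullet> q t x)) \<partial>lborel)
      \<le> abs_conv a (\<lambda>s. ennreal (norm (p s x))) t * ennreal (norm (q t x))" .
  qed
  also have "\<dots> < \<infinity>"
    using sq_integrable_finite[OF p] sq_integrable_finite[OF q]
    by (intro nn_integral_mult_finite abs_conv_square_finite a) auto
  finally show ?thesis .
qed

lemma conv_form_finite':
  assumes a: "integrable lborel a" and p: "sq_integrable p" and q: "sq_integrable q"
  shows "(\<integral>\<^sup>+t. \<integral>\<^sup>+s. norm (a (t - s) * (LINT x|lborel. p s x \<bullet> q t x)) \<partial>lborel \<partial>lborel) < \<infinity>"
proof -
  have "norm (a (t - s) * (LINT x|lborel. p s x \<bullet> q t x))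
      \<le> (\<integral>\<^sup>+x. norm (a (t - s) * (p s x \<bullet> q t x)) \<partial>lborel)" for t s
  proof (cases "integrable lborel (\<lambda>x. a (t - s) * (p s x \<bullet> q t x))")
    case True
    from integral_norm_bound_ennreal[OF this] show ?thesis by simp
  next
    case False
    then have "(LINT x|lborel. a (t - s) * (p s x \<bullet> q t x)) = 0"
      by (rule not_integrable_integral_eq)
    then have "a (t - s) * (LINT x|lborel. p s x \<bullet> q t x) = 0" by simp
    then show ?thesis by (simp only: norm_zero ennreal_0 zero_le)
  qed
  then have "(\<integral>\<^sup>+t. \<integral>\<^sup>+s. norm (a (t - s) * (LINT x|lborel. p s x \<bullet> q t x)) \<partial>lborel \<partial>lborel)
      \<le> (\<integral>\<^sup>+t. \<integral>\<^sup>+s. \<integral>\<^sup>+x. norm (a (t - s) * (p s x \<bullet> q t x)) \<partial>lborel \<partial>lborel \<partial>lborel)"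
    by (intro nn_integral_mono)
  also note conv_form_finite[OF assms]
  finally show ?thesis .
qed

lemma conv_form_measurable:
  assumes a: "integrable lborel a" and p: "sq_integrable p" and q: "sq_integrable q"
  shows "(\<lambda>(t, s). a (t - s) * (LINT x|lborel. p s x \<bullet> q t x)) \<in> borel_measurable (lborel \<Otimes>\<^sub>M lborel)"
proof -
  note [measurable] = integrable_measurable_borel[OF a] sq_integrable_measurable[OF p]
    sq_integrable_measurable[OF q]
  show ?thesis by measurable
qed

lemma conv_form_Fubini:
  assumes "integrable lborel a" "sq_integrable p" "sq_integrable q"
  shows "integrable (lborel \<Otimes>\<^sub>M lborel) (\<lambda>(t, s). a (t - s) * (LINT x|lborel. p s x \<bullet> q t x))"
    and "(LINT t|lborel. LINT s|lborel. a (t - s) * (LINT x|lborel. p s x \<bullet> q t x))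
       = (LINT s|lborel. LINT t|lborel. a (t - s) * (LINT x|lborel. p s x \<bullet> q t x))"
    and "integrable lborel (\<lambda>t. LINT s|lborel. a (t - s) * (LINT x|lborel. p s x \<bullet> q t x))"
    and "AE t in lborel. integrable lborel (\<lambda>s. a (t - s) * (LINT x|lborel. p s x \<bullet> q t x))"
  using Fubini_iterated[OF conv_form_measurable[OF assms] conv_form_finite'[OF assms]] by auto

text \<open>
  Integrating out \<open>s\<close> first puts the convolution on \<open>p\<close>; integrating out \<open>t\<close> first puts its adjoint,
  the backward convolution, on \<open>q\<close>.
\<close>

lemma conv_form_eq_st_inner:
  assumes a: "integrable lborel a" and p: "sq_integrable p" and q: "sq_integrable q"
  shows "conv_form a p q = st_inner (time_conv a p) q"
proof -
  note [measurable] = integrable_measurable_borel[OF a] sq_integrable_measurable[OF p]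
    sq_integrable_measurable[OF q]
  have fin: "AE t in lborel. (\<integral>\<^sup>+s. \<integral>\<^sup>+x. norm (a (t - s) * (p s x \<bullet> q t x)) \<partial>lborel \<partial>lborel) \<noteq> \<infinity>"
    using conv_form_finite[OF assms] by (intro nn_integral_PInf_AE) auto
  have fin2: "AE t in lborel. AE x in lborel. abs_conv a (\<lambda>s. ennreal (norm (p s x))) t < \<infinity>"
    using sq_integrable_finite[OF p] by (intro AE_AE_finite_of_square(2) abs_conv_square_finite a) auto
  show ?thesis
    unfolding conv_form_def st_inner_def
  proof (rule integral_cong_AE)
    show "AE t in lborel. (LINT s|lborel. a (t - s) * (LINT x|lborel. p s x \<bullet> q t x)) =
        (LINT x|lborel. time_conv a p t x \<bullet> q t x)"
      using fin fin2
    proof eventually_elim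
      case (elim t)
      have "(LINT s|lborel. a (t - s) * (LINT x|lborel. p s x \<bullet> q t x))
         = (LINT s|lborel. LINT x|lborel. a (t - s) * (p s x \<bullet> q t x))"
        by simp
      also have "\<dots> = (LINT x|lborel. LINT s|lborel. a (t - s) * (p s x \<bullet> q t x))"
        using elim(1) by (intro Fubini_iterated(2)) (auto simp: less_top)
      also have "\<dots> = (LINT x|lborel. time_conv a p t x \<bullet> q t x)"
      proof (rule integral_cong_AE)
        show "AE x in lborel. (LINT s|lborel. a (t - s) * (p s x \<bullet> q t x)) = time_conv a p t x \<bullet> q t x"
          using elim(2)
        proof eventually_elim
          case (elim x)
          have "integrable lborel (\<lambda>s. a (t - s) *\<^sub>R p s x)"
            by (rule line_conv_integrable_at) (use elim in auto)
          from integral_inner_left[OF this, of "q t x"] show ?case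
            by (simp add: time_conv_def line_conv_def)
        qed
      qed (auto simp: time_conv_def)
      finally show ?case .
    qed
  qed (auto simp: time_conv_def)
qed

lemma conv_form_swap:
  assumes a: "integrable lborel a" and p: "sq_integrable p" and q: "sq_integrable q"
  shows "conv_form a p q = conv_form (\<lambda>s. a (- s)) q p"
  unfolding conv_form_def using conv_form_Fubini(2)[OF assms] by (simp add: inner_commute)

lemma integrable_reflect:
  fixes a :: "real \<Rightarrow> real"
  shows "integrable lborel a \<Longrightarrow> integrable lborel (\<lambda>s. a (- s))"
  using lborel_integrable_real_affine[of a "-1" 0] by simp

lemma conv_form_eq_st_inner':
  assumes a: "integrable lborel a" and p: "sq_integrable p" and q: "sq_integrable q"
  shows "conv_form a p q = st_inner p (time_conv (\<lambda>s. a (- s)) q)"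
  by (simp add: conv_form_swap[OF assms] conv_form_eq_st_inner[OF integrable_reflect[OF a] q p]
      st_inner_commute)

lemma conv_form_assoc:
  assumes a: "integrable lborel a" and b: "integrable lborel b"
    and p: "sq_integrable p" and q: "sq_integrable q"
  shows "conv_form a (time_conv b p) q = conv_form (line_conv a b) p q"
proof -
  note [measurable] = integrable_measurable_borel[OF a] integrable_measurable_borel[OF b]
    sq_integrable_measurable[OF p] sq_integrable_measurable[OF q]
  have "AE t in lborel. AE x in lborel.
      abs_conv a (abs_conv b (\<lambda>s. ennreal (norm (p s x)))) t < \<infinity>"
    using sq_integrable_finite[OF p] 
    by (intro AE_AE_finite_of_square(2) abs_conv_square_finite a b) auto
  then have "AE t in lborel. AE x in lborel.
      time_conv a (time_conv b p) t x \<bullet> q t x = time_conv (line_conv a b) p t x \<bullet> q t x"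
  proof eventually_elim
    case (elim t)
    then show ?case
    proof eventually_elim
      case (elim x)
      have "line_conv a (line_conv b (\<lambda>s. p s x)) t = line_conv (line_conv a b) (\<lambda>s. p s x) t"
        by (rule line_conv_assoc_at) (use elim in auto)
      then show ?case
        by (simp add: time_conv_def)
    qed
  qed
  then show ?thesis
    using assms by (subst (1 2) conv_form_eq_st_inner)
       (auto intro!: st_inner_cong_AE sq_integrable_time_conv integrable_line_conv)
qed

lemma conv_form_add_kernel:
  assumes a: "integrable lborel a" and b: "integrable lborel b"
    and p: "sq_integrable p" and q: "sq_integrable q"
  shows "conv_form (\<lambda>s. a s + b s) p q = conv_form a p q + conv_form b p q"
proof -
  have eq: "conv_form a p q = (LINT (t, s)|(lborel \<Otimes>\<^sub>M lborel). a (t - s) * (LINT x|lborel. p s x \<bullet> q t x))"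
    if "integrable lborel a" for a
    using lborel_pair.integral_fst'[OF conv_form_Fubini(1)[OF that p q]]
    by (simp add: conv_form_def)
  have "integrable lborel (\<lambda>s. a s + b s)"
    using a b by simp
  from eq[OF this] show ?thesis
    using Bochner_Integration.integral_add[OF conv_form_Fubini(1)[OF a p q]
        conv_form_Fubini(1)[OF b p q]]
    by (simp add: eq a b case_prod_beta' distrib_right)
qed

lemma conv_form_scale_kernel: "conv_form (\<lambda>s. c * a s) p q = c * conv_form a p q"
  by (simp add: conv_form_def mult.assoc)

text \<open>
  Only time differences in \<open>(-T, T)\<close> occur when both arguments live on \<open>(0, T)\<close>. This is what makes
  the kernel identities, which hold on \<open>(0, T)\<close> only, applicable to the truncated kernels, whose
  convolutions are supported on \<open>(0, 2 T)\<close>.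
\<close>

lemma conv_form_cong_kernel:
  assumes a: "integrable lborel a" and b: "integrable lborel b"
    and p: "sq_integrable p" and q: "sq_integrable q"
    and supp: "\<And>t x. t \<notin> {0<..<T} \<Longrightarrow> p t x = 0" "\<And>t x. t \<notin> {0<..<T} \<Longrightarrow> q t x = 0"
    and eq: "AE s in lborel. s \<in> {-T<..<T} \<longrightarrow> a s = b s"
  shows "conv_form a p q = conv_form b p q"
proof -
  note [measurable] = integrable_measurable_borel[OF a] integrable_measurable_borel[OF b]
    sq_integrable_measurable[OF p] sq_integrable_measurable[OF q]
  show ?thesis
    unfolding conv_form_def
  proof (rule Bochner_Integration.integral_cong[OF refl], rule integral_cong_AE)
    fix t
    show "AE s in lborel. a (t - s) * (LINT x|lborel. p s x \<bullet> q t x) = b (t - s) * (LINT x|lborel. p s x \<bullet> q t x)"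
      using AE_reflect_shift[OF eq, of t]
    proof eventually_elim
      case (elim s)
      show ?case
      proof (cases "s \<in> {0<..<T} \<and> t \<in> {0<..<T}")
        case True
        with elim show ?thesis by auto
      next
        case False
        then have "p s x \<bullet> q t x = 0" for x
          using supp[of s x] supp[of t x] by auto
        then show ?thesis by simp
      qed
    qed
  qed measurable
qed

lemma conv_form_add_left:
  assumes a: "integrable lborel a" and p: "sq_integrable p" and p': "sq_integrable p'"
    and q: "sq_integrable q"
  shows "conv_form a (\<lambda>t x. p t x + p' t x) q = conv_form a p q + conv_form a p' q"
  using assms
  by (simp add: conv_form_eq_st_inner' sq_integrable_add st_inner_commute[of _ "time_conv _ q"]
      st_inner_add_right sq_integrable_time_conv integrable_reflect)

lemma conv_form_scale_left: "conv_form a (\<lambda>t x. c *\<^sub>R p t x) q = c * conv_form a p q"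
  by (simp add: conv_form_def mult.left_commute)

lemma conv_form_diff_left:
  assumes a: "integrable lborel a" and p: "sq_integrable p" and p': "sq_integrable p'"
    and q: "sq_integrable q"
  shows "conv_form a (\<lambda>t x. p t x - p' t x) q = conv_form a p q - conv_form a p' q"
  using conv_form_add_left[OF a p sq_integrable_scale[OF p', of "-1"] q]
    conv_form_scale_left[of a "-1" p' q] by simp

section \<open>Positivity of the resolvent of the first kind\<close>

text \<open>
  Dyadic unions decrease to a given compact set, so the integral over every compact subset is
  nonnegative, and inner regularity carries this over to the set \<open>{g < 0}\<close>. Rational end points keep the
  family of intervals countable, which matters when \<open>g\<close> depends on a parameter up to null sets.
\<close>

lemma AE_nonneg_of_rational_intervals:
  fixes g :: "real \<Rightarrow> real"
  assumes g: "integrable lborel g"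
    and nonneg: "\<And>a b. a \<in> \<rat> \<Longrightarrow> b \<in> \<rat> \<Longrightarrow> 0 < a \<Longrightarrow> a < b \<Longrightarrow> b < T \<Longrightarrow>
      0 \<le> (LINT s:{a<..<b}|lborel. g s)"
  shows "AE s in lborel. s \<in> {0<..<T} \<longrightarrow> 0 \<le> g s"
proof -
  note [measurable] = integrable_measurable_borel[OF g]
  have compact_nonneg: "0 \<le> (LINT s:C|lborel. g s)" if C: "compact C" "C \<subseteq> {0<..<T}" for C
  proof (cases "C = {}")
    case False
    define U where "U m = {s :: real. \<lfloor>2 ^ m * s\<rfloor> \<in> (\<lambda>s. \<lfloor>2 ^ m * s\<rfloor>) ` C}" for m :: nat
    have [measurable]: "C \<in> sets borel"
      using C by (simp add: borel_compact)
    have floor_dist: "\<bar>s - r\<bar> < 1 / 2 ^ m" if "\<lfloor>2 ^ m * s\<rfloor> = \<lfloor>2 ^ m * r\<rfloor>" for s r :: real and m :: nat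
    proof -
      have "\<bar>2 ^ m * s - 2 ^ m * r\<bar> < 1"
        using that by linarith
      then have "2 ^ m * \<bar>s - r\<bar> < 1"
        by (simp add: abs_mult flip: right_diff_distrib)
      then show ?thesis
        by (simp add: field_simps)
    qed
    have fin: "finite ((\<lambda>s. \<lfloor>2 ^ m * s\<rfloor>) ` C)" for m :: nat
    proof (rule finite_subset)
      show "(\<lambda>s. \<lfloor>2 ^ m * s\<rfloor>) ` C \<subseteq> {0..\<lfloor>2 ^ m * T\<rfloor>}"
        using C(2) by (force intro!: floor_mono)
    qed simp
    have cell: "{s :: real. \<lfloor>2 ^ m * s\<rfloor> = i} = {of_int i / 2 ^ m ..< (of_int i + 1) / 2 ^ m}" for m :: nat and i
      by (auto simp: floor_eq_iff field_simps)
    have meas[measurable]: "U m \<in> sets borel" for m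
    proof -
      have "U m = (\<Union>i\<in>(\<lambda>s. \<lfloor>2 ^ m * s\<rfloor>) ` C. {s. \<lfloor>2 ^ m * s\<rfloor> = i})"
        by (auto simp: U_def)
      also have "\<dots> \<in> sets borel"
        using fin by (intro sets.finite_UN) (simp_all only: cell, auto)
      finally show ?thesis .
    qed
    obtain x where x: "x \<in> C" "\<forall>y\<in>C. x \<le> y"
      using compact_attains_inf[OF C(1) False] by blast
    obtain z where z: "z \<in> C" "\<forall>y\<in>C. y \<le> z"
      using compact_attains_sup[OF C(1) False] by blast
    have "(\<lambda>m. 1 / 2 ^ m :: real) \<longlonglongrightarrow> 0"
      using LIMSEQ_realpow_zero[of "1/2"] by (simp add: power_one_over)
    note small = order_tendstoD(2)[OF this]
    have U_nonneg: "eventually (\<lambda>m. 0 \<le> (LINT s:U m|lborel. g s)) sequentially"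
    proof -
      have "0 < x" "0 < T - z"
        using x z C(2) by auto
      then have "eventually (\<lambda>m. 1 / 2 ^ m < x \<and> 1 / 2 ^ m < T - z) sequentially"
        using small by (intro eventually_conj) auto
      then show ?thesis
      proof eventually_elim
        case (elim m)
        have "(LINT s:U m|lborel. g s)
            = (LINT s:(\<Union>i\<in>(\<lambda>s. \<lfloor>2 ^ m * s\<rfloor>) ` C. {s. \<lfloor>2 ^ m * s\<rfloor> = i})|lborel. g s)"
          by (rule arg_cong[where f="\<lambda>A. set_lebesgue_integral lborel A g"]) (auto simp: U_def)
        also have "\<dots> = (\<Sum>i\<in>(\<lambda>s. \<lfloor>2 ^ m * s\<rfloor>) ` C. LINT s:{s. \<lfloor>2 ^ m * s\<rfloor> = i}|lborel. g s)"
        proof (rule set_integral_finite_Union[OF fin])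
          show "disjoint_family_on (\<lambda>i. {s. \<lfloor>2 ^ m * s\<rfloor> = i}) ((\<lambda>s. \<lfloor>2 ^ m * s\<rfloor>) ` C)"
            by (auto simp: disjoint_family_on_def)
          show "{s :: real. \<lfloor>2 ^ m * s\<rfloor> = i} \<in> sets lborel" for i
            unfolding cell by simp
          show "set_integrable lborel {s. \<lfloor>2 ^ m * s\<rfloor> = i} g" for i
            unfolding set_integrable_def cell by (intro integrable_mult_indicator g) simp
        qed
        also have "\<dots> \<ge> 0"
        proof (rule sum_nonneg)
          fix i assume "i \<in> (\<lambda>s. \<lfloor>2 ^ m * s\<rfloor>) ` C"
          then obtain y where y: "y \<in> C" "i = \<lfloor>2 ^ m * y\<rfloor>" by auto
          define a b :: real where "a = of_int i / 2 ^ m" and "b = (of_int i + 1) / 2 ^ m"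
          have yab: "a \<le> y" "y < b" "b = a + 1 / 2 ^ m"
            using y(2) cell[of m i] by (auto simp: a_def b_def add_divide_distrib)
          have "0 < a" "a < b" "b < T"
            using yab elim x z y(1) by (auto simp: not_le dest!: bspec[of C _ y])
          moreover have "a \<in> \<rat>" "b \<in> \<rat>"
            by (auto simp: a_def b_def)
          ultimately have "0 \<le> (LINT s:{a<..<b}|lborel. g s)"
            by (intro nonneg)
          also have "\<dots> = (LINT s:{a..<b}|lborel. g s)"
            unfolding set_lebesgue_integral_def
            by (intro integral_cong_AE)
               (use AE_lborel_singleton[of a] in \<open>auto elim!: eventually_mono simp: indicator_def\<close>)
          finally show "0 \<le> (LINT s:{s. \<lfloor>2 ^ m * s\<rfloor> = i}|lborel. g s)"
            unfolding cell a_def b_def .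
        qed
        finally show ?case .
      qed
    qed
    have "(\<lambda>m. LINT s:U m|lborel. g s) \<longlonglongrightarrow> (LINT s:C|lborel. g s)"
      unfolding set_lebesgue_integral_def
    proof (rule integral_dominated_convergence[where w="\<lambda>s. norm (g s)"])
      show "AE s in lborel. (\<lambda>m. indicat_real (U m) s *\<^sub>R g s) \<longlonglongrightarrow> indicat_real C s *\<^sub>R g s"
      proof (intro AE_I2)
        fix s :: real
        have "eventually (\<lambda>m. s \<in> U m \<longleftrightarrow> s \<in> C) sequentially"
        proof (cases "s \<in> C")
          case True
          then show ?thesis by (auto simp: U_def)
        next
          case False
          then have "0 < infdist s C"
            using C(1) \<open>C \<noteq> {}\<close> compact_imp_closed in_closed_iff_infdist_zero infdist_nonneg
            by (metis less_eq_real_def)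
          from small[OF this] show ?thesis
          proof eventually_elim
            case (elim m)
            have "s \<notin> U m"
            proof
              assume "s \<in> U m"
              then obtain y where y: "y \<in> C" "\<lfloor>2 ^ m * s\<rfloor> = \<lfloor>2 ^ m * y\<rfloor>"
                by (auto simp: U_def)
              have "infdist s C \<le> dist s y"
                by (rule infdist_le[OF y(1)])
              also have "\<dots> < 1 / 2 ^ m"
                using floor_dist[OF y(2)] by (simp add: dist_real_def)
              finally show False using elim by simp
            qed
            with False show ?case by simp
          qed
        qed
        then show "(\<lambda>m. indicat_real (U m) s *\<^sub>R g s) \<longlonglongrightarrow> indicat_real C s *\<^sub>R g s"
          by (intro tendsto_eventually) (auto elim!: eventually_mono simp: indicator_def)
      qed
    qed (use g in \<open>auto simp: indicator_def\<close>)
    then show ?thesis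
      by (rule tendsto_lowerbound[OF _ U_nonneg]) simp
  qed (simp add: set_lebesgue_integral_def)
  define B where "B = {s \<in> {0<..<T}. g s < 0}"
  \<comment> \<open>The measure whose density is the negative part of \<open>g\<close>.\<close>
  define M where "M = density lborel (\<lambda>s. ennreal (- g s))"
  have [measurable]: "B \<in> sets borel"
    unfolding B_def by measurable
  have "emeasure M B = 0"
  proof -
    have "emeasure M UNIV \<noteq> \<infinity>"
    proof -
      have "emeasure M UNIV \<le> (\<integral>\<^sup>+s. ennreal (norm (g s)) \<partial>lborel)"
        by (simp add: M_def emeasure_density nn_integral_mono ennreal_leI)
      also have "\<dots> < \<infinity>"
        using g by (simp add: integrable_iff_bounded)
      finally show ?thesis by simp
    qed
    then have "emeasure M B = (SUP C \<in> {C. C \<subseteq> B \<and> compact C}. emeasure M C)"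
      by (intro inner_regular) (auto simp: M_def)
    also have "\<dots> \<le> 0"
    proof (rule SUP_least)
      fix C assume "C \<in> {C. C \<subseteq> B \<and> compact C}"
      then have C: "C \<subseteq> B" "compact C" by auto
      have [measurable]: "C \<in> sets borel"
        using C by (simp add: borel_compact)
      have int: "integrable lborel (\<lambda>s. indicator C s * - g s)"
        using integrable_mult_indicator[of C lborel g] g by simp
      have "emeasure M C = (\<integral>\<^sup>+s. ennreal (indicator C s * - g s) \<partial>lborel)"
        by (simp add: M_def emeasure_density)
           (intro nn_integral_cong, auto simp: indicator_def)
      also have "\<dots> = ennreal (LINT s|lborel. indicator C s * - g s)"
        using C by (intro nn_integral_eq_integral int AE_I2) (force simp: indicator_def B_def)
      also have "(LINT s|lborel. indicator C s * - g s) \<le> 0"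
      proof -
        have "C \<subseteq> {0<..<T}"
          using C by (auto simp: B_def)
        from compact_nonneg[OF C(2) this] show ?thesis
          by (simp add: set_lebesgue_integral_def)
      qed
      then have "ennreal (LINT s|lborel. indicator C s * - g s) \<le> 0"
        by (simp add: ennreal_neg)
      finally show "emeasure M C \<le> 0" .
    qed
    finally show ?thesis by simp
  qed
  then have "AE s in lborel. ennreal (- g s) * indicator B s = 0"
    by (subst (asm) M_def, subst (asm) emeasure_density) (auto simp: nn_integral_0_iff_AE)
  then show ?thesis
    by eventually_elim (auto simp: B_def indicator_def ennreal_eq_0_iff split: if_splits)
qed

lemma AE_zero_of_rational_intervals:
  fixes g :: "real \<Rightarrow> real"
  assumes g: "integrable lborel g"
    and zero: "\<And>a b. a \<in> \<rat> \<Longrightarrow> b \<in> \<rat> \<Longrightarrow> 0 < a \<Longrightarrow> a < b \<Longrightarrow> b < T \<Longrightarrow>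
      (LINT s:{a<..<b}|lborel. g s) = 0"
  shows "AE s in lborel. s \<in> {0<..<T} \<longrightarrow> g s = 0"
proof -
  have "AE s in lborel. s \<in> {0<..<T} \<longrightarrow> 0 \<le> g s"
    by (rule AE_nonneg_of_rational_intervals[OF g]) (simp add: zero)
  moreover have "AE s in lborel. s \<in> {0<..<T} \<longrightarrow> 0 \<le> - g s"
    using g zero by (intro AE_nonneg_of_rational_intervals) (auto simp: set_lebesgue_integral_def)
  ultimately show ?thesis
    by eventually_elim auto
qed

text \<open>
  A pair \<open>(k, l) \<in> PC\<close>, truncated to \<open>(0, T)\<close>.
\<close>

locale first_kind_pair =
  fixes T :: real and K L :: "real \<Rightarrow> real"
  assumes T_pos: "0 < T"
    and K_int: "integrable lborel K" and L_int: "integrable lborel L"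
    and K_supp: "\<And>s. s \<notin> {0<..<T} \<Longrightarrow> K s = 0" and L_supp: "\<And>s. s \<notin> {0<..<T} \<Longrightarrow> L s = 0"
    and K_nonneg: "\<And>s. 0 \<le> K s"
    and K_antimono: "\<And>s t. 0 < s \<Longrightarrow> s \<le> t \<Longrightarrow> K t \<le> K s"
    and K_L: "AE t in lborel. t \<in> {0<..<T} \<longrightarrow> line_conv K L t = 1"
begin

text \<open>
  The minimum principle behind \<open>l \<ge> 0\<close>. The function \<open>v = \<phi> * l\<close> is Lipschitz continuous, vanishes for
  \<open>t \<le> 0\<close>, and \<open>k * v = 1 * \<phi>\<close> increases at a rate of at least \<open>\<eta> t\<close>. If \<open>v\<close> had a negative minimum at
  \<open>t\<^sub>1\<close>, then, because \<open>k\<close> is nonincreasing, \<open>(k * v)(t\<^sub>1) - (k * v)(t\<^sub>1 - e)\<close> would be at most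
  \<open>C e \<integral>\<^sub>0\<^sup>e k\<close>. This is \<open>o(e)\<close>, even for \<open>k\<close> singular at \<open>0\<close>, whereas the increase is of order \<open>e\<close>. The
  smoothing by \<open>\<phi>\<close> is needed for the Lipschitz bound, and the slope \<open>\<eta>\<close> for kernels \<open>k\<close> that vanish
  from some point on.
\<close>

lemma conv_with_test_nonneg:
  fixes \<phi> :: "real \<Rightarrow> real"
  assumes lip: "\<And>s t. \<bar>\<phi> s - \<phi> t\<bar> \<le> c * \<bar>s - t\<bar>"
    and zero: "\<And>s. s \<le> 0 \<Longrightarrow> \<phi> s = 0"
    and bound: "\<And>s. \<bar>\<phi> s\<bar> \<le> M"
    and eta: "\<eta> > 0" "\<And>s. 0 \<le> s \<Longrightarrow> s \<le> T \<Longrightarrow> \<eta> * s \<le> \<phi> s"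
    and t0: "t0 < T"
  shows "0 \<le> line_conv \<phi> L t0"
proof (rule ccontr)
  define v where "v = line_conv \<phi> L"
  assume "\<not> 0 \<le> line_conv \<phi> L t0"
  then have neg: "v t0 < 0" by (simp add: v_def)
  have c: "c-lipschitz_on UNIV \<phi>"
  proof (rule lipschitz_onI)
    show "0 \<le> c" using lip[of 0 1] by simp
  qed (use lip in \<open>auto simp: dist_real_def\<close>)
  then have cont: "continuous_on UNIV \<phi>"
    by (rule lipschitz_on_continuous_on)
  note [measurable] = integrable_measurable_borel[OF K_int] integrable_measurable_borel[OF L_int]
    borel_measurable_continuous_onI[OF cont]
  have c0: "c \<ge> 0" using lip[of 0 1] by simp
  define C where "C = c * (LINT s|lborel. \<bar>L s\<bar>)"
  have C0: "C \<ge> 0" unfolding C_def using c0 by (intro mult_nonneg_nonneg integral_nonneg) auto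
  have int_phi: "integrable lborel (\<lambda>s. \<phi> (t - s) * L s)" for t
  proof (rule Bochner_Integration.integrable_bound[where f="\<lambda>s. M * L s"])
    show "AE s in lborel. norm (\<phi> (t - s) * L s) \<le> norm (M * L s)"
      using bound by (auto simp: abs_mult intro!: mult_right_mono order_trans[OF bound])
  qed (use L_int in auto)
  have v_lip: "\<bar>v t - v t'\<bar> \<le> C * \<bar>t - t'\<bar>" for t t'
  proof -
    have "v t - v t' = (LINT s|lborel. \<phi> (t - s) * L s - \<phi> (t' - s) * L s)"
      unfolding v_def line_conv_def using int_phi by simp
    also have "\<bar>\<dots>\<bar> \<le> (LINT s|lborel. \<bar>\<phi> (t - s) * L s - \<phi> (t' - s) * L s\<bar>)"
      by (rule integral_abs_bound)
    also have "\<dots> \<le> (LINT s|lborel. (c * \<bar>t - t'\<bar>) * \<bar>L s\<bar>)"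
    proof (rule integral_mono)
      fix s
      have "\<bar>\<phi> (t - s) * L s - \<phi> (t' - s) * L s\<bar> = \<bar>\<phi> (t - s) - \<phi> (t' - s)\<bar> * \<bar>L s\<bar>"
        by (simp add: abs_mult flip: left_diff_distrib)
      also have "\<dots> \<le> (c * \<bar>t - t'\<bar>) * \<bar>L s\<bar>"
        using lip[of "t - s" "t' - s"] by (intro mult_right_mono) auto
      finally show "\<bar>\<phi> (t - s) * L s - \<phi> (t' - s) * L s\<bar> \<le> (c * \<bar>t - t'\<bar>) * \<bar>L s\<bar>" .
    qed (use int_phi L_int in \<open>auto intro!: integrable_abs Bochner_Integration.integrable_diff\<close>)
    finally show ?thesis by (simp add: C_def mult_ac)
  qed
  have v_zero: "v t = 0" if "t \<le> 0" for t
  proof -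
    have "\<phi> (t - s) * L s = 0" for s
      using zero[of "t - s"] L_supp[of s] that by (cases "0 < s") auto
    then show ?thesis by (simp only: v_def line_conv_def real_scaleR_def) simp
  qed
  have v_bound: "\<bar>v t\<bar> \<le> M * (LINT s|lborel. \<bar>L s\<bar>)" for t
  proof -
    have "\<bar>v t\<bar> \<le> (LINT s|lborel. \<bar>\<phi> (t - s) * L s\<bar>)"
      unfolding v_def line_conv_def real_scaleR_def by (rule integral_abs_bound)
    also have "\<dots> \<le> (LINT s|lborel. M * \<bar>L s\<bar>)"
      using integrable_abs[OF int_phi[of t]] L_int bound
      by (intro integral_mono) (auto simp: abs_mult intro!: mult_right_mono)
    finally show ?thesis by simp
  qed
  have v_cont: "continuous_on UNIV v"
    by (rule lipschitz_on_continuous_on[of C], rule lipschitz_onI) (use v_lip C0 in \<open>auto simp: dist_real_def\<close>)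
  note [measurable] = borel_measurable_continuous_onI[OF v_cont]
  have "0 < t0" using neg v_zero[of t0] by (cases "0 < t0") auto
  then obtain t1 where t1: "t1 \<in> {0..t0}" "\<And>s. s \<in> {0..t0} \<Longrightarrow> v t1 \<le> v s"
    using continuous_attains_inf[of "{0..t0}" v] continuous_on_subset[OF v_cont] by (auto simp: atLeastAtMost_iff)
  define m where "m = - v t1"
  have m: "m > 0" using t1(2)[of t0] neg \<open>0 < t0\<close> by (simp add: m_def)
  have t1_pos: "0 < t1" using m v_zero[of t1] by (cases "0 < t1") (auto simp: m_def)
  have t1_T: "t1 < T" using t1(1) t0 by auto
  have v_ge: "- m \<le> v s" if "s \<le> t1" for s
    using that t1 v_zero[of s] m by (cases "0 \<le> s") (auto simp: m_def)
  \<comment> \<open>\<open>K * (\<phi> * L) = \<phi> * (K * L) = \<phi> * 1\<close> on \<open>(-\<infinity>, T)\<close>.\<close>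
  have Kv: "line_conv K v t = (LINT s:{0<..<t}|lborel. \<phi> s)" if t: "t < T" for t
  proof -
    have fin0: "(\<integral>\<^sup>+s. ennreal \<bar>a (t - s)\<bar> \<partial>lborel) < \<infinity>" if "integrable lborel a" for a :: "real \<Rightarrow> real" and t
    proof -
      have [measurable]: "a \<in> borel_measurable borel" by (rule integrable_measurable_borel[OF that])
      show ?thesis
        using that by (subst nn_integral_reflect_shift[of "\<lambda>s. ennreal \<bar>a s\<bar>"]) (auto simp: integrable_iff_bounded)
    qed
    have bnd: "abs_conv \<phi> P t \<le> ennreal M * (\<integral>\<^sup>+s. P s \<partial>lborel)" if [measurable]: "P \<in> borel_measurable borel" for P t
      unfolding abs_conv_def
      by (subst nn_integral_cmult[symmetric]) (auto intro!: nn_integral_mono mult_right_mono ennreal_leI bound)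
    have finL: "(\<integral>\<^sup>+s. ennreal (norm (L s)) \<partial>lborel) < \<infinity>"
      using L_int by (simp add: integrable_iff_bounded)
    have fin1: "abs_conv K (abs_conv \<phi> (\<lambda>s. ennreal (norm (L s)))) t < \<infinity>"
    proof -
      have "abs_conv K (abs_conv \<phi> (\<lambda>s. ennreal (norm (L s)))) t
          \<le> (\<integral>\<^sup>+s. ennreal \<bar>K (t - s)\<bar> * (ennreal M * (\<integral>\<^sup>+s. ennreal (norm (L s)) \<partial>lborel)) \<partial>lborel)"
        unfolding abs_conv_def[of K] by (intro nn_integral_mono mult_left_mono bnd) auto
      also have "\<dots> < \<infinity>"
        using fin0[OF K_int, of t] finL by (simp add: nn_integral_multc ennreal_mult_less_top)
      finally show ?thesis .
    qed
    have fin2: "abs_conv \<phi> (abs_conv K (\<lambda>s. ennreal (norm (L s)))) t < \<infinity>"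
    proof -
      have "abs_conv \<phi> (abs_conv K (\<lambda>s. ennreal (norm (L s)))) t
          \<le> ennreal M * (\<integral>\<^sup>+s. abs_conv K (\<lambda>s. ennreal (norm (L s))) s \<partial>lborel)"
        by (rule bnd) measurable
      also have "\<dots> < \<infinity>"
        using finL K_int
        by (subst nn_integral_abs_conv) (auto simp: ennreal_mult_less_top integrable_iff_bounded)
      finally show ?thesis .
    qed
    have "line_conv K v t = line_conv (line_conv K \<phi>) L t"
      unfolding v_def by (rule line_conv_assoc_at) (use fin1 in auto)
    also have "\<dots> = line_conv (line_conv \<phi> K) L t"
      by (simp add: line_conv_commute)
    also have "\<dots> = line_conv \<phi> (line_conv K L) t"
      by (rule line_conv_assoc_at[symmetric]) (use fin2 in auto)
    also have "\<dots> = (LINT s|lborel. indicator {0<..<t} (t - s) * \<phi> (t - s))"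
      unfolding line_conv_def[of \<phi>]
    proof (rule integral_cong_AE)
      show "AE s in lborel. \<phi> (t - s) *\<^sub>R line_conv K L s = indicator {0<..<t} (t - s) * \<phi> (t - s)"
        using K_L AE_lborel_singleton[of 0]
      proof eventually_elim
        case (elim s)
        have "K (s - r) * L r = 0" if "s \<le> 0" for r
          using that K_supp[of "s - r"] L_supp[of r] by (cases "0 < r") auto
        then have "line_conv K L s = 0" if "s \<le> 0"
          using that by (simp only: line_conv_def real_scaleR_def) simp
        with elim t zero[of "t - s"] show ?case
          by (cases "0 < s"; cases "s < t") (auto simp: indicator_def)
      qed
    qed measurable
    also have "\<dots> = (LINT s:{0<..<t}|lborel. \<phi> s)"
      using integral_reflect_shift[of "\<lambda>s. indicator {0<..<t} s * \<phi> s" t]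
      by (simp add: set_lebesgue_integral_def)
    finally show ?thesis .
  qed
  have Kv_int: "integrable lborel (\<lambda>s. K (s - e) * v (t1 - s))" for e
  proof (rule Bochner_Integration.integrable_bound[where f="\<lambda>s. (M * (LINT s|lborel. \<bar>L s\<bar>)) * K (s - e)"])
    show "AE s in lborel. norm (K (s - e) * v (t1 - s)) \<le> norm ((M * (LINT s|lborel. \<bar>L s\<bar>)) * K (s - e))"
      using v_bound
      by (auto simp: abs_mult mult.commute[of "\<bar>K _\<bar>"] simp flip: mult.assoc abs_mult[of M] intro!: mult_right_mono order_trans[OF v_bound])
  qed (use K_int lborel_integrable_real_affine[of K 1 "-e"] in auto)
  have K_shift: "integrable lborel (\<lambda>s. K (s - e))" for e
    using K_int lborel_integrable_real_affine[of K 1 "-e"] by auto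
  have set_int: "integrable lborel (\<lambda>s. indicator {0<..<b} s * \<phi> s)" for b
    using integrableI_bounded_set_indicator[of "{0<..<b}" lborel \<phi> M] bound
    by (cases "0 \<le> b") auto
  define k0 where "k0 e = (LINT s|lborel. indicator {0<..e} s * K s)" for e
  \<comment> \<open>Both sides bound the difference quotient of \<open>K * v\<close> on \<open>[t1 - e, t1]\<close>, from below by the growth of
    \<open>1 * \<phi>\<close> and from above by the minimality of \<open>v t1\<close>.\<close>
  have main: "\<eta> * (t1 - e) \<le> C * k0 e" if e: "0 < e" "e < t1" for e
  proof -
    have "\<eta> * (t1 - e) * e = (LINT s|lborel. indicator {t1 - e..<t1} s * (\<eta> * (t1 - e)))"
      using e by simp
    also have "\<dots> \<le> (LINT s|lborel. indicator {0<..<t1} s * \<phi> s - indicator {0<..<t1 - e} s * \<phi> s)"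
    proof (rule integral_mono)
      show "integrable lborel (\<lambda>s. indicator {0<..<t1} s * \<phi> s - indicator {0<..<t1 - e} s * \<phi> s)"
        by (intro Bochner_Integration.integrable_diff set_int)
      fix s
      have "\<eta> * (t1 - e) \<le> \<phi> s" if "t1 - e \<le> s" "s < t1"
        by (rule order_trans[OF mult_left_mono eta(2)]) (use that e t1_T eta(1) in auto)
      then show "indicator {t1 - e..<t1} s * (\<eta> * (t1 - e))
          \<le> indicator {0<..<t1} s * \<phi> s - indicator {0<..<t1 - e} s * \<phi> s"
        using e by (auto simp: indicator_def)
      show "integrable lborel (\<lambda>s. indicator {t1 - e..<t1} s * (\<eta> * (t1 - e)))"
        using e by (intro integrable_mult_left integrable_real_indicator) auto
    qed
    also have "\<dots> = line_conv K v t1 - line_conv K v (t1 - e)"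
    proof -
      show ?thesis
        using e t1_T by (simp add: Kv set_lebesgue_integral_def set_int)
    qed
    also have "line_conv K v t1 = (LINT s|lborel. K (s - 0) * v (t1 - s))"
      by (subst line_conv_commute) (simp add: line_conv_def mult.commute)
    also have "line_conv K v (t1 - e) = (LINT s|lborel. K (s - e) * v (t1 - s))"
      using integral_shift[of "\<lambda>s. K s * v (t1 - e - s)" e]
      by (subst line_conv_commute) (simp add: line_conv_def mult.commute algebra_simps)
    also have "(LINT s|lborel. K (s - 0) * v (t1 - s)) - (LINT s|lborel. K (s - e) * v (t1 - s))
       = (LINT s|lborel. K (s - 0) * v (t1 - s) - K (s - e) * v (t1 - s))"
      by (rule Bochner_Integration.integral_diff[symmetric]) (rule Kv_int)+
    \<comment> \<open>For \<open>s \<le> e\<close> the kernel is singular, but \<open>v (t1 - s)\<close> is within \<open>C e\<close> of the minimum \<open>- m\<close>;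
      for \<open>s > e\<close> the kernel difference is nonpositive and \<open>v \<ge> - m\<close> suffices.\<close>
    also have "\<dots> \<le> (LINT s|lborel. C * e * (indicator {0<..e} s * K s)
        - m * (indicator {0<..<t1} s * K s - indicator {0<..<t1} s * K (s - e)))"
    proof (rule integral_mono)
      show "integrable lborel (\<lambda>s. K (s - 0) * v (t1 - s) - K (s - e) * v (t1 - s))"
        by (intro Bochner_Integration.integrable_diff Kv_int)
      show "integrable lborel (\<lambda>s. C * e * (indicator {0<..e} s * K s)
        - m * (indicator {0<..<t1} s * K s - indicator {0<..<t1} s * K (s - e)))"
        using integrable_mult_indicator[OF _ K_int] integrable_mult_indicator[OF _ K_shift[of e]]
        by (intro Bochner_Integration.integrable_diff integrable_mult_right) auto
      fix s
      consider "s \<le> 0" | "0 < s" "s \<le> e" | "e < s" "s < t1" | "t1 \<le> s" by linarith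
      then show "K (s - 0) * v (t1 - s) - K (s - e) * v (t1 - s)
        \<le> C * e * (indicator {0<..e} s * K s)
         - m * (indicator {0<..<t1} s * K s - indicator {0<..<t1} s * K (s - e))"
      proof cases
        case 1
        then show ?thesis using e K_supp[of s] K_supp[of "s - e"] by simp
      next
        case 2
        have "v (t1 - s) \<le> - m + C * e"
          using v_lip[of "t1 - s" t1] mult_left_mono[OF 2(2) C0] 2 by (auto simp: m_def)
        from mult_left_mono[OF this K_nonneg[of s]] show ?thesis
          using 2 e K_supp[of "s - e"] by (simp add: algebra_simps)
      next
        case 3
        have "(K s - K (s - e)) * (v (t1 - s) + m) \<le> 0"
          using 3 e K_antimono[of "s - e" s] v_ge[of "t1 - s"] by (intro mult_nonpos_nonneg) auto
        then show ?thesis using 3 e by (simp add: algebra_simps)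
      next
        case 4
        then show ?thesis using e v_zero[of "t1 - s"] by simp
      qed
    qed
    also have "\<dots> = C * e * k0 e - m * ((LINT s|lborel. indicator {0<..<t1} s * K s)
        - (LINT s|lborel. indicator {0<..<t1} s * K (s - e)))"
      unfolding k0_def
      using integrable_mult_indicator[OF _ K_int] integrable_mult_indicator[OF _ K_shift[of e]]
      by (subst Bochner_Integration.integral_diff) auto
    also have "\<dots> \<le> C * e * k0 e"
    proof -
      have "(LINT s|lborel. indicator {0<..<t1} s * K (s - e)) = (LINT s|lborel. indicator {0<..<t1} (s + e) * K s)"
        using integral_shift[of "\<lambda>s. indicator {0<..<t1} (s + e) * K s" e] by simp
      also have "\<dots> \<le> (LINT s|lborel. indicator {0<..<t1} s * K s)"
      proof (rule integral_mono)
        show "integrable lborel (\<lambda>s. indicator {0<..<t1} (s + e) * K s)"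
          by (rule Bochner_Integration.integrable_bound[OF K_int]) (auto simp: indicator_def)
        show "integrable lborel (\<lambda>s. indicator {0<..<t1} s * K s)"
          using integrable_mult_indicator[OF _ K_int, of "{0<..<t1}"] by simp
        show "indicator {0<..<t1} (s + e) * K s \<le> indicator {0<..<t1} s * K s" for s
          using e K_nonneg[of s] K_supp[of s] by (auto simp: indicator_def)
      qed
      finally show ?thesis using m by (simp add: mult_nonneg_nonneg)
    qed
    finally have "e * (\<eta> * (t1 - e)) \<le> e * (C * k0 e)" by (simp add: mult_ac)
    then show ?thesis using e by simp
  qed
  have seq: "(\<lambda>i. 1 / real (Suc i)) \<longlonglongrightarrow> 0"
    using LIMSEQ_inverse_real_of_nat by (simp add: inverse_eq_divide)
  have "(\<lambda>i. k0 (1 / real (Suc i))) \<longlonglongrightarrow> (LINT s::real|lborel. 0)"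
    unfolding k0_def
  proof (rule integral_dominated_convergence[where w="\<lambda>s. norm (K s)"])
    show "AE s in lborel. (\<lambda>i. indicator {0<..1 / real (Suc i)} s * K s) \<longlonglongrightarrow> 0"
    proof (intro AE_I2)
      fix s :: real
      show "(\<lambda>i. indicator {0<..1 / real (Suc i)} s * K s) \<longlonglongrightarrow> 0"
      proof (cases "0 < s")
        case True
        from order_tendstoD(2)[OF seq this]
        have "eventually (\<lambda>i. indicator {0<..1 / real (Suc i)} s * K s = 0) sequentially"
          by eventually_elim (simp add: indicator_def)
        then show ?thesis
          by (rule tendsto_eventually)
      qed (simp add: indicator_def)
    qed
  qed (use K_int in \<open>auto simp: indicator_def\<close>)
  then have "(\<lambda>i. C * k0 (1 / real (Suc i)) - \<eta> * (t1 - 1 / real (Suc i))) \<longlonglongrightarrow> C * 0 - \<eta> * (t1 - 0)"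
    by (intro tendsto_intros seq) simp
  moreover have "eventually (\<lambda>i. 0 \<le> C * k0 (1 / real (Suc i)) - \<eta> * (t1 - 1 / real (Suc i))) sequentially"
    using order_tendstoD(2)[OF seq t1_pos] by eventually_elim (use main in auto)
  ultimately have "0 \<le> C * 0 - \<eta> * (t1 - 0)"
    by (rule tendsto_lowerbound) simp
  then show False using eta(1) t1_pos by (simp add: mult_le_0_iff)
qed

text \<open>
  The minimum principle is applied to trapezoids \<open>\<phi>\<close> that converge to the indicator of a reflected
  interval, with a ramp of slope \<open>\<eta> = 1/j\<close> added; in the limit, \<open>l\<close> has nonnegative integral over every
  interval.
\<close>

lemma resolvent_nonneg: "AE s in lborel. 0 \<le> L s"
proof -
  note [measurable] = integrable_measurable_borel[OF L_int]
  have "AE s in lborel. s \<in> {0<..<T} \<longrightarrow> 0 \<le> L s"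
  proof (rule AE_nonneg_of_rational_intervals[OF L_int])
    fix a b :: real
    assume ab: "0 < a" "a < b" "b < T"
    \<comment> \<open>Reflection at \<open>t > b\<close> maps \<open>(a, b)\<close> into \<open>(0, \<infinity>)\<close>, where the trapezoids may be supported.\<close>
    define t where "t = (b + T) / 2"
    have t: "b < t" "t < T" using ab by (auto simp: t_def)
    define trap where "trap j s = min 1 (max 0 (real j * min (s - (t - b)) (t - a - s)))" for j :: nat and s
    define ramp where "ramp s = min (max s 0) T" for s
    define \<phi> where "\<phi> j s = trap j s + 1 / real j * ramp s" for j :: nat and s
    have trap_lip: "\<bar>trap j s - trap j r\<bar> \<le> real j * \<bar>s - r\<bar>" for j s r
    proof -
      have "\<bar>trap j s - trap j r\<bar> \<le>
         \<bar>real j * min (s - (t - b)) (t - a - s) - real j * min (r - (t - b)) (t - a - r)\<bar>"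
        unfolding trap_def by linarith
      also have "\<dots> = real j * \<bar>min (s - (t - b)) (t - a - s) - min (r - (t - b)) (t - a - r)\<bar>"
        by (simp add: abs_mult flip: right_diff_distrib)
      also have "\<dots> \<le> real j * \<bar>s - r\<bar>"
        by (intro mult_left_mono) linarith+
      finally show ?thesis .
    qed
    have ramp_lip: "\<bar>ramp s - ramp r\<bar> \<le> \<bar>s - r\<bar>" for s r
      unfolding ramp_def by linarith
    have nonneg: "0 \<le> line_conv (\<phi> j) L t" if j: "j \<ge> 1" for j
    proof (rule conv_with_test_nonneg)
      show "\<bar>\<phi> j s - \<phi> j r\<bar> \<le> (real j + 1) * \<bar>s - r\<bar>" for s r
      proof -
        have "\<bar>\<phi> j s - \<phi> j r\<bar> \<le> \<bar>trap j s - trap j r\<bar> + \<bar>1 / real j * (ramp s - ramp r)\<bar>"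
          unfolding \<phi>_def right_diff_distrib by linarith
        also have "\<bar>1 / real j * (ramp s - ramp r)\<bar> \<le> 1 * \<bar>s - r\<bar>"
          unfolding abs_mult using j by (intro mult_mono ramp_lip) (auto simp: divide_le_eq)
        finally show ?thesis using trap_lip[of j s r] by (simp add: algebra_simps)
      qed
      show "\<phi> j s = 0" if "s \<le> 0" for s
      proof -
        have "real j * min (s - (t - b)) (t - a - s) \<le> 0"
          using that t by (intro mult_nonneg_nonpos) auto
        then show ?thesis using that T_pos by (simp add: \<phi>_def trap_def ramp_def)
      qed
      show "\<bar>\<phi> j s\<bar> \<le> 1 + T" for s
      proof -
        have "\<bar>1 / real j * ramp s\<bar> \<le> 1 * T"
          unfolding abs_mult using j T_pos by (intro mult_mono) (auto simp: divide_le_eq ramp_def)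
        moreover have "\<bar>trap j s\<bar> \<le> 1" unfolding trap_def by linarith
        ultimately show ?thesis unfolding \<phi>_def by linarith
      qed
      show "1 / real j > 0" using j by simp
      show "1 / real j * s \<le> \<phi> j s" if "0 \<le> s" "s \<le> T" for s
        using that by (simp add: \<phi>_def ramp_def trap_def)
    qed (use t in simp)
    have [measurable]: "trap j \<in> borel_measurable borel" "ramp \<in> borel_measurable borel" for j
      unfolding trap_def ramp_def by measurable
    have "(\<lambda>j. line_conv (\<phi> (Suc j)) L t) \<longlonglongrightarrow> (LINT s|lborel. indicator {a<..<b} s *\<^sub>R L s)"
      unfolding line_conv_def
    proof (rule integral_dominated_convergence[where w="\<lambda>s. (1 + T) * \<bar>L s\<bar>"])
      show "AE s in lborel. (\<lambda>j. \<phi> (Suc j) (t - s) *\<^sub>R L s) \<longlonglongrightarrow> indicat_real {a<..<b} s *\<^sub>R L s"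
      proof (intro AE_I2 tendsto_intros)
        fix s :: real
        have lim_trap: "(\<lambda>j. trap (Suc j) (t - s)) \<longlonglongrightarrow> indicat_real {a<..<b} s"
        proof (cases "s \<in> {a<..<b}")
          case True
          define d where "d = min (b - s) (s - a)"
          have d: "d > 0" using True by (auto simp: d_def)
          obtain N :: nat where N: "1 / d < real N" using reals_Archimedean2 by blast
          have "trap (Suc j) (t - s) = 1" if "j \<ge> N" for j
          proof -
            have "1 \<le> real (Suc j) * d"
              using N that d by (simp add: divide_less_eq) (smt (verit, best) mult_right_mono of_nat_mono)
            moreover have "min (t - s - (t - b)) (t - a - (t - s)) = d" by (simp add: d_def)
            ultimately show ?thesis by (simp add: trap_def)
          qed
          then have "eventually (\<lambda>j. trap (Suc j) (t - s) = indicat_real {a<..<b} s) sequentially"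
            using True by (auto simp: eventually_sequentially)
          then show ?thesis by (rule tendsto_eventually)
        next
          case False
          have "real (Suc j) * min (t - s - (t - b)) (t - a - (t - s)) \<le> 0" for j
            using False by (intro mult_nonneg_nonpos) auto
          then show ?thesis using False by (simp add: trap_def)
        qed
        have "(\<lambda>j. trap (Suc j) (t - s) + 1 / real (Suc j) * ramp (t - s)) \<longlonglongrightarrow> indicat_real {a<..<b} s + 0 * ramp (t - s)"
          using LIMSEQ_inverse_real_of_nat
          by (intro tendsto_intros lim_trap) (simp add: inverse_eq_divide)
        then show "(\<lambda>j. \<phi> (Suc j) (t - s)) \<longlonglongrightarrow> indicat_real {a<..<b} s"
          by (simp add: \<phi>_def)
      qed
      show "AE s in lborel. norm (\<phi> (Suc j) (t - s) *\<^sub>R L s) \<le> (1 + T) * \<bar>L s\<bar>" for j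
      proof (intro AE_I2)
        fix s
        have "\<bar>1 / real (Suc j) * ramp (t - s)\<bar> \<le> 1 * T"
          unfolding abs_mult using T_pos by (intro mult_mono) (auto simp: divide_le_eq ramp_def)
        moreover have "\<bar>trap (Suc j) (t - s)\<bar> \<le> 1" unfolding trap_def by linarith
        ultimately have "\<bar>\<phi> (Suc j) (t - s)\<bar> \<le> 1 + T" unfolding \<phi>_def by linarith
        then show "norm (\<phi> (Suc j) (t - s) *\<^sub>R L s) \<le> (1 + T) * \<bar>L s\<bar>"
          by (simp add: abs_mult mult_right_mono)
      qed
    qed (use L_int in \<open>auto simp: \<phi>_def\<close>)
    then show "0 \<le> (LINT s:{a<..<b}|lborel. L s)"
      unfolding set_lebesgue_integral_def
      by (rule tendsto_lowerbound) (auto simp: nonneg)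
  qed
  then show ?thesis
    by eventually_elim (use L_supp in \<open>metis order_refl\<close>)
qed

end

section \<open>The regularized kernel and its derivative\<close>

abbreviation window :: "real \<Rightarrow> real \<Rightarrow> real" where
  "window T \<equiv> indicator {0<..<T}"

lemma window_integrable: "integrable lborel (window T)"
  by (cases "0 \<le> T") (auto intro: integrable_real_indicator)

lemma line_conv_window:
  assumes "\<And>s. s \<le> 0 \<Longrightarrow> p s = 0" "t \<le> T"
  shows "line_conv (window T) p t = (LINT s:{0<..<t}|lborel. p s)"
  unfolding line_conv_def set_lebesgue_integral_def
  by (intro Bochner_Integration.integral_cong refl) (use assms in \<open>auto simp: indicator_def not_less\<close>)

lemma continuous_on_integral_upto:
  fixes g :: "real \<Rightarrow> real"
  assumes g: "integrable lborel g"
  shows "continuous_on UNIV (\<lambda>t. LINT s:{0<..<t}|lborel. g s)"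
  unfolding continuous_on_sequentially
proof (intro ballI allI impI, elim conjE)
  fix X :: "nat \<Rightarrow> real" and t
  assume X: "X \<longlonglongrightarrow> t"
  note [measurable] = integrable_measurable_borel[OF g]
  have "(\<lambda>i. LINT s:{0<..<X i}|lborel. g s) \<longlonglongrightarrow> (LINT s:{0<..<t}|lborel. g s)"
    unfolding set_lebesgue_integral_def
  proof (rule integral_dominated_convergence[where w="\<lambda>s. norm (g s)"])
    show "AE s in lborel. (\<lambda>i. indicat_real {0<..<X i} s *\<^sub>R g s) \<longlonglongrightarrow> indicat_real {0<..<t} s *\<^sub>R g s"
      using AE_lborel_singleton[of t]
    proof eventually_elim
      case (elim s)
      then have "eventually (\<lambda>i. s < X i \<longleftrightarrow> s < t) sequentially"
        using order_tendstoD(1)[OF X, of s] order_tendstoD(2)[OF X, of s]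
        by (cases "s < t") (auto elim!: eventually_mono)
      then have "eventually (\<lambda>i. indicat_real {0<..<X i} s *\<^sub>R g s = indicat_real {0<..<t} s *\<^sub>R g s) sequentially"
        by eventually_elim (simp add: indicator_def)
      then show ?case by (rule tendsto_eventually)
    qed
  qed (use g in \<open>auto simp: indicator_def\<close>)
  then show "((\<lambda>t. LINT s:{0<..<t}|lborel. g s) \<circ> X) \<longlonglongrightarrow> (LINT s:{0<..<t}|lborel. g s)"
    by (simp add: o_def)
qed

lemma AE_zero_of_constant_primitive:
  fixes g :: "real \<Rightarrow> real"
  assumes g: "integrable lborel g"
    and const: "AE t in lborel. t \<in> {0<..<T} \<longrightarrow> (LINT s:{0<..<t}|lborel. g s) = c"
  shows "AE s in lborel. s \<in> {0<..<T} \<longrightarrow> g s = 0"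
proof (rule AE_zero_of_rational_intervals[OF g])
  define W where "W t = (LINT s:{0<..<t}|lborel. g s)" for t
  have W_const: "W t = c" if t: "t \<in> {0<..<T}" for t
  proof (rule ccontr)
    assume "W t \<noteq> c"
    have "open ({0<..<T} \<inter> W -` (- {c}))"
      using continuous_on_integral_upto[OF g]
      by (intro open_Int open_vimage) (auto simp: W_def)
    moreover have "t \<in> {0<..<T} \<inter> W -` (- {c})"
      using t \<open>W t \<noteq> c\<close> by simp
    ultimately obtain e where "e > 0" "ball t e \<subseteq> {0<..<T} \<inter> W -` (- {c})"
      by (rule openE)
    then have e: "e > 0" "{t - e<..<t + e} \<subseteq> {0<..<T} \<inter> W -` (- {c})"
      by (simp_all only: ball_eq_greaterThanLessThan)
    have "AE s in lborel. s \<notin> {t - e<..<t + e}"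
      using const
    proof eventually_elim
      case (elim s)
      then show ?case
        using subsetD[OF e(2), of s] by (auto simp: W_def)
    qed
    then have "emeasure lborel {t - e<..<t + e} = 0"
      by (subst (asm) AE_iff_null_sets[symmetric]) auto
    then show False using e by simp
  qed
  fix a b :: real assume ab: "0 < a" "a < b" "b < T"
  note [measurable] = integrable_measurable_borel[OF g]
  have "(LINT s:{a<..<b}|lborel. g s) = (LINT s|lborel. indicator {0<..<b} s * g s - indicator {0<..<a} s * g s)"
    unfolding set_lebesgue_integral_def
    by (intro integral_cong_AE) (use AE_lborel_singleton[of a] ab in \<open>auto elim!: eventually_mono simp: indicator_def\<close>)
  also have "\<dots> = W b - W a"
    unfolding W_def set_lebesgue_integral_def real_scaleR_def
    using integrable_mult_indicator[OF _ g, of "{0<..<a}"] integrable_mult_indicator[OF _ g, of "{0<..<b}"]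
    by (intro Bochner_Integration.integral_diff) auto
  finally show "(LINT s:{a<..<b}|lborel. g s) = 0"
    using W_const[of a] W_const[of b] ab by simp
qed

text \<open>
  In addition, \<open>H\<close> is the truncation of the kernel \<open>h\<^sub>n\<close>. The parameter \<open>n\<close> is real since only the
  equation \<open>h + n h * l = n l\<close> matters here.
\<close>

locale resolvent_pair = first_kind_pair +
  fixes n :: real and H :: "real \<Rightarrow> real"
  assumes H_int: "integrable lborel H"
    and H_supp: "\<And>s. s \<notin> {0<..<T} \<Longrightarrow> H s = 0"
    and H_eq: "AE t in lborel. t \<in> {0<..<T} \<longrightarrow> H t + n * line_conv H L t = n * L t"
begin

text \<open>
  Convolve the equation for \<open>h\<close> with \<open>k\<close>: since \<open>k * (h * l) = h * (k * l) = h * 1\<close>, it becomes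
  \<open>k * h + n (1 * h) = n\<close>.
\<close>

lemma regularized_kernel_eq:
  "AE t in lborel. t \<in> {0<..<T} \<longrightarrow>
     line_conv K H t = n - n * (LINT s:{0<..<t}|lborel. H s)"
proof -
  note [measurable] = integrable_measurable_borel[OF K_int] integrable_measurable_borel[OF L_int]
    integrable_measurable_borel[OF H_int]
  note HL_int = integrable_line_conv(1)[OF H_int L_int]
  have supp0: "s \<le> 0 \<Longrightarrow> K s = 0" "s \<le> 0 \<Longrightarrow> L s = 0" "s \<le> 0 \<Longrightarrow> H s = 0" for s
    using K_supp L_supp H_supp by auto
  have A1: "AE t in lborel. line_conv K (line_conv H L) t = line_conv (line_conv K H) L t"
    by (rule line_conv_assoc_AE[OF K_int H_int L_int])
  have A2: "AE t in lborel. line_conv H (line_conv K L) t = line_conv (line_conv K H) L t"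
    using line_conv_assoc_AE[OF H_int K_int L_int] by (simp add: line_conv_commute)
  have A3: "AE t in lborel. abs_conv K (\<lambda>s. ennreal (norm (H s))) t < \<infinity>"
    by (rule integrable_line_conv(2)[OF K_int H_int])
  have A4: "AE t in lborel. abs_conv K (\<lambda>s. ennreal (norm (line_conv H L s))) t < \<infinity>"
    by (rule integrable_line_conv(2)[OF K_int HL_int])
  show ?thesis
    using A1 A2 A3 A4 K_L
  proof eventually_elim
    case (elim t)
    show ?case
    proof
      assume t: "t \<in> {0<..<T}"
      have "line_conv K (\<lambda>s. H s + n * line_conv H L s) t = line_conv K (\<lambda>s. n * L s) t"
      proof (rule line_conv_cong_AE)
        show "AE s in lborel. s < t \<longrightarrow> H s + n * line_conv H L s = n * L s"
          using H_eq
        proof eventually_elim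
          case (elim s)
          then show ?case
            using t supp0[of s] line_conv_eq_0[of H L s] supp0 by (cases "s \<le> 0") auto
        qed
      qed (auto simp: supp0)
      also have "\<dots> = n * line_conv K L t"
        by (simp add: line_conv_def mult.left_commute)
      also have "\<dots> = n" using elim t by simp
      also have "line_conv K (\<lambda>s. H s + n * line_conv H L s) t
          = line_conv K H t + n * line_conv K (line_conv H L) t"
      proof -
        have "integrable lborel (\<lambda>s. K (t - s) * H s)" "integrable lborel (\<lambda>s. K (t - s) * line_conv H L s)"
          using line_conv_integrable_at[of K H t] line_conv_integrable_at[of K "line_conv H L" t] elim by auto
        then show ?thesis
          by (simp add: line_conv_def[of K] distrib_left mult.left_commute[of _ n])
      qed
      also have "line_conv K (line_conv H L) t = line_conv H (line_conv K L) t"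
        using elim by simp
      also have "\<dots> = line_conv H (window T) t"
      proof (rule line_conv_cong_AE)
        show "AE s in lborel. s < t \<longrightarrow> line_conv K L s = window T s"
          using K_L
        proof eventually_elim
          case (elim s)
          then show ?case
            using t line_conv_eq_0[of K L s] supp0 by (cases "s \<le> 0") auto
        qed
      qed (auto simp: supp0)
      also have "\<dots> = (LINT s:{0<..<t}|lborel. H s)"
        using t by (subst line_conv_commute) (rule line_conv_window, auto simp: supp0)
      finally show "line_conv K H t = n - n * (LINT s:{0<..<t}|lborel. H s)"
        by simp
    qed
  qed
qed

text \<open>
  A derivative of a locally absolutely continuous function is unique almost everywhere; it is
  compared here with the one read off from \<open>k * h = n - n (1 * h)\<close>.
\<close>

lemma kernel_derivative_eq:
  assumes d: "integrable lborel d"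
    and c: "AE t in lborel. t \<in> {0<..<T} \<longrightarrow> line_conv K H t = c + (LINT s:{0<..<t}|lborel. d s)"
  shows "AE s in lborel. s \<in> {0<..<T} \<longrightarrow> - d s = n * H s"
proof -
  have int: "integrable lborel (\<lambda>s. d s + n * H s)"
    using d H_int by simp
  have "AE s in lborel. s \<in> {0<..<T} \<longrightarrow> d s + n * H s = 0"
  proof (rule AE_zero_of_constant_primitive[OF int, where c="n - c"])
    have eq: "(LINT s:{0<..<t}|lborel. d s + n * H s)
       = (LINT s:{0<..<t}|lborel. d s) + n * (LINT s:{0<..<t}|lborel. H s)" for t
      using integrable_mult_indicator[OF _ d, of "{0<..<t}"] integrable_mult_indicator[OF _ H_int, of "{0<..<t}"]
      by (simp add: set_lebesgue_integral_def distrib_left mult.left_commute[of _ n])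
    show "AE t in lborel. t \<in> {0<..<T} \<longrightarrow> (LINT s:{0<..<t}|lborel. d s + n * H s) = n - c"
      using c regularized_kernel_eq by eventually_elim (unfold eq, auto)
  qed
  then show ?thesis
    by eventually_elim auto
qed

text \<open>
  The formula \<open>(k\<^sub>n * v)' = n (v - h * v)\<close> in integrated form. It holds at every \<open>t\<close>, although \<open>k\<^sub>n\<close> is
  known almost everywhere only.
\<close>

lemma regularized_kernel_conv_eq_primitive:
  fixes v :: "real \<Rightarrow> real"
  assumes v: "integrable lborel v" and v_supp: "\<And>s. s \<notin> {0<..<T} \<Longrightarrow> v s = 0"
    and t: "t \<in> {0<..<T}"
  shows "(LINT s:{0<..<t}|lborel. line_conv K H (t - s) * v s)
    = (LINT s:{0<..<t}|lborel. n * (v s - line_conv H v s))"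
proof -
  note [measurable] = integrable_measurable_borel[OF K_int] integrable_measurable_borel[OF H_int]
    integrable_measurable_borel[OF v]
  have supp0: "s \<le> 0 \<Longrightarrow> H s = 0" "s \<le> 0 \<Longrightarrow> v s = 0" for s
    using H_supp v_supp by auto
  have Hv: "integrable lborel (line_conv H v)"
    by (rule integrable_line_conv(1)[OF H_int v])
  define A where "A = line_conv (window T) H"
  have A_int: "integrable lborel A"
    unfolding A_def by (rule integrable_line_conv(1)[OF window_integrable H_int])
  note [measurable] = integrable_measurable_borel[OF A_int]
  have A_bound: "\<bar>A s\<bar> \<le> (LINT s|lborel. \<bar>H s\<bar>)" for s
  proof -
    have "\<bar>A s\<bar> \<le> (LINT r|lborel. \<bar>window T (s - r) * H r\<bar>)"
      unfolding A_def line_conv_def real_scaleR_def by (rule integral_abs_bound)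
    also have "\<dots> \<le> (LINT s|lborel. \<bar>H s\<bar>)"
      using H_int
      by (intro integral_mono integrable_abs Bochner_Integration.integrable_bound[OF H_int])
         (auto simp: indicator_def)
    finally show ?thesis .
  qed
  have Av: "integrable lborel (\<lambda>s. A (t - s) * v s)"
  proof (rule Bochner_Integration.integrable_bound[where f="\<lambda>s. (LINT s|lborel. \<bar>H s\<bar>) * v s"])
    show "AE s in lborel. norm (A (t - s) * v s) \<le> norm ((LINT s|lborel. \<bar>H s\<bar>) * v s)"
      by (intro AE_I2) (auto simp: abs_mult intro!: mult_right_mono order_trans[OF A_bound])
  qed (use v in auto)
  have Wv: "integrable lborel (\<lambda>s. window T (t - s) * v s)"
    by (rule Bochner_Integration.integrable_bound[OF v]) (auto simp: indicator_def)
  have "(LINT s:{0<..<t}|lborel. line_conv K H (t - s) * v s)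
     = (LINT s|lborel. n * (window T (t - s) * v s) - n * (A (t - s) * v s))"
    unfolding set_lebesgue_integral_def
  proof (rule integral_cong_AE)
    show "AE s in lborel. indicat_real {0<..<t} s *\<^sub>R (line_conv K H (t - s) * v s)
        = n * (window T (t - s) * v s) - n * (A (t - s) * v s)"
      using AE_reflect_shift[OF regularized_kernel_eq, of t] AE_lborel_singleton[of t]
    proof eventually_elim
      case (elim s)
      consider "s \<le> 0" | "0 < s" "s < t" | "t < s" using elim by linarith
      then show ?case
      proof cases
        case 1
        then show ?thesis by (simp add: supp0)
      next
        case 2
        have A: "A (t - s) = (LINT r:{0<..<t - s}|lborel. H r)"
          unfolding A_def using t 2 by (intro line_conv_window) (auto simp: supp0)
        have "t - s \<in> {0<..<T}"
          using t 2 by auto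
        then have "line_conv K H (t - s) = n - n * A (t - s)"
          using elim(1) unfolding A by blast
        moreover have "window T (t - s) = (1 :: real)" "indicator {0<..<t} s = (1 :: real)"
          using t 2 by auto
        ultimately show ?thesis
          by (simp only: left_diff_distrib real_scaleR_def mult_1_left mult.assoc)
      next
        case 3
        have "A (t - s) = 0"
          unfolding A_def by (rule line_conv_eq_0) (use 3 supp0 in auto)
        then show ?thesis using 3 by simp
      qed
    qed
  qed measurable
  also have "\<dots> = n * line_conv (window T) v t - n * line_conv A v t"
    using Av Wv by (simp add: line_conv_def)
  also have "line_conv A v t = line_conv (window T) (line_conv H v) t"
    unfolding A_def
  proof (rule line_conv_assoc_at[symmetric])
    have "abs_conv (window T) (abs_conv H (\<lambda>s. ennreal (norm (v s)))) t
        \<le> (\<integral>\<^sup>+s. abs_conv H (\<lambda>s. ennreal (norm (v s))) s \<partial>lborel)"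
      unfolding abs_conv_def[of "window T"]
      by (intro nn_integral_mono) (auto simp: indicator_def)
    also have "\<dots> < \<infinity>"
      using H_int v by (subst nn_integral_abs_conv) (auto simp: integrable_iff_bounded ennreal_mult_less_top)
    finally show "abs_conv (window T) (abs_conv H (\<lambda>s. ennreal (norm (v s)))) t < \<infinity>" .
  qed auto
  also have "line_conv (window T) v t = (LINT s:{0<..<t}|lborel. v s)"
    using t by (intro line_conv_window) (auto simp: supp0)
  also have "line_conv (window T) (line_conv H v) t = (LINT s:{0<..<t}|lborel. line_conv H v s)"
    using t by (intro line_conv_window line_conv_eq_0) (auto simp: supp0)
  also have "n * (LINT s:{0<..<t}|lborel. v s) - n * (LINT s:{0<..<t}|lborel. line_conv H v s)
     = (LINT s:{0<..<t}|lborel. n * (v s - line_conv H v s))"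
    using integrable_mult_indicator[OF _ v, of "{0<..<t}"] integrable_mult_indicator[OF _ Hv, of "{0<..<t}"]
    by (simp add: set_lebesgue_integral_def right_diff_distrib mult.left_commute[of _ n])
  finally show ?thesis .
qed

end

section \<open>Smooth bump functions and integration by parts\<close>

lemma Ck_cmult: "Ck m f \<Longrightarrow> Ck m (\<lambda>x. c * f x)"
proof (induction m arbitrary: f)
  case 0
  then show ?case by (auto intro: continuous_intros)
next
  case (Suc m)
  then obtain f' where f': "\<And>x. (f has_derivative f' x) (at x)" "\<And>v. Ck m (\<lambda>x. f' x v)"
    by auto
  have "((\<lambda>x. c * f x) has_derivative (\<lambda>v. c * f' x v)) (at x)" for x
    by (intro has_derivative_mult_right f')
  with Suc.IH[OF f'(2)] show ?case by (auto intro!: exI[of _ "\<lambda>x v. c * f' x v"])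
qed

lemma Ck_add: "Ck m f \<Longrightarrow> Ck m g \<Longrightarrow> Ck m (\<lambda>x. f x + g x)"
proof (induction m arbitrary: f g)
  case 0
  then show ?case by (auto intro: continuous_intros)
next
  case (Suc m)
  then obtain f' g' where *: "\<And>x. (f has_derivative f' x) (at x)" "\<And>v. Ck m (\<lambda>x. f' x v)"
    "\<And>x. (g has_derivative g' x) (at x)" "\<And>v. Ck m (\<lambda>x. g' x v)"
    by auto
  have "((\<lambda>x. f x + g x) has_derivative (\<lambda>v. f' x v + g' x v)) (at x)" for x
    by (intro has_derivative_add *)
  with Suc.IH[OF *(2,4)] show ?case by (auto intro!: exI[of _ "\<lambda>x v. f' x v + g' x v"])
qed

lemma Ck_Suc_D: "Ck (Suc m) f \<Longrightarrow> Ck m f"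
proof (induction m arbitrary: f)
  case 0
  then obtain f' where "\<And>x. (f has_derivative f' x) (at x)" by auto
  then show ?case
    by (auto simp: continuous_on_eq_continuous_at intro: has_derivative_continuous)
next
  case (Suc m)
  then obtain f' where f': "\<And>x. (f has_derivative f' x) (at x)" "\<And>v. Ck (Suc m) (\<lambda>x. f' x v)"
    by (subst (asm) (2) Ck.simps(2)) blast
  with Suc.IH[OF f'(2)] show ?case by auto
qed

lemma Ck_mult: "Ck m f \<Longrightarrow> Ck m g \<Longrightarrow> Ck m (\<lambda>x. f x * g x)"
proof (induction m arbitrary: f g)
  case 0
  then show ?case by (auto intro: continuous_intros)
next
  case (Suc m)
  then obtain f' g' where *: "\<And>x. (f has_derivative f' x) (at x)" "\<And>v. Ck m (\<lambda>x. f' x v)"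
    "\<And>x. (g has_derivative g' x) (at x)" "\<And>v. Ck m (\<lambda>x. g' x v)"
    by auto
  have "((\<lambda>x. f x * g x) has_derivative (\<lambda>v. f x * g' x v + f' x v * g x)) (at x)" for x
    by (intro has_derivative_mult *)
  moreover have "Ck m (\<lambda>x. f x * g' x v + f' x v * g x)" for v
    by (intro Ck_add Suc.IH *(2,4) Ck_Suc_D[OF Suc.prems(1)] Ck_Suc_D[OF Suc.prems(2)])
  ultimately show ?case
    by (auto intro!: exI[of _ "\<lambda>x v. f x * g' x v + f' x v * g x"])
qed

text \<open>
  The functions \<open>P(1/t) exp(-1/t)\<close>, extended by zero to \<open>t \<le> 0\<close>: a family of flat functions that is
  closed under differentiation, which makes smoothness a plain induction.
\<close>

definition flat_exp :: "real poly \<Rightarrow> real \<Rightarrow> real" where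
  "flat_exp P t = (if 0 < t then poly P (1 / t) * exp (- (1 / t)) else 0)"

lemma poly_exp_tendsto_0: "((\<lambda>y. poly P y * exp (- y)) \<longlongrightarrow> (0::real)) at_top"
proof -
  have "((\<lambda>y. \<Sum>i\<le>degree P. coeff P i * (y ^ i / exp y)) \<longlongrightarrow> (\<Sum>i\<le>degree P. coeff P i * 0)) at_top"
    by (intro tendsto_intros tendsto_power_div_exp_0)
  then show ?thesis
    by (simp add: poly_altdef sum_distrib_right exp_minus divide_inverse mult.assoc)
qed

lemma flat_exp_has_derivative:
  "(flat_exp P has_real_derivative flat_exp ([:0, 0, 1:] * (P - pderiv P)) t) (at t)"
proof -
  consider "t < 0" | "t = 0" | "0 < t" by linarith
  then show ?thesis
  proof cases
    case 1
    have "(flat_exp P has_real_derivative 0) (at t)"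
      by (rule has_field_derivative_transform_within_open[where S="{..<0}" and f="\<lambda>_. 0"])
         (use 1 in \<open>auto simp: flat_exp_def\<close>)
    then show ?thesis using 1 by (simp add: flat_exp_def)
  next
    case 2
    have "((\<lambda>y. poly ([:0, 1:] * P) y * exp (- y)) \<longlongrightarrow> 0) at_top"
      by (rule poly_exp_tendsto_0)
    then have "((\<lambda>h. poly ([:0, 1:] * P) (inverse h) * exp (- inverse h)) \<longlongrightarrow> 0) (at_right 0)"
      by (rule filterlim_compose[OF _ filterlim_inverse_at_top_right])
    moreover have "eventually (\<lambda>h. flat_exp P h / h = poly ([:0, 1:] * P) (inverse h) * exp (- inverse h)) (at_right 0)"
      using eventually_at_right_less[of 0] by eventually_elim (simp add: flat_exp_def field_simps)
    ultimately have R: "((\<lambda>h. flat_exp P h / h) \<longlongrightarrow> 0) (at_right 0)"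
      by (simp add: tendsto_cong)
    have "eventually (\<lambda>h. flat_exp P h / h = 0) (at_left 0)"
      by (auto simp: eventually_at_filter flat_exp_def)
    then have L: "((\<lambda>h. flat_exp P h / h) \<longlongrightarrow> 0) (at_left 0)"
      by (rule tendsto_eventually)
    from L R have "((\<lambda>h. flat_exp P h / h) \<longlongrightarrow> 0) (at 0)"
      by (simp add: filterlim_split_at)
    then show ?thesis
      using 2 by (simp add: DERIV_def flat_exp_def)
  next
    case 3
    have "((\<lambda>t. poly P (1 / t) * exp (- (1 / t))) has_real_derivative
        flat_exp ([:0, 0, 1:] * (P - pderiv P)) t) (at t)"
      using 3
      by (auto intro!: derivative_eq_intros DERIV_chain2[OF poly_DERIV] simp: flat_exp_def power2_eq_square field_simps)
    then show ?thesis
      by (rule has_field_derivative_transform_within_open[where S="{0<..}"])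
         (use 3 in \<open>auto simp: flat_exp_def\<close>)
  qed
qed

lemma Ck_flat_exp_affine: "Ck m (\<lambda>t. flat_exp P (c * t + d))"
proof (induction m arbitrary: P)
  have deriv: "((\<lambda>t. flat_exp P (c * t + d)) has_real_derivative
      c * flat_exp ([:0, 0, 1:] * (P - pderiv P)) (c * t + d)) (at t)" for P t
  proof -
    have "((\<lambda>t. c * t + d) has_real_derivative c) (at t)"
      by (auto intro!: derivative_eq_intros)
    from DERIV_chain2[where f="flat_exp P" and g="\<lambda>t. c * t + d", OF flat_exp_has_derivative this]
    show ?thesis
      by (simp add: mult.commute)
  qed
  {
    case 0
    show ?case
      using deriv by (auto simp: continuous_on_eq_continuous_at intro!: DERIV_isCont)
  next
    case (Suc m)
    define D where "D t v = c * flat_exp ([:0, 0, 1:] * (P - pderiv P)) (c * t + d) * v" for t v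
    have "((\<lambda>t. flat_exp P (c * t + d)) has_derivative D t) (at t)" for t
      using deriv[of P t] by (simp add: has_field_derivative_def D_def[abs_def])
    moreover have "Ck m (\<lambda>t. D t v)" for v
      using Ck_cmult[OF Suc.IH[of "[:0, 0, 1:] * (P - pderiv P)"], of "c * v"]
      by (simp add: D_def mult_ac)
    ultimately show ?case
      unfolding Ck.simps by blast
  }
qed

text \<open>
  The factor \<open>j + 1\<close> drives both exponentials to \<open>1\<close> inside \<open>(a, b)\<close>, so that the bumps approximate the
  indicator of the interval from below.
\<close>

definition bump :: "real \<Rightarrow> real \<Rightarrow> nat \<Rightarrow> real \<Rightarrow> real" where
  "bump a b j t = flat_exp 1 (real (Suc j) * (t - a)) * flat_exp 1 (real (Suc j) * (b - t))"

lemma bump_support: "{t. bump a b j t \<noteq> 0} = {a<..<b}"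
  by (auto simp: bump_def flat_exp_def zero_less_mult_iff)

lemma bump_bounds: "0 \<le> bump a b j t" "bump a b j t \<le> 1"
proof -
  have "0 \<le> flat_exp 1 s" "flat_exp 1 s \<le> 1" for s
    by (auto simp: flat_exp_def)
  then show "0 \<le> bump a b j t" "bump a b j t \<le> 1"
    by (auto simp: bump_def intro: mult_le_one)
qed

lemma bump_tendsto: "(\<lambda>j. bump a b j t) \<longlonglongrightarrow> indicator {a<..<b} t"
proof -
  have flat: "(\<lambda>j. flat_exp 1 (real (Suc j) * s)) \<longlonglongrightarrow> indicator {0<..} s" for s
  proof (cases "0 < s")
    case True
    have "(\<lambda>j. exp (- (inverse (real (Suc j)) * (1 / s)))) \<longlonglongrightarrow> exp (- (0 * (1 / s)))"
      by (intro tendsto_intros LIMSEQ_inverse_real_of_nat)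
    then show ?thesis
      using True by (simp add: flat_exp_def field_simps zero_less_mult_iff add_pos_nonneg)
  next
    case False
    then show ?thesis
      by (auto simp: flat_exp_def zero_less_mult_iff)
  qed
  have "(\<lambda>j. bump a b j t) \<longlonglongrightarrow> indicator {0<..} (t - a) * indicator {0<..} (b - t)"
    unfolding bump_def by (intro tendsto_mult flat)
  also have "indicator {0<..} (t - a) * indicator {0<..} (b - t) = (indicator {a<..<b} t :: real)"
    by (auto simp: indicator_def)
  finally show ?thesis .
qed

lemma test_fun_bump:
  assumes "0 < a" "b < T"
  shows "test_fun {0<..<T} (bump a b j)"
proof -
  have "Ck m (\<lambda>t. flat_exp 1 (real (Suc j) * t + - real (Suc j) * a)
      * flat_exp 1 (- real (Suc j) * t + real (Suc j) * b))" for m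
    by (intro Ck_mult Ck_flat_exp_affine)
  then have "Ck m (bump a b j)" for m
    by (simp add: bump_def[abs_def] algebra_simps)
  moreover have cl: "closure {t. bump a b j t \<noteq> 0} \<subseteq> {a..b}"
    unfolding bump_support by (intro closure_minimal) auto
  then have "compact (closure {t. bump a b j t \<noteq> 0})"
    by (meson bounded_closed_interval bounded_subset closed_closure compact_eq_bounded_closed)
  moreover have "closure {t. bump a b j t \<noteq> 0} \<subseteq> {0<..<T}"
    using cl assms by (force simp: subset_iff)
  ultimately show ?thesis
    by (simp add: test_fun_def)
qed

lemma test_fun_real_deriv:
  fixes \<phi> :: "real \<Rightarrow> real"
  assumes "test_fun {0<..<T} \<phi>"
  shows "(\<phi> has_real_derivative deriv \<phi> t) (at t)" and "continuous_on UNIV (deriv \<phi>)"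
    and "t \<notin> {0<..<T} \<Longrightarrow> \<phi> t = 0"
proof -
  have "Ck (Suc 0) \<phi>" using assms by (auto simp: test_fun_def)
  then obtain f' where f': "\<And>x. (\<phi> has_derivative f' x) (at x)" "\<And>v. continuous_on UNIV (\<lambda>x. f' x v)"
    by auto
  have *: "(\<phi> has_real_derivative f' x 1) (at x)" for x
    using f'(1)[of x] has_derivative_imp_has_field_derivative[OF f'(1)[of x], of "f' x 1"]
      linear_simps(5)[OF has_derivative_bounded_linear[OF f'(1)[of x]], of _ 1]
    by (metis mult.right_neutral real_scaleR_def)
  then have d: "deriv \<phi> = (\<lambda>x. f' x 1)"
    by (auto intro!: DERIV_imp_deriv)
  show "(\<phi> has_real_derivative deriv \<phi> t) (at t)" "continuous_on UNIV (deriv \<phi>)"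
    unfolding d using * f'(2)[of 1] by auto
  show "\<phi> t = 0" if "t \<notin> {0<..<T}"
    using assms that closure_subset[of "{t. \<phi> t \<noteq> 0}"] by (auto simp: test_fun_def)
qed

text \<open>
  Fubini reduces this to the fundamental theorem of calculus for \<open>\<phi>\<close>, so that no differentiation of
  the primitive of \<open>e\<close> is involved.
\<close>

lemma test_fun_by_parts:
  fixes e :: "real \<Rightarrow> real"
  assumes \<phi>: "test_fun {0<..<T} \<phi>" and e: "integrable lborel e" and T: "0 < T"
  shows "(LINT t:{0<..<T}|lborel. deriv \<phi> t * (LINT r:{0<..<t}|lborel. e r))
    = - (LINT t:{0<..<T}|lborel. \<phi> t * e t)"
proof -
  note d = test_fun_real_deriv[OF \<phi>]
  note [measurable] = integrable_measurable_borel[OF e] borel_measurable_continuous_onI[OF d(2)]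
  define F where "F t r = indicator {0<..<T} t * deriv \<phi> t * ((if 0 < r \<and> r < t then 1 else 0) * e r)" for t r
  have d_int: "integrable lborel (\<lambda>t. indicator {0<..<T} t * deriv \<phi> t)"
  proof -
    have "integrable lborel (\<lambda>t. indicator {0..T} t *\<^sub>R deriv \<phi> t)"
      by (rule borel_integrable_compact) (auto intro: continuous_on_subset[OF d(2)])
    then show ?thesis
      by (rule Bochner_Integration.integrable_bound) (auto simp: indicator_def)
  qed
  have "(LINT t:{0<..<T}|lborel. deriv \<phi> t * (LINT r:{0<..<t}|lborel. e r))
     = (LINT t|lborel. LINT r|lborel. F t r)"
  proof -
    have "(LINT r|lborel. F t r) = indicator {0<..<T} t * (deriv \<phi> t * (LINT r:{0<..<t}|lborel. e r))" for t
      unfolding F_def set_lebesgue_integral_def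
      by (simp add: indicator_def mult.assoc of_bool_def)
    then show ?thesis by (simp add: set_lebesgue_integral_def)
  qed
  also have "\<dots> = (LINT r|lborel. LINT t|lborel. F t r)"
  proof (rule Fubini_iterated(2))
    have "(\<integral>\<^sup>+t. \<integral>\<^sup>+r. norm (F t r) \<partial>lborel \<partial>lborel)
      \<le> (\<integral>\<^sup>+t. \<integral>\<^sup>+r. ennreal (norm (indicator {0<..<T} t * deriv \<phi> t)) * ennreal (norm (e r)) \<partial>lborel \<partial>lborel)"
      by (intro nn_integral_mono)
         (auto simp: F_def abs_mult ennreal_mult''[symmetric] indicator_def intro!: ennreal_leI)
    also have "\<dots> < \<infinity>"
      using d_int e by (simp add: nn_integral_cmult nn_integral_multc ennreal_mult_less_top integrable_iff_bounded)
    finally show "(\<integral>\<^sup>+t. \<integral>\<^sup>+r. norm (F t r) \<partial>lborel \<partial>lborel) < \<infinity>" .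
    show "(\<lambda>(t, r). F t r) \<in> borel_measurable (lborel \<Otimes>\<^sub>M lborel)"
      unfolding F_def by measurable
  qed
  also have "\<dots> = (LINT r|lborel. - (indicator {0<..<T} r * (\<phi> r * e r)))"
  proof (intro Bochner_Integration.integral_cong refl)
    fix r
    show "(LINT t|lborel. F t r) = - (indicator {0<..<T} r * (\<phi> r * e r))"
    proof (cases "r \<in> {0<..<T}")
      case True
      have "(LINT t|lborel. indicator {r..T} t *\<^sub>R deriv \<phi> t) = \<phi> T - \<phi> r"
        using True d(2)
        by (intro integral_FTC_Icc)
           (auto intro: continuous_on_subset has_vector_derivative_at_within
             simp flip: has_real_derivative_iff_has_vector_derivative intro!: DERIV_subset[OF d(1)])
      moreover have "(LINT t|lborel. F t r) = (LINT t|lborel. indicator {r..T} t *\<^sub>R deriv \<phi> t * e r)"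
        unfolding F_def
      proof (rule integral_cong_AE)
        show "AE t in lborel. indicat_real {0<..<T} t * deriv \<phi> t * ((if 0 < r \<and> r < t then 1 else 0) * e r) =
          indicat_real {r..T} t *\<^sub>R deriv \<phi> t * e r"
          using AE_lborel_singleton[of r] AE_lborel_singleton[of T]
          by eventually_elim (use True in \<open>auto simp: indicator_def\<close>)
      qed measurable
      ultimately show ?thesis
        using True d(3)[of T] by simp
    next
      case False
      then have "F t r = 0" for t
        by (auto simp: F_def indicator_def)
      then show ?thesis using False by simp
    qed
  qed
  finally show ?thesis
    by (simp add: set_lebesgue_integral_def)
qed

section \<open>The time derivative, the gradient term and the tested inequality\<close>

definition time_cut :: "real \<Rightarrow> (real \<Rightarrow> 'a \<Rightarrow> 'b::real_vector) \<Rightarrow> real \<Rightarrow> 'a \<Rightarrow> 'b" where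
  "time_cut T p t x = window T t *\<^sub>R p t x"

lemma time_cut_outside: "t \<notin> {0<..<T} \<Longrightarrow> time_cut T p t x = 0"
  by (simp add: time_cut_def)

lemma time_cut_eq:
  assumes "\<And>t x. t \<notin> {0<..<T} \<Longrightarrow> p t x = 0"
  shows "time_cut T p = p"
  using assms by (auto simp: time_cut_def indicator_def fun_eq_iff)

lemma sq_integrable_time_cut:
  assumes p: "sq_integrable p"
  shows "sq_integrable (time_cut T p)"
proof -
  note [measurable] = sq_integrable_measurable[OF p]
  show ?thesis
    by (rule sq_integrable_mono[OF p]) (auto simp: time_cut_def[abs_def] indicator_def)
qed

lemma st_inner_time_cut: "st_inner (time_cut T p) q = st_inner p (time_cut T q)"
  by (simp add: st_inner_def time_cut_def)

lemma AE_integrable_time_slice: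
  assumes p: "sq_integrable p" and supp: "\<And>t x. t \<notin> {0<..<T} \<Longrightarrow> p t x = 0"
  shows "AE x in lborel. integrable lborel (\<lambda>t. p t x)"
proof -
  note [measurable] = sq_integrable_measurable[OF p]
  have "(\<integral>\<^sup>+x. \<integral>\<^sup>+t. (ennreal (norm (p t x)))\<^sup>2 \<partial>lborel \<partial>lborel) < \<infinity>"
    using sq_integrable_finite[OF p] by (subst lborel_pair.Fubini') auto
  then have "AE x in lborel. (\<integral>\<^sup>+t. (ennreal (norm (p t x)))\<^sup>2 \<partial>lborel) \<noteq> \<infinity>"
    by (intro nn_integral_PInf_AE) auto
  then show ?thesis
  proof eventually_elim
    case (elim x)
    have "(\<integral>\<^sup>+t. norm (p t x) \<partial>lborel)
        \<le> (\<integral>\<^sup>+t. ennreal (norm (window T t :: real)) + (ennreal (norm (p t x)))\<^sup>2 \<partial>lborel)"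
    proof (rule nn_integral_mono)
      fix t
      show "ennreal (norm (p t x)) \<le> ennreal (norm (window T t :: real)) + (ennreal (norm (p t x)))\<^sup>2"
      proof (cases "t \<in> {0<..<T}")
        case True
        have "norm (p t x) \<le> 1 + (norm (p t x))\<^sup>2"
          using sum_squares_bound[of 1 "norm (p t x)"] by (simp add: algebra_simps) (smt (verit) norm_ge_zero zero_le_power2)
        then have "ennreal (norm (p t x)) \<le> ennreal (1 + (norm (p t x))\<^sup>2)"
          by (rule ennreal_leI)
        then show ?thesis
          using True by (simp add: ennreal_plus ennreal_power)
      qed (simp add: supp)
    qed
    also have "\<dots> < \<infinity>"
      using elim window_integrable[of T]
      by (subst nn_integral_add) (auto simp: integrable_iff_bounded less_top)
    finally show ?case
      by (intro integrableI_bounded) auto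
  qed
qed

context resolvent_pair
begin

text \<open>
  Here \<open>V = k\<^sub>n * v\<close> is a primitive of \<open>n (v - h * v)\<close> for almost every \<open>x\<close>, so integration by parts
  shows that the difference of \<open>D\<close> and this function is orthogonal to each test function, for almost every
  \<open>x\<close>. The null set depends on the test function; the countable family of bumps over rational intervals
  removes this dependence and still determines a function of time.
\<close>

lemma weak_time_derivative_eq:
  fixes v D V :: "real \<Rightarrow> 'a::euclidean_space \<Rightarrow> real"
  assumes v: "sq_integrable v" and v_supp: "\<And>t x. t \<notin> {0<..<T} \<or> x \<notin> \<Omega> \<Longrightarrow> v t x = 0"
    and D: "sq_integrable D" and D_supp: "\<And>t x. t \<notin> {0<..<T} \<or> x \<notin> \<Omega> \<Longrightarrow> D t x = 0"
    and V: "\<And>t x. t \<in> {0<..<T} \<Longrightarrow> x \<in> \<Omega> \<Longrightarrow>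
      V t x = (LINT s:{0<..<t}|lborel. line_conv K H (t - s) * v s x)"
    and weak: "\<And>\<phi>. test_fun {0<..<T} \<phi> \<Longrightarrow> AE x\<in>\<Omega> in lborel.
      (LINT t:{0<..<T}|lborel. deriv \<phi> t * V t x) = - (LINT t:{0<..<T}|lborel. \<phi> t * D t x)"
  shows "AE t in lborel. AE x in lborel. D t x = time_cut T (\<lambda>t x. n * (v t x - time_conv H v t x)) t x"
proof -
  define e where "e t x = n * (v t x - time_conv H v t x)" for t x
  define E where "E t x = D t x - time_cut T e t x" for t x
  have e: "sq_integrable e"
    unfolding e_def using sq_integrable_scale[OF sq_integrable_diff[OF v sq_integrable_time_conv[OF H_int v]], of n]
    by simp
  note ce = sq_integrable_time_cut[OF e, of T]
  have E: "sq_integrable E"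
    unfolding E_def by (rule sq_integrable_diff[OF D ce])
  note [measurable] = sq_integrable_measurable[OF E]
  have E_supp: "E t x = 0" if "t \<notin> {0<..<T}" for t x
    using that by (simp add: E_def D_supp time_cut_outside)
  have slices: "AE x in lborel. integrable lborel (\<lambda>t. v t x) \<and> integrable lborel (\<lambda>t. D t x)
      \<and> integrable lborel (\<lambda>t. time_cut T e t x)"
    using AE_integrable_time_slice[OF v, of T] AE_integrable_time_slice[OF D, of T]
      AE_integrable_time_slice[OF ce time_cut_outside]
    by (simp add: v_supp D_supp)
  \<comment> \<open>Off \<open>\<Omega>\<close> everything vanishes, so the statement can be made for almost every \<open>x\<close> of the whole space.\<close>
  have orth: "AE x in lborel. (LINT t:{0<..<T}|lborel. \<phi> t * E t x) = 0" if \<phi>: "test_fun {0<..<T} \<phi>" for \<phi>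
    using weak[OF \<phi>] slices
  proof eventually_elim
    case (elim x)
    show ?case
    proof (cases "x \<in> \<Omega>")
      case True
      have cont: "continuous_on UNIV \<phi>"
        using test_fun_real_deriv(1)[OF \<phi>] by (auto intro!: DERIV_continuous_on)
      have bnd: "bounded (\<phi> ` {0..T})"
        by (intro compact_imp_bounded compact_continuous_image) (auto intro: continuous_on_subset[OF cont])
      then obtain M where "\<forall>t\<in>{0..T}. \<bar>\<phi> t\<bar> \<le> M"
        by (auto simp: bounded_iff)
      then have M: "\<And>t. t \<in> {0..T} \<Longrightarrow> \<bar>\<phi> t\<bar> \<le> M"
        by blast
      note [measurable] = borel_measurable_continuous_onI[OF cont]
      have int: "integrable lborel (\<lambda>t. window T t * (\<phi> t * g t))" if g: "integrable lborel g" for g :: "real \<Rightarrow> real"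
      proof (rule Bochner_Integration.integrable_bound[where f="\<lambda>t. M * g t"])
        note [measurable] = integrable_measurable_borel[OF g]
        show "(\<lambda>t. window T t * (\<phi> t * g t)) \<in> borel_measurable lborel" by measurable
        show "AE t in lborel. norm (window T t * (\<phi> t * g t)) \<le> norm (M * g t)"
          using M by (intro AE_I2) (auto simp: indicator_def abs_mult intro!: mult_right_mono order_trans[OF M])
      qed (use g in simp)
      have cH: "line_conv H (\<lambda>s. v s x) = (\<lambda>t. time_conv H v t x)"
        by (simp add: time_conv_def fun_eq_iff)
      have "V t x = (LINT s:{0<..<t}|lborel. time_cut T e s x)" if t: "t \<in> {0<..<T}" for t
      proof -
        have "V t x = (LINT s:{0<..<t}|lborel. e s x)"
          using regularized_kernel_conv_eq_primitive[of "\<lambda>s. v s x", OF _ _ t] V[OF t True] elim v_supp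
          by (simp add: e_def cH)
        also have "\<dots> = (LINT s:{0<..<t}|lborel. time_cut T e s x)"
          unfolding set_lebesgue_integral_def
          by (intro Bochner_Integration.integral_cong refl) (use t in \<open>auto simp: time_cut_def indicator_def\<close>)
        finally show ?thesis .
      qed
      then have "(LINT t:{0<..<T}|lborel. deriv \<phi> t * V t x)
        = (LINT t:{0<..<T}|lborel. deriv \<phi> t * (LINT s:{0<..<t}|lborel. time_cut T e s x))"
        unfolding set_lebesgue_integral_def
        by (intro Bochner_Integration.integral_cong refl) (auto simp: indicator_def)
      also have "\<dots> = - (LINT t:{0<..<T}|lborel. \<phi> t * time_cut T e t x)"
        using elim by (intro test_fun_by_parts[OF \<phi>] T_pos) auto
      finally have "(LINT t:{0<..<T}|lborel. \<phi> t * D t x) = (LINT t:{0<..<T}|lborel. \<phi> t * time_cut T e t x)"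
        using elim True by simp
      then show ?thesis
        using int[of "\<lambda>t. D t x"] int[of "\<lambda>t. time_cut T e t x"] elim
        by (simp add: E_def set_lebesgue_integral_def right_diff_distrib)
    next
      case False
      then have "E t x = 0" for t
        by (simp add: E_def D_supp time_cut_def e_def time_conv_def line_conv_def v_supp)
      then show ?thesis by simp
    qed
  qed
  define I where "I = {(a :: real, b :: real). a \<in> \<rat> \<and> b \<in> \<rat> \<and> 0 < a \<and> b < T} \<times> (UNIV :: nat set)"
  have "countable I"
    unfolding I_def
    by (intro countable_SIGMA) (auto intro: countable_subset[OF _ countable_SIGMA[OF countable_rat countable_rat]])
  then have "AE x in lborel. \<forall>i\<in>I. (LINT t:{0<..<T}|lborel. bump (fst (fst i)) (snd (fst i)) (snd i) t * E t x) = 0"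
    by (subst AE_ball_countable) (auto simp: I_def intro!: orth test_fun_bump)
  with slices have "AE x in lborel. AE t in lborel. E t x = 0"
  proof eventually_elim
    case (elim x)
    have int: "integrable lborel (\<lambda>t. E t x)"
      unfolding E_def using elim by auto
    have "AE t in lborel. t \<in> {0<..<T} \<longrightarrow> E t x = 0"
    proof (rule AE_zero_of_rational_intervals[OF int])
      fix a b :: real assume ab: "a \<in> \<rat>" "b \<in> \<rat>" "0 < a" "a < b" "b < T"
      have "(\<lambda>j. LINT t:{0<..<T}|lborel. bump a b j t * E t x) \<longlonglongrightarrow> (LINT t:{a<..<b}|lborel. E t x)"
        unfolding set_lebesgue_integral_def
      proof (rule integral_dominated_convergence[where w="\<lambda>t. norm (E t x)"])
        show "AE t in lborel. (\<lambda>j. window T t *\<^sub>R (bump a b j t * E t x)) \<longlonglongrightarrow> indicat_real {a<..<b} t *\<^sub>R E t x"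
        proof (intro AE_I2)
          fix t
          have "(\<lambda>j. window T t *\<^sub>R (bump a b j t * E t x)) \<longlonglongrightarrow> window T t *\<^sub>R (indicat_real {a<..<b} t * E t x)"
            by (intro tendsto_intros bump_tendsto)
          also have "window T t *\<^sub>R (indicat_real {a<..<b} t * E t x) = indicat_real {a<..<b} t *\<^sub>R E t x"
            using ab by (auto simp: indicator_def)
          finally show "(\<lambda>j. window T t *\<^sub>R (bump a b j t * E t x)) \<longlonglongrightarrow> indicat_real {a<..<b} t *\<^sub>R E t x" .
        qed
        show "AE t in lborel. norm (window T t *\<^sub>R (bump a b j t * E t x)) \<le> norm (E t x)" for j
          using bump_bounds[of a b j]
          by (auto simp: indicator_def abs_mult intro!: mult_left_le_one_le)
        have "Ck 0 (bump a b j)" for j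
          using test_fun_bump[of a b T j] ab unfolding test_fun_def by blast
        then have "bump a b j \<in> borel_measurable borel" for j
          by (auto intro: borel_measurable_continuous_onI)
        then show "(\<lambda>t. window T t *\<^sub>R (bump a b j t * E t x)) \<in> borel_measurable lborel" for j
          by measurable
      qed (use int in auto)
      moreover have "(LINT t:{0<..<T}|lborel. bump a b j t * E t x) = 0" for j
        using elim(2) ab by (auto simp: I_def)
      ultimately show "(LINT t:{a<..<b}|lborel. E t x) = 0"
        by (simp add: LIMSEQ_const_iff)
    qed
    then show ?case
      by eventually_elim (use E_supp in auto)
  qed
  moreover have "{z \<in> space (lborel \<Otimes>\<^sub>M lborel). E (fst z) (snd z) = 0} \<in> sets (lborel \<Otimes>\<^sub>M lborel)"
    by measurable
  ultimately have "AE t in lborel. AE x in lborel. E t x = 0"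
    by (subst lborel_pair.AE_commute)
  then show ?thesis
    by (simp add: E_def e_def[abs_def])
qed

text \<open>
  Causality: a forward kernel reaches a time in \<open>(0, T)\<close> only from earlier times, so values of \<open>p\<close>
  beyond \<open>T\<close> do not contribute.
\<close>

lemma conv_form_time_cut_left:
  assumes "\<And>t x. t \<notin> {0<..<T} \<Longrightarrow> q t x = 0" and "\<And>t x. t \<le> 0 \<Longrightarrow> p t x = 0"
  shows "conv_form L (time_cut T p) q = conv_form L p q"
proof -
  have "L (t - s) * (LINT x|lborel. time_cut T p s x \<bullet> q t x) = L (t - s) * (LINT x|lborel. p s x \<bullet> q t x)" for t s
  proof (cases "t \<in> {0<..<T} \<and> 0 < t - s \<and> 0 < s")
    case True
    then have "window T s = (1 :: real)" by auto
    then show ?thesis by (simp add: time_cut_def)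
  next
    case False
    then consider "t \<notin> {0<..<T}" | "t - s \<le> 0" | "s \<le> 0" by linarith
    then show ?thesis
      using assms L_supp[of "t - s"] by cases (auto simp: time_cut_def)
  qed
  then show ?thesis
    unfolding conv_form_def by (intro Bochner_Integration.integral_cong refl)
qed

text \<open>
  The equation \<open>h = n l - n l * h\<close> inside the form. It is used twice: for the time derivative, with
  \<open>q = w\<close>, and for the gradient, with \<open>p = l *\<^sup>T \<nabla>w\<close> and \<open>q = \<nabla>w\<close>.
\<close>

lemma resolvent_identity:
  assumes p: "sq_integrable p" and q: "sq_integrable q"
    and p_supp: "\<And>t x. t \<notin> {0<..<T} \<Longrightarrow> p t x = 0" and q_supp: "\<And>t x. t \<notin> {0<..<T} \<Longrightarrow> q t x = 0"
  shows "conv_form H p q = n * (conv_form L p q - conv_form L (time_cut T (time_conv H p)) q)"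
proof -
  have LH: "integrable lborel (line_conv L H)"
    by (rule integrable_line_conv(1)[OF L_int H_int])
  have nLH: "integrable lborel (\<lambda>s. (- n) * line_conv L H s)"
    using LH by simp
  have "conv_form H p q = conv_form (\<lambda>s. n * L s + (- n) * line_conv L H s) p q"
  proof (rule conv_form_cong_kernel[OF H_int _ p q p_supp q_supp])
    show "integrable lborel (\<lambda>s. n * L s + (- n) * line_conv L H s)"
      using L_int LH by simp
    show "AE s in lborel. s \<in> {-T<..<T} \<longrightarrow> H s = n * L s + (- n) * line_conv L H s"
      using H_eq
    proof eventually_elim
      case (elim s)
      show ?case
      proof (cases "0 < s")
        case True
        with elim show ?thesis by (auto simp: line_conv_commute)
      next
        case False
        then have "line_conv L H s = 0"
          using H_supp L_supp by (intro line_conv_eq_0) auto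
        then show ?thesis using False H_supp[of s] L_supp[of s] by simp
      qed
    qed
  qed auto
  also have "\<dots> = n * conv_form L p q - n * conv_form (line_conv L H) p q"
  proof -
    have "integrable lborel (\<lambda>s. n * L s)"
      using L_int by simp
    from conv_form_add_kernel[OF this nLH p q] show ?thesis
      unfolding conv_form_scale_kernel by simp
  qed
  also have "conv_form (line_conv L H) p q = conv_form L (time_conv H p) q"
    by (rule conv_form_assoc[OF L_int H_int p q, symmetric])
  also have "\<dots> = conv_form L (time_cut T (time_conv H p)) q"
  proof (rule conv_form_time_cut_left[symmetric, OF q_supp])
    show "time_conv H p t x = 0" if "t \<le> 0" for t x
      unfolding time_conv_def using H_supp p_supp that by (intro line_conv_eq_0) auto
  qed auto
  finally show ?thesis
    by (simp add: right_diff_distrib)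
qed

lemma time_derivative_term:
  fixes v D w :: "real \<Rightarrow> 'a::euclidean_space \<Rightarrow> real"
  assumes v: "sq_integrable v" and D: "sq_integrable D" and w: "sq_integrable w"
    and v_supp: "\<And>t x. t \<notin> {0<..<T} \<Longrightarrow> v t x = 0"
    and w_supp: "\<And>t x. t \<notin> {0<..<T} \<Longrightarrow> w t x = 0"
    and eq: "AE t in lborel. AE x in lborel. D t x = time_cut T (\<lambda>t x. n * (v t x - time_conv H v t x)) t x"
  shows "conv_form L D w = conv_form H v w"
proof -
  note Hv = sq_integrable_time_cut[OF sq_integrable_time_conv[OF H_int v], of T]
  have cut: "time_cut T (\<lambda>t x. n * (v t x - time_conv H v t x))
     = (\<lambda>t x. n *\<^sub>R (v t x - time_cut T (time_conv H v) t x))"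
    using v_supp by (auto simp: time_cut_def fun_eq_iff indicator_def)
  have sq: "sq_integrable (\<lambda>t x. n *\<^sub>R (v t x - time_cut T (time_conv H v) t x))"
    by (intro sq_integrable_scale sq_integrable_diff v Hv)
  have "conv_form L D w = conv_form L (\<lambda>t x. n *\<^sub>R (v t x - time_cut T (time_conv H v) t x)) w"
  proof -
    have "st_inner D (time_conv (\<lambda>s. L (- s)) w)
        = st_inner (\<lambda>t x. n *\<^sub>R (v t x - time_cut T (time_conv H v) t x)) (time_conv (\<lambda>s. L (- s)) w)"
    proof (rule st_inner_cong_AE[OF D sq sq_integrable_time_conv[OF integrable_reflect[OF L_int] w]])
      show "AE t in lborel. AE x in lborel. D t x \<bullet> time_conv (\<lambda>s. L (- s)) w t x
        = n *\<^sub>R (v t x - time_cut T (time_conv H v) t x) \<bullet> time_conv (\<lambda>s. L (- s)) w t x"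
        using eq[unfolded cut] by (auto elim!: eventually_mono)
    qed
    then show ?thesis
      by (simp only: conv_form_eq_st_inner'[OF L_int D w] conv_form_eq_st_inner'[OF L_int sq w])
  qed
  also have "\<dots> = n * (conv_form L v w - conv_form L (time_cut T (time_conv H v)) w)"
    by (subst conv_form_scale_left) (simp add: conv_form_diff_left[OF L_int v Hv w])
  also have "\<dots> = conv_form H v w"
    by (rule resolvent_identity[OF v w v_supp w_supp, symmetric])
  finally show ?thesis .
qed

text \<open>
  The weak form of \<open>h *\<^sup>T g = n (G - h *\<^sup>T G)\<close>, tested with \<open>G = l *\<^sup>T g\<close>.
\<close>

lemma gradient_term:
  fixes g :: "real \<Rightarrow> 'a::euclidean_space \<Rightarrow> 'b::euclidean_space"
  assumes g: "sq_integrable g" and g_supp: "\<And>t x. t \<notin> {0<..<T} \<Longrightarrow> g t x = 0"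
  defines "G \<equiv> time_cut T (time_conv (\<lambda>s. L (- s)) g)"
  shows "conv_form H G g = n * (st_inner G G - conv_form H G G)"
proof -
  have Lg: "sq_integrable (time_conv (\<lambda>s. L (- s)) g)"
    by (rule sq_integrable_time_conv[OF integrable_reflect[OF L_int] g])
  have G: "sq_integrable G"
    unfolding G_def by (rule sq_integrable_time_cut[OF Lg])
  have G_supp: "G t x = 0" if "t \<notin> {0<..<T}" for t x
    using that by (simp add: G_def time_cut_outside)
  note HG = sq_integrable_time_conv[OF H_int G]
  have "conv_form L G g = st_inner G G"
  proof -
    have "conv_form L G g = st_inner (time_cut T G) (time_conv (\<lambda>s. L (- s)) g)"
      using time_cut_eq[of T G] G_supp by (simp add: conv_form_eq_st_inner'[OF L_int G g])
    then show ?thesis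
      by (simp add: st_inner_time_cut G_def)
  qed
  moreover have "conv_form L (time_cut T (time_conv H G)) g = conv_form H G G"
    by (simp add: conv_form_eq_st_inner'[OF L_int sq_integrable_time_cut[OF HG] g] st_inner_time_cut
        conv_form_eq_st_inner[OF H_int G G] flip: G_def)
  ultimately show ?thesis
    using resolvent_identity[OF G g G_supp g_supp] by simp
qed

end

lemma AE_slice_square_finite:
  assumes p: "sq_integrable p"
  shows "AE t in lborel. (\<integral>\<^sup>+x. (ennreal (norm (p t x)))\<^sup>2 \<partial>lborel) < \<infinity>"
proof -
  note [measurable] = sq_integrable_measurable[OF p]
  show ?thesis
    by (rule AE_AE_finite_of_square(1)) (use sq_integrable_finite[OF p] in auto)
qed

lemma integrable_inner_of_squares:
  fixes f g :: "'a::euclidean_space \<Rightarrow> 'b::euclidean_space"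
  assumes [measurable]: "f \<in> borel_measurable borel" "g \<in> borel_measurable borel"
    and f: "(\<integral>\<^sup>+x. (ennreal (norm (f x)))\<^sup>2 \<partial>lborel) < \<infinity>"
    and g: "(\<integral>\<^sup>+x. (ennreal (norm (g x)))\<^sup>2 \<partial>lborel) < \<infinity>"
  shows "integrable lborel (\<lambda>x. f x \<bullet> g x)"
proof (rule integrableI_bounded)
  have "(\<integral>\<^sup>+x. norm (f x \<bullet> g x) \<partial>lborel)
      \<le> (\<integral>\<^sup>+x. (ennreal (norm (f x)))\<^sup>2 + (ennreal (norm (g x)))\<^sup>2 \<partial>lborel)"
  proof (intro nn_integral_mono)
    fix x
    have "ennreal (norm (f x \<bullet> g x)) \<le> 1 * (ennreal (norm (f x)) * ennreal (norm (g x)))"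
      using inner_le_ennreal[of "f x" "g x"] by simp
    also have "\<dots> \<le> 2 * (ennreal (norm (f x)) * ennreal (norm (g x)))"
      by (intro mult_right_mono) auto
    also have "\<dots> \<le> (ennreal (norm (f x)))\<^sup>2 + (ennreal (norm (g x)))\<^sup>2"
      using sum_of_squares_ge_ennreal by (simp only: mult.assoc)
    finally show "ennreal (norm (f x \<bullet> g x)) \<le> (ennreal (norm (f x)))\<^sup>2 + (ennreal (norm (g x)))\<^sup>2" .
  qed
  also have "\<dots> < \<infinity>"
    using f g by (subst nn_integral_add) auto
  finally show "(\<integral>\<^sup>+x. norm (f x \<bullet> g x) \<partial>lborel) < \<infinity>" .
qed measurable

text \<open>
  The hypothesis is the inequality at time \<open>s\<close>, tested with the functions at time \<open>t\<close>. The spatial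
  integrals can be split because almost all time slices of square-integrable functions are
  square-integrable.
\<close>

lemma conv_form_tested_inequality:
  fixes D w F :: "real \<Rightarrow> 'a::euclidean_space \<Rightarrow> real" and C g :: "real \<Rightarrow> 'a \<Rightarrow> 'b::euclidean_space"
  assumes a: "integrable lborel a" and a_nonneg: "AE s in lborel. 0 \<le> a s"
    and D: "sq_integrable D" and w: "sq_integrable w" and F: "sq_integrable F"
    and C: "sq_integrable C" and g: "sq_integrable g"
    and ineq: "AE t in lborel. AE s in lborel.
      (LINT x|lborel. w t x * D s x + C s x \<bullet> g t x) \<le> (LINT x|lborel. F s x * w t x)"
  shows "conv_form a D w + conv_form a C g \<le> conv_form a F w"
proof -
  note [measurable] = integrable_measurable_borel[OF a] sq_integrable_measurable[OF D]
    sq_integrable_measurable[OF w] sq_integrable_measurable[OF F]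
    sq_integrable_measurable[OF C] sq_integrable_measurable[OF g]
  note FD = conv_form_Fubini[OF a D w] and FC = conv_form_Fubini[OF a C g]
    and FF = conv_form_Fubini[OF a F w]
  have "conv_form a D w + conv_form a C g =
     (LINT t|lborel. (LINT s|lborel. a (t - s) * (LINT x|lborel. D s x \<bullet> w t x))
                   + (LINT s|lborel. a (t - s) * (LINT x|lborel. C s x \<bullet> g t x)))"
    unfolding conv_form_def by (rule Bochner_Integration.integral_add[OF FD(3) FC(3), symmetric])
  also have "\<dots> \<le> conv_form a F w"
    unfolding conv_form_def
  proof (rule integral_mono_AE[OF Bochner_Integration.integrable_add[OF FD(3) FC(3)] FF(3)])
    show "AE t in lborel. (LINT s|lborel. a (t - s) * (LINT x|lborel. D s x \<bullet> w t x))
                   + (LINT s|lborel. a (t - s) * (LINT x|lborel. C s x \<bullet> g t x))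
         \<le> (LINT s|lborel. a (t - s) * (LINT x|lborel. F s x \<bullet> w t x))"
      using FD(4) FC(4) FF(4) AE_slice_square_finite[OF w] AE_slice_square_finite[OF g] ineq
    proof eventually_elim
      case (elim t)
      note t = elim
      have "(LINT s|lborel. a (t - s) * (LINT x|lborel. D s x \<bullet> w t x))
           + (LINT s|lborel. a (t - s) * (LINT x|lborel. C s x \<bullet> g t x))
         = (LINT s|lborel. a (t - s) * (LINT x|lborel. D s x \<bullet> w t x)
              + a (t - s) * (LINT x|lborel. C s x \<bullet> g t x))"
        by (rule Bochner_Integration.integral_add[OF elim(1,2), symmetric])
      also have "\<dots> \<le> (LINT s|lborel. a (t - s) * (LINT x|lborel. F s x \<bullet> w t x))"
      proof (rule integral_mono_AE[OF Bochner_Integration.integrable_add[OF elim(1,2)] elim(3)])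
        show "AE s in lborel. a (t - s) * (LINT x|lborel. D s x \<bullet> w t x)
              + a (t - s) * (LINT x|lborel. C s x \<bullet> g t x) \<le> a (t - s) * (LINT x|lborel. F s x \<bullet> w t x)"
          using elim(6) AE_reflect_shift[OF a_nonneg, of t]
            AE_slice_square_finite[OF D] AE_slice_square_finite[OF C]
        proof eventually_elim
          case (elim s)
          have "integrable lborel (\<lambda>x. w t x \<bullet> D s x)"
            by (rule integrable_inner_of_squares) (use elim t in auto)
          moreover have "integrable lborel (\<lambda>x. C s x \<bullet> g t x)"
            by (rule integrable_inner_of_squares) (use elim t in auto)
          ultimately have "(LINT x|lborel. D s x \<bullet> w t x) + (LINT x|lborel. C s x \<bullet> g t x)
              \<le> (LINT x|lborel. F s x \<bullet> w t x)"
            using elim(1) by (simp add: mult.commute)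
          from mult_left_mono[OF this elim(2)] show ?case
            by (simp add: distrib_left)
        qed
      qed
      finally show ?case .
    qed
  qed
  finally show ?thesis .
qed

section \<open>The quadratic form of the kernel\<close>

context resolvent_pair
begin

lemma line_conv_H_window:
  assumes "t \<in> {0<..<T}"
  shows "(LINT s|lborel. H (t - s) * window T s) = (LINT s:{0<..<t}|lborel. H s)"
proof -
  have "(LINT s|lborel. H (t - s) * window T s) = line_conv H (window T) t"
    by (simp add: line_conv_def)
  also have "\<dots> = line_conv (window T) H t"
    by (simp add: line_conv_commute)
  also have "\<dots> = (LINT s:{0<..<t}|lborel. H s)"
    using assms H_supp by (intro line_conv_window) auto
  finally show ?thesis .
qed

text \<open>
  Expand \<open>|G(t) - G(t - s)|\<^sup>2\<close>. The diagonal parts, integrated against \<open>n h(s)\<close>, give \<open>n A(t) |G(t)|\<^sup>2\<close> and,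
  after exchanging the integrals, \<open>n A(T - t) |G(t)|\<^sup>2\<close>; these cancel against the boundary terms and leave
  \<open>n |G|\<^sup>2\<close>. The mixed part is the convolution form.
\<close>

lemma energy_identity:
  fixes G :: "real \<Rightarrow> 'a::euclidean_space \<Rightarrow> 'b::euclidean_space"
  assumes G: "sq_integrable G" and G_supp: "\<And>t x. t \<notin> {0<..<T} \<Longrightarrow> G t x = 0"
  defines "A \<equiv> \<lambda>t. LINT s:{0<..<t}|lborel. H s"
  shows "1/2 * (LINT t:{0<..<T}|lborel. LINT x|lborel. ((n - n * A (T - t)) + (n - n * A t)) * (norm (G t x))\<^sup>2)
    + 1/2 * (LINT t:{0<..<T}|lborel. LINT s:{0<..<t}|lborel. LINT x|lborel.
          (n * H s) * (norm (G t x - G (t - s) x))\<^sup>2)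
    = n * (st_inner G G - conv_form H G G)"
proof -
  note [measurable] = integrable_measurable_borel[OF H_int] sq_integrable_measurable[OF G]
  define g where "g t = (LINT x|lborel. (norm (G t x))\<^sup>2)" for t
  define P where "P s t = (LINT x|lborel. G s x \<bullet> G t x)" for s t
  have g_eq: "g t = (LINT x|lborel. G t x \<bullet> G t x)" for t
    by (simp add: g_def power2_norm_eq_inner)
  have g_int: "integrable lborel g"
    unfolding g_eq[abs_def] using lborel_pair.integrable_fst'[OF st_inner_integrable[OF G G]] by simp
  note [measurable] = integrable_measurable_borel[OF g_int]
  have [measurable]: "(\<lambda>(s, t). P s t) \<in> borel_measurable (lborel \<Otimes>\<^sub>M lborel)"
    unfolding P_def by measurable
  have g_supp: "g t = 0" if "t \<notin> {0<..<T}" for t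
    using that by (simp add: g_def G_supp)
  have P_supp: "P s t = 0" if "s \<notin> {0<..<T} \<or> t \<notin> {0<..<T}" for s t
    using that by (auto simp: P_def G_supp)
  have st: "st_inner G G = (LINT t|lborel. g t)"
    by (simp add: st_inner_def g_eq)
  have A_bound: "\<bar>A t\<bar> \<le> (LINT s|lborel. \<bar>H s\<bar>)" for t
  proof -
    have "\<bar>A t\<bar> \<le> (LINT s|lborel. \<bar>indicator {0<..<t} s * H s\<bar>)"
      unfolding A_def set_lebesgue_integral_def real_scaleR_def by (rule integral_abs_bound)
    also have "\<dots> \<le> (LINT s|lborel. \<bar>H s\<bar>)"
      using H_int integrable_mult_indicator[OF _ H_int, of "{0<..<t}"]
      by (intro integral_mono integrable_abs) (auto simp: indicator_def)
    finally show ?thesis .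
  qed
  have [measurable]: "A \<in> borel_measurable borel"
    unfolding A_def by (intro borel_measurable_continuous_onI continuous_on_integral_upto H_int)
  have Ag_int: "integrable lborel (\<lambda>t. A t * g t)" "integrable lborel (\<lambda>t. A (T - t) * g t)"
  proof -
    have "integrable lborel (\<lambda>t. B t * g t)" if "B \<in> borel_measurable borel" "\<And>t. \<bar>B t\<bar> \<le> (LINT s|lborel. \<bar>H s\<bar>)" for B
    proof (rule Bochner_Integration.integrable_bound[where f="\<lambda>t. (LINT s|lborel. \<bar>H s\<bar>) * g t"])
      show "AE t in lborel. norm (B t * g t) \<le> norm ((LINT s|lborel. \<bar>H s\<bar>) * g t)"
        using that(2) by (intro AE_I2) (auto simp: abs_mult intro!: mult_right_mono order_trans[OF that(2)])
    qed (use that(1) g_int in auto)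
    from this[of A] this[of "\<lambda>t. A (T - t)"] A_bound
    show "integrable lborel (\<lambda>t. A t * g t)" "integrable lborel (\<lambda>t. A (T - t) * g t)"
      by auto
  qed
  have first: "(LINT t:{0<..<T}|lborel. LINT x|lborel. ((n - n * A (T - t)) + (n - n * A t)) * (norm (G t x))\<^sup>2)
     = 2 * n * (LINT t|lborel. g t) - n * (LINT t|lborel. A (T - t) * g t) - n * (LINT t|lborel. A t * g t)"
  proof -
    have "(LINT t:{0<..<T}|lborel. LINT x|lborel. ((n - n * A (T - t)) + (n - n * A t)) * (norm (G t x))\<^sup>2)
      = (LINT t|lborel. 2 * n * g t - n * (A (T - t) * g t) - n * (A t * g t))"
      unfolding set_lebesgue_integral_def
    proof (intro Bochner_Integration.integral_cong refl)
      fix t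
      have "(LINT x|lborel. ((n - n * A (T - t)) + (n - n * A t)) * (norm (G t x))\<^sup>2)
         = ((n - n * A (T - t)) + (n - n * A t)) * g t"
        by (simp add: g_def)
      then show "window T t *\<^sub>R (LINT x|lborel. ((n - n * A (T - t)) + (n - n * A t)) * (norm (G t x))\<^sup>2)
         = 2 * n * g t - n * (A (T - t) * g t) - n * (A t * g t)"
        by (cases "t \<in> {0<..<T}") (auto simp: g_supp algebra_simps)
    qed
    also have "\<dots> = 2 * n * (LINT t|lborel. g t) - n * (LINT t|lborel. A (T - t) * g t) - n * (LINT t|lborel. A t * g t)"
      using g_int Ag_int by simp
    finally show ?thesis .
  qed
  have Hg: "AE t in lborel. integrable lborel (\<lambda>s. H (t - s) * g s)"
    using integrable_line_conv(2)[OF H_int g_int]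
    by eventually_elim (use line_conv_integrable_at[of H g] in auto)
  have HP: "AE t in lborel. integrable lborel (\<lambda>s. H (t - s) * P s t)"
    using conv_form_Fubini(4)[OF H_int G G] by (simp add: P_def)
  \<comment> \<open>The inner integral after the substitution \<open>s \<mapsto> t - s\<close>. The factor \<open>window T s\<close> accompanies \<open>g t\<close> because
    this term, unlike the others, does not vanish by itself for \<open>s \<notin> (0, T)\<close>.\<close>
  have inner: "AE t in lborel. window T t * (LINT s:{0<..<t}|lborel. LINT x|lborel.
          (n * H s) * (norm (G t x - G (t - s) x))\<^sup>2)
     = n * (A t * g t) + n * (window T t * (LINT s|lborel. H (t - s) * g s))
       - 2 * n * (LINT s|lborel. H (t - s) * P s t)"
    using Hg HP AE_slice_square_finite[OF G]
  proof eventually_elim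
    case (elim t)
    note t_elim = elim
    show ?case
    proof (cases "t \<in> {0<..<T}")
      case False
      then have "g t = 0" "P s t = 0" for s
        by (auto simp: g_supp P_supp)
      then show ?thesis using False by simp
    next
      case True
      have Hw: "integrable lborel (\<lambda>s. H (t - s) * window T s)"
      proof (rule Bochner_Integration.integrable_bound[where f="\<lambda>s. H (t - s)"])
        show "integrable lborel (\<lambda>s. H (t - s))"
          using lborel_integrable_real_affine[OF H_int, of "-1" t] by simp
      qed (auto simp: indicator_def)
      have "(LINT s:{0<..<t}|lborel. LINT x|lborel. (n * H s) * (norm (G t x - G (t - s) x))\<^sup>2)
         = (LINT s|lborel. indicator {0<..<t} (t - s) * (n * H (t - s) * (LINT x|lborel. (norm (G t x - G s x))\<^sup>2)))"
        using integral_reflect_shift[of "\<lambda>s. indicator {0<..<t} s *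
          (n * H s * (LINT x|lborel. (norm (G t x - G (t - s) x))\<^sup>2))" t]
        by (simp add: set_lebesgue_integral_def)
      also have "\<dots> = (LINT s|lborel. n * g t * (H (t - s) * window T s) + n * (H (t - s) * g s)
          - 2 * n * (H (t - s) * P s t))"
      proof (rule integral_cong_AE)
        show "AE s in lborel. indicator {0<..<t} (t - s) * (n * H (t - s) * (LINT x|lborel. (norm (G t x - G s x))\<^sup>2))
           = n * g t * (H (t - s) * window T s) + n * (H (t - s) * g s) - 2 * n * (H (t - s) * P s t)"
          using AE_slice_square_finite[OF G]
        proof eventually_elim
          case (elim s)
          show ?case
          proof (cases "0 < s \<and> s < t")
            case s: True
            have int: "integrable lborel (\<lambda>x. G t x \<bullet> G t x)" "integrable lborel (\<lambda>x. G s x \<bullet> G s x)"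
              "integrable lborel (\<lambda>x. G s x \<bullet> G t x)"
              by (rule integrable_inner_of_squares; use elim t_elim in auto)+
            have "(LINT x|lborel. (norm (G t x - G s x))\<^sup>2)
                = (LINT x|lborel. G t x \<bullet> G t x + G s x \<bullet> G s x - 2 * (G s x \<bullet> G t x))"
              by (simp add: power2_norm_eq_inner inner_diff_left inner_diff_right inner_commute algebra_simps)
            also have "\<dots> = g t + g s - 2 * P s t"
              using int by (simp add: g_eq P_def)
            finally have eq: "(LINT x|lborel. (norm (G t x - G s x))\<^sup>2) = g t + g s - 2 * P s t" .
            show ?thesis
              unfolding eq using s True by (simp add: algebra_simps)
          next
            case False
            then consider "s \<le> 0" | "t - s \<le> 0" by linarith
            then show ?thesis
              using H_supp[of "t - s"] by cases (auto simp: g_supp P_supp)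
          qed
        qed
      qed measurable
      also have "\<dots> = n * g t * A t + n * (LINT s|lborel. H (t - s) * g s) - 2 * n * (LINT s|lborel. H (t - s) * P s t)"
        using Hw elim line_conv_H_window[OF True] by (simp add: A_def)
      finally show ?thesis
        using True by (simp add: mult.commute mult.left_commute)
    qed
  qed
  have swap: "(LINT t|lborel. window T t * (LINT s|lborel. H (t - s) * g s)) = (LINT t|lborel. A (T - t) * g t)"
    and swap_int: "integrable lborel (\<lambda>t. window T t * (LINT s|lborel. H (t - s) * g s))"
  proof -
    have fin: "(\<integral>\<^sup>+t. \<integral>\<^sup>+s. norm (window T t * (H (t - s) * g s)) \<partial>lborel \<partial>lborel) < \<infinity>"
    proof -
      have "(\<integral>\<^sup>+t. \<integral>\<^sup>+s. norm (window T t * (H (t - s) * g s)) \<partial>lborel \<partial>lborel)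
         \<le> (\<integral>\<^sup>+t. abs_conv H (\<lambda>s. ennreal (norm (g s))) t \<partial>lborel)"
        unfolding abs_conv_def
        by (intro nn_integral_mono) (auto simp: indicator_def abs_mult ennreal_mult'')
      also have "\<dots> < \<infinity>"
        using H_int g_int by (subst nn_integral_abs_conv) (auto simp: integrable_iff_bounded ennreal_mult_less_top)
      finally show ?thesis .
    qed
    have meas: "(\<lambda>(t, s). window T t * (H (t - s) * g s)) \<in> borel_measurable (lborel \<Otimes>\<^sub>M lborel)"
      by measurable
    note Fb = Fubini_iterated[OF meas fin]
    show "integrable lborel (\<lambda>t. window T t * (LINT s|lborel. H (t - s) * g s))"
      using Fb(3) by simp
    have "(LINT t|lborel. window T t * (LINT s|lborel. H (t - s) * g s))
       = (LINT s|lborel. LINT t|lborel. window T t * (H (t - s) * g s))"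
      using Fb(2) by simp
    also have "\<dots> = (LINT s|lborel. A (T - s) * g s)"
    proof (intro Bochner_Integration.integral_cong refl)
      fix s
      show "(LINT t|lborel. window T t * (H (t - s) * g s)) = A (T - s) * g s"
      proof (cases "s \<in> {0<..<T}")
        case True
        have "(LINT t|lborel. window T t * (H (t - s) * g s)) = (LINT t|lborel. window T (t + s) * H t) * g s"
          using integral_shift[of "\<lambda>t. window T (t + s) * (H t * g s)" s]
          by (simp flip: mult.assoc)
        also have "(LINT t|lborel. window T (t + s) * H t) = A (T - s)"
          unfolding A_def set_lebesgue_integral_def real_scaleR_def
          by (intro Bochner_Integration.integral_cong refl) (use True H_supp in \<open>auto simp: indicator_def\<close>)
        finally show ?thesis .
      qed (simp add: g_supp)
    qed
    finally show "(LINT t|lborel. window T t * (LINT s|lborel. H (t - s) * g s)) = (LINT t|lborel. A (T - t) * g t)" .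
  qed
  have form_int: "integrable lborel (\<lambda>t. LINT s|lborel. H (t - s) * P s t)"
    using conv_form_Fubini(3)[OF H_int G G] by (simp add: P_def)
  have "(LINT t:{0<..<T}|lborel. LINT s:{0<..<t}|lborel. LINT x|lborel.
          (n * H s) * (norm (G t x - G (t - s) x))\<^sup>2)
     = (LINT t|lborel. n * (A t * g t) + n * (window T t * (LINT s|lborel. H (t - s) * g s))
       - 2 * n * (LINT s|lborel. H (t - s) * P s t))"
    unfolding set_lebesgue_integral_def[of lborel "{0<..<T}"] real_scaleR_def
  proof (rule integral_cong_AE)
    have "(\<lambda>t. window T t * (LINT s|lborel. (if 0 < s \<and> s < t then 1 else 0) * (LINT x|lborel.
        n * H s * (norm (G t x - G (t - s) x))\<^sup>2))) \<in> borel_measurable lborel"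
      by measurable
    then show "(\<lambda>t. window T t * (LINT s:{0<..<t}|lborel. LINT x|lborel.
        n * H s * (norm (G t x - G (t - s) x))\<^sup>2)) \<in> borel_measurable lborel"
      by (simp add: set_lebesgue_integral_def indicator_def of_bool_def)
  qed (use inner in measurable)
  also have "\<dots> = n * (LINT t|lborel. A t * g t) + n * (LINT t|lborel. A (T - t) * g t) - 2 * n * conv_form H G G"
    using Ag_int swap_int form_int swap by (simp add: conv_form_def P_def[symmetric])
  finally show ?thesis
    unfolding first st by (simp add: algebra_simps)
qed

end

section \<open>The energy inequality\<close>

definition cyl_cut ::
  "real \<Rightarrow> 'a set \<Rightarrow> (real \<Rightarrow> 'a \<Rightarrow> 'b::real_vector) \<Rightarrow> real \<Rightarrow> 'a \<Rightarrow> 'b" where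
  "cyl_cut T \<Omega> p t x = indicator ({0<..<T} \<times> \<Omega>) (t, x) *\<^sub>R p t x"

lemma cyl_cut_inside: "t \<in> {0<..<T} \<Longrightarrow> x \<in> \<Omega> \<Longrightarrow> cyl_cut T \<Omega> p t x = p t x"
  by (simp add: cyl_cut_def)

lemma cyl_cut_outside: "t \<notin> {0<..<T} \<or> x \<notin> \<Omega> \<Longrightarrow> cyl_cut T \<Omega> p t x = 0"
  by (auto simp: cyl_cut_def)

lemma sq_integrable_cyl_cut:
  fixes p :: "real \<Rightarrow> 'a::euclidean_space \<Rightarrow> 'b::euclidean_space"
  assumes "L2_on ({0<..<T} \<times> \<Omega>) (\<lambda>(t, x). p t x)"
  shows "sq_integrable (cyl_cut T \<Omega> p)"
proof -
  have "(\<lambda>z. indicator ({0<..<T} \<times> \<Omega>) z *\<^sub>R (case z of (t, x) \<Rightarrow> p t x))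
      \<in> borel_measurable (lborel \<Otimes>\<^sub>M lborel)"
    using assms by (simp add: L2_on_def set_borel_measurable_def lborel_prod)
  then have m: "case_prod (cyl_cut T \<Omega> p) \<in> borel_measurable (lborel \<Otimes>\<^sub>M lborel)"
    by (simp add: cyl_cut_def[abs_def] case_prod_beta')
  note [measurable] = m
  have "integrable (lborel \<Otimes>\<^sub>M lborel)
      (\<lambda>z. indicator ({0<..<T} \<times> \<Omega>) z *\<^sub>R (norm (case z of (t, x) \<Rightarrow> p t x))\<^sup>2)"
    using assms by (simp add: L2_on_def set_integrable_def lborel_prod)
  then have "(\<integral>\<^sup>+z. norm (indicator ({0<..<T} \<times> \<Omega>) z *\<^sub>R (norm (case z of (t, x) \<Rightarrow> p t x))\<^sup>2)
      \<partial>(lborel \<Otimes>\<^sub>M lborel)) < \<infinity>"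
    by (simp add: integrable_iff_bounded)
  also have "(\<integral>\<^sup>+z. norm (indicator ({0<..<T} \<times> \<Omega>) z *\<^sub>R (norm (case z of (t, x) \<Rightarrow> p t x))\<^sup>2)
      \<partial>(lborel \<Otimes>\<^sub>M lborel))
     = (\<integral>\<^sup>+z. (ennreal (norm (case_prod (cyl_cut T \<Omega> p) z)))\<^sup>2 \<partial>(lborel \<Otimes>\<^sub>M lborel))"
    by (intro nn_integral_cong) (auto simp: cyl_cut_def ennreal_power indicator_def split: prod.splits)
  also have "\<dots> = (\<integral>\<^sup>+t. \<integral>\<^sup>+x. (ennreal (norm (cyl_cut T \<Omega> p t x)))\<^sup>2 \<partial>lborel \<partial>lborel)"
    by (subst lborel.nn_integral_fst[symmetric]) auto
  finally show ?thesis
    using m by (simp add: sq_integrable_def)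
qed

lemma sq_integrable_cyl_cut_const:
  fixes v :: "'a::euclidean_space \<Rightarrow> 'b::euclidean_space"
  assumes "L2_on \<Omega> v" and T: "0 < T"
  shows "sq_integrable (cyl_cut T \<Omega> (\<lambda>t. v))"
proof -
  have [measurable]: "(\<lambda>x. indicator \<Omega> x *\<^sub>R v x) \<in> borel_measurable borel"
    using assms by (simp add: L2_on_def set_borel_measurable_def)
  have eq: "cyl_cut T \<Omega> (\<lambda>t. v) = (\<lambda>t x. window T t *\<^sub>R (indicator \<Omega> x *\<^sub>R v x))"
    by (auto simp: cyl_cut_def indicator_def fun_eq_iff)
  have "integrable lborel (\<lambda>x. indicator \<Omega> x *\<^sub>R (norm (v x))\<^sup>2)"
    using assms by (simp add: L2_on_def set_integrable_def)
  then have "(\<integral>\<^sup>+x. norm (indicator \<Omega> x *\<^sub>R (norm (v x))\<^sup>2) \<partial>lborel) < \<infinity>"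
    by (simp add: integrable_iff_bounded)
  also have "(\<integral>\<^sup>+x. norm (indicator \<Omega> x *\<^sub>R (norm (v x))\<^sup>2) \<partial>lborel)
      = (\<integral>\<^sup>+x. (ennreal (norm (indicator \<Omega> x *\<^sub>R v x)))\<^sup>2 \<partial>lborel)"
    by (intro nn_integral_cong) (auto simp: ennreal_power indicator_def)
  finally have fin: "(\<integral>\<^sup>+x. (ennreal (norm (indicator \<Omega> x *\<^sub>R v x)))\<^sup>2 \<partial>lborel) < \<infinity>" .
  have "(\<integral>\<^sup>+t. \<integral>\<^sup>+x. (ennreal (norm (window T t *\<^sub>R (indicator \<Omega> x *\<^sub>R v x))))\<^sup>2 \<partial>lborel \<partial>lborel)
     = (\<integral>\<^sup>+t. indicator {0<..<T} t * (\<integral>\<^sup>+x. (ennreal (norm (indicator \<Omega> x *\<^sub>R v x)))\<^sup>2 \<partial>lborel) \<partial>lborel)"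
    by (intro nn_integral_cong) (auto simp: indicator_def)
  also have "\<dots> < \<infinity>"
    using fin T by (simp add: nn_integral_multc ennreal_mult_less_top)
  finally have "(\<integral>\<^sup>+t. \<integral>\<^sup>+x. (ennreal (norm (cyl_cut T \<Omega> (\<lambda>t. v) t x)))\<^sup>2 \<partial>lborel \<partial>lborel) < \<infinity>"
    unfolding eq .
  moreover have "case_prod (cyl_cut T \<Omega> (\<lambda>t. v)) \<in> borel_measurable (lborel \<Otimes>\<^sub>M lborel)"
    unfolding eq by measurable
  ultimately show ?thesis
    unfolding sq_integrable_def by blast
qed

lemma conv_eq_line_conv:
  fixes p :: "real \<Rightarrow> 'b::euclidean_space"
  assumes "t \<in> {0<..<T}"
  shows "conv a p t = line_conv (\<lambda>s. window T s * a s) (\<lambda>s. window T s *\<^sub>R p s) t"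
  unfolding conv_def line_conv_def set_lebesgue_integral_def
  by (intro Bochner_Integration.integral_cong refl) (use assms in \<open>auto simp: indicator_def\<close>)

lemma conv_eq_time_conv:
  fixes p :: "real \<Rightarrow> 'a \<Rightarrow> 'b::euclidean_space"
  assumes "t \<in> {0<..<T}" "x \<in> \<Omega>"
  shows "conv a (\<lambda>s. p s x) t = time_conv (\<lambda>s. window T s * a s) (cyl_cut T \<Omega> p) t x"
  unfolding conv_eq_line_conv[OF assms(1)] time_conv_def
  using assms(2) by (simp add: cyl_cut_def indicator_def)

lemma bconv_eq_time_conv:
  fixes p :: "real \<Rightarrow> 'a \<Rightarrow> 'b::euclidean_space"
  assumes "t \<in> {0<..<T}" "x \<in> \<Omega>"
  shows "bconv T a (\<lambda>s. p s x) t = time_conv (\<lambda>s. window T (- s) * a (- s)) (cyl_cut T \<Omega> p) t x"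
  unfolding bconv_def time_conv_def line_conv_def set_lebesgue_integral_def
  by (intro Bochner_Integration.integral_cong refl) (use assms in \<open>auto simp: cyl_cut_def indicator_def\<close>)

lemma time_conv_outside:
  assumes "\<And>s. p s x = 0"
  shows "time_conv a p t x = 0"
  using assms by (simp add: time_conv_def line_conv_def)

lemma cylinder_integral_eq:
  fixes F' :: "real \<Rightarrow> 'a::euclidean_space \<Rightarrow> real"
  assumes "\<And>t x. t \<in> S \<Longrightarrow> x \<in> \<Omega> \<Longrightarrow> F t x = F' t x"
    and "\<And>t x. t \<notin> S \<or> x \<notin> \<Omega> \<Longrightarrow> F' t x = 0"
  shows "(LINT t:S|lborel. LINT x:\<Omega>|lborel. F t x) = (LINT t|lborel. LINT x|lborel. F' t x)"
proof -
  have "indicator S t *\<^sub>R (LINT x|lborel. indicator \<Omega> x *\<^sub>R F t x) = (LINT x|lborel. F' t x)" for t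
  proof (cases "t \<in> S")
    case True
    then have "indicator \<Omega> x *\<^sub>R F t x = F' t x" for x
      using assms by (cases "x \<in> \<Omega>") auto
    with True show ?thesis by simp
  qed (simp add: assms(2))
  then show ?thesis
    by (simp add: set_lebesgue_integral_def)
qed

lemma space_integral_eq:
  fixes F F' :: "'a::euclidean_space \<Rightarrow> real"
  assumes "\<And>x. x \<in> \<Omega> \<Longrightarrow> F x = F' x" and "\<And>x. x \<notin> \<Omega> \<Longrightarrow> F' x = 0"
  shows "(LINT x:\<Omega>|lborel. F x) = (LINT x|lborel. F' x)"
  unfolding set_lebesgue_integral_def
  by (intro Bochner_Integration.integral_cong refl) (use assms in \<open>auto simp: indicator_def\<close>)

lemma resolvent_pair_of_PC:
  assumes T: "0 < T" and PC: "(k, l) \<in> PC" and h: "reg_kernel l m h"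
  shows "resolvent_pair T (\<lambda>s. window T s * k s) (\<lambda>s. window T s * l s) (real m) (\<lambda>s. window T s * h s)"
proof
  have int: "integrable lborel (\<lambda>s. window T s * a s)" if "L1_loc a" for a
    using that T by (auto simp: L1_loc_def set_integrable_def)
  show "integrable lborel (\<lambda>s. window T s * k s)" "integrable lborel (\<lambda>s. window T s * l s)"
    "integrable lborel (\<lambda>s. window T s * h s)"
    using PC h by (auto simp: PC_def reg_kernel_def intro!: int)
  show "0 \<le> window T s * k s" for s
    using PC by (auto simp: PC_def indicator_def)
  show "window T t * k t \<le> window T s * k s" if "0 < s" "s \<le> t" for s t
    using PC that by (auto simp: PC_def indicator_def monotone_on_def)
  have "AE t in lborel. 0 < t \<longrightarrow> conv k l t = 1"
    using PC by (simp add: PC_def)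
  then show "AE t in lborel. t \<in> {0<..<T} \<longrightarrow>
      line_conv (\<lambda>s. window T s * k s) (\<lambda>s. window T s * l s) t = 1"
    by eventually_elim (use conv_eq_line_conv[of _ T k l] in auto)
  have "AE t in lborel. 0 < t \<longrightarrow> h t + real m * conv h l t = real m * l t"
    using h by (simp add: reg_kernel_def)
  then show "AE t in lborel. t \<in> {0<..<T} \<longrightarrow> window T t * h t +
      real m * line_conv (\<lambda>s. window T s * h s) (\<lambda>s. window T s * l s) t = real m * (window T t * l t)"
    by eventually_elim (use conv_eq_line_conv[of _ T h l] in auto)
qed (use T in auto)

theorem lemma3p1:
  fixes T :: real and \<Omega> :: "'a::euclidean_space set"
    and k l :: "real \<Rightarrow> real" and h dk :: "nat \<Rightarrow> real \<Rightarrow> real"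
    and u0 :: "'a \<Rightarrow> real" and f u w :: "real \<Rightarrow> 'a \<Rightarrow> real" and gw :: "real \<Rightarrow> 'a \<Rightarrow> 'a"
    and n :: nat
  assumes "T > 0"
    and "bounded_lipschitz_domain \<Omega>"
    and "(k, l) \<in> PC"
    and "\<And>m. m \<ge> 1 \<Longrightarrow> reg_kernel l m (h m)"
    and "\<And>m. m \<ge> 1 \<Longrightarrow> loc_ac_deriv (conv k (h m)) (dk m)"
    and "L2_on \<Omega> u0"
    and "L2_on ({0<..<T} \<times> \<Omega>) (\<lambda>(t, x). f t x)"
    and "L2_on ({0<..<T} \<times> \<Omega>) (\<lambda>(t, x). u t x)"
    and "cont_L2_null_at_0 T \<Omega> (\<lambda>t x. conv k (\<lambda>\<tau>. u \<tau> x) t)"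
    and "(L2_time T \<Omega> (H1_0 \<Omega>) w gw \<and>
          (AE (t, x) in lborel. (t, x) \<in> {0<..<T} \<times> \<Omega> \<longrightarrow> 0 \<le> w t x) \<and>
          weak_ineq T \<Omega> (H1_0 \<Omega>) k h u0 u f gw) \<or>
         (L2_time T \<Omega> (H1 \<Omega>) w gw \<and>
          (AE (t, x) in lborel. (t, x) \<in> {0<..<T} \<times> \<Omega> \<longrightarrow> 0 \<le> w t x) \<and>
          weak_ineq T \<Omega> (H1 \<Omega>) k h u0 u f gw)"
    and "n \<ge> 1"
  shows
    "(LINT t:{0<..<T}|lborel. LINT x:\<Omega>|lborel. w t x * conv (h n) (\<lambda>\<tau>. u \<tau> x) t)
     + 1/2 * (LINT t:{0<..<T}|lborel. LINT x:\<Omega>|lborel.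
          (conv k (h n) (T - t) + conv k (h n) t) * (norm (bconv T l (\<lambda>\<tau>. gw \<tau> x) t))\<^sup>2)
     + 1/2 * (LINT t:{0<..<T}|lborel. LINT s:{0<..<t}|lborel. LINT x:\<Omega>|lborel.
          (- dk n s) *
          (norm (bconv T l (\<lambda>\<tau>. gw \<tau> x) t - bconv T l (\<lambda>\<tau>. gw \<tau> x) (t - s)))\<^sup>2)
     \<le> (LINT t:{0<..<T}|lborel. LINT x:\<Omega>|lborel. w t x * u0 x * conv (\<lambda>_. 1) (h n) t)
     + (LINT t:{0<..<T}|lborel. LINT x:\<Omega>|lborel.
          conv (h n) (\<lambda>\<tau>. f \<tau> x) t * bconv T l (\<lambda>\<tau>. w \<tau> x) t)
     + (LINT t:{0<..<T}|lborel. LINT x:\<Omega>|lborel.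
          (bconv T (h n) (\<lambda>\<tau>. gw \<tau> x) t - conv (h n) (\<lambda>\<tau>. gw \<tau> x) t)
          \<bullet> bconv T l (\<lambda>\<tau>. gw \<tau> x) t)"
proof -
  obtain X where w_time: "L2_time T \<Omega> X w gw"
    and w_nonneg: "AE (t, x) in lborel. (t, x) \<in> {0<..<T} \<times> \<Omega> \<longrightarrow> 0 \<le> w t x"
    and weak: "weak_ineq T \<Omega> X k h u0 u f gw"
    using assms(10) by blast
  define K where "K s = window T s * k s" for s
  define L where "L s = window T s * l s" for s
  define H where "H s = window T s * h n s" for s
  define N where "N = real n"
  interpret resolvent_pair T K L N H
    unfolding K_def[abs_def] L_def[abs_def] H_def[abs_def] N_def
    by (rule resolvent_pair_of_PC[OF assms(1) assms(3) assms(4)[OF assms(11)]])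
  obtain D where D_weak: "weak_time_deriv T \<Omega> (\<lambda>t x. conv (conv k (h n)) (\<lambda>\<tau>. u \<tau> x - u0 x) t) D"
    and test: "\<And>\<psi> g\<psi>. X \<psi> g\<psi> \<Longrightarrow> AE x\<in>\<Omega> in lborel. 0 \<le> \<psi> x \<Longrightarrow>
       AE t\<in>{0<..<T} in lborel.
         (LINT x:\<Omega>|lborel. \<psi> x * D t x + conv (h n) (\<lambda>\<tau>. gw \<tau> x) t \<bullet> g\<psi> x)
         \<le> (LINT x:\<Omega>|lborel. conv (h n) (\<lambda>\<tau>. f \<tau> x) t * \<psi> x)"
    using weak assms(11) unfolding weak_ineq_def by blast
  define cD cw cf cu cu0 where "cD = cyl_cut T \<Omega> D" and "cw = cyl_cut T \<Omega> w" and "cf = cyl_cut T \<Omega> f"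
    and "cu = cyl_cut T \<Omega> u" and "cu0 = cyl_cut T \<Omega> (\<lambda>t. u0)"
  define cg where "cg = cyl_cut T \<Omega> gw"
  define v where "v t x = cu t x - cu0 t x" for t x
  note cut_defs = cD_def cw_def cf_def cu_def cu0_def cg_def
  have sq: "sq_integrable cD" "sq_integrable cw" "sq_integrable cf" "sq_integrable cu" "sq_integrable cu0"
    "sq_integrable cg"
    unfolding cut_defs
    using D_weak w_time assms(7,8) sq_integrable_cyl_cut_const[OF assms(6,1)]
    by (simp_all add: weak_time_deriv_def L2_time_def sq_integrable_cyl_cut)
  have sq_v: "sq_integrable v"
    unfolding v_def by (rule sq_integrable_diff[OF sq(4,5)])
  have out: "cD t x = 0" "cw t x = 0" "cf t x = 0" "cu t x = 0" "cu0 t x = 0" "cg t x = 0" "v t x = 0"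
    if "t \<notin> {0<..<T} \<or> x \<notin> \<Omega>" for t x
    by (simp_all add: cut_defs v_def cyl_cut_outside[OF that])
  have inside: "cD t x = D t x" "cw t x = w t x" "cf t x = f t x" "cu t x = u t x" "cu0 t x = u0 x" "cg t x = gw t x"
    "v t x = u t x - u0 x"
    if "t \<in> {0<..<T}" "x \<in> \<Omega>" for t x
    by (simp_all add: cut_defs v_def cyl_cut_inside[OF that])
  define C where "C = time_cut T (time_conv H cg)"
  define F where "F = time_cut T (time_conv H cf)"
  define G where "G = time_cut T (time_conv (\<lambda>s. L (- s)) cg)"
  have sq_CFG: "sq_integrable C" "sq_integrable F" "sq_integrable G"
    unfolding C_def F_def G_def
    by (intro sq_integrable_time_cut sq_integrable_time_conv sq H_int L_int integrable_reflect)+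
  have conv_h: "conv (h n) (\<lambda>s. p s x) t = time_conv H (cyl_cut T \<Omega> p) t x" if "t \<in> {0<..<T}" "x \<in> \<Omega>"
    for p :: "real \<Rightarrow> 'a \<Rightarrow> 'b::euclidean_space" and t x
    using conv_eq_time_conv[OF that, of "h n" p] by (simp add: H_def[abs_def])
  have bconv_l: "bconv T l (\<lambda>s. p s x) t = time_conv (\<lambda>s. L (- s)) (cyl_cut T \<Omega> p) t x" if "t \<in> {0<..<T}" "x \<in> \<Omega>"
    for p :: "real \<Rightarrow> 'a \<Rightarrow> 'b::euclidean_space" and t x
    using bconv_eq_time_conv[OF that, of l p] by (simp add: L_def)
  have bconv_h: "bconv T (h n) (\<lambda>s. p s x) t = time_conv (\<lambda>s. H (- s)) (cyl_cut T \<Omega> p) t x" if "t \<in> {0<..<T}" "x \<in> \<Omega>"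
    for p :: "real \<Rightarrow> 'a \<Rightarrow> 'b::euclidean_space" and t x
    using bconv_eq_time_conv[OF that, of "h n" p] by (simp add: H_def)
  have conv_k: "conv k (h n) t = line_conv K H t" if "t \<in> {0<..<T}" for t
    using conv_eq_line_conv[OF that, of k "h n"] by (simp add: K_def[abs_def] H_def[abs_def])
  have CFG_in: "conv (h n) (\<lambda>s. gw s x) t = C t x" "conv (h n) (\<lambda>s. f s x) t = F t x"
    "bconv T l (\<lambda>s. gw s x) t = G t x" if "t \<in> {0<..<T}" "x \<in> \<Omega>" for t x
    using that by (simp_all add: conv_h bconv_l C_def F_def G_def cg_def cf_def time_cut_def)
  have CFG_out: "C t x = 0" "F t x = 0" "G t x = 0" if "t \<notin> {0<..<T} \<or> x \<notin> \<Omega>" for t x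
  proof -
    have "time_conv a cg t x = 0" "time_conv a cf t x = 0" if "x \<notin> \<Omega>" for a
      using that by (auto intro!: time_conv_outside simp: out)
    with that show "C t x = 0" "F t x = 0" "G t x = 0"
      by (auto simp: C_def F_def G_def time_cut_def)
  qed
  \<comment> \<open>The weak inequality at time \<open>s\<close> is tested with \<open>w t\<close>, which lies in \<open>X\<close> and is nonnegative for
    almost every \<open>t\<close>.\<close>
  have main: "conv_form L cD cw + conv_form L C cg \<le> conv_form L F cw"
  proof (rule conv_form_tested_inequality[OF L_int resolvent_nonneg sq(1,2) sq_CFG(2,1) sq(6)])
    have "AE z in lborel \<Otimes>\<^sub>M lborel. z \<in> {0<..<T} \<times> \<Omega> \<longrightarrow> 0 \<le> w (fst z) (snd z)"
      unfolding lborel_prod using w_nonneg by (simp add: case_prod_beta' mem_Times_iff)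
    from lborel_pair.AE_pair[OF this]
    have nonneg: "AE t in lborel. AE x in lborel. (t, x) \<in> {0<..<T} \<times> \<Omega> \<longrightarrow> 0 \<le> w t x"
      by simp
    have X: "AE t in lborel. t \<in> {0<..<T} \<longrightarrow> X (w t) (gw t)"
      using w_time by (simp add: L2_time_def)
    show "AE t in lborel. AE s in lborel.
      (LINT x|lborel. cw t x * cD s x + C s x \<bullet> cg t x) \<le> (LINT x|lborel. F s x * cw t x)"
      using nonneg X
    proof eventually_elim
      case (elim t)
      show ?case
      proof (cases "t \<in> {0<..<T}")
        case False
        then show ?thesis by (simp add: out)
      next
        case True
        have "AE x\<in>\<Omega> in lborel. 0 \<le> w t x"
          using elim(1) True by auto
        from test[OF _ this] elim(2) True
        have "AE s\<in>{0<..<T} in lborel.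
            (LINT x:\<Omega>|lborel. w t x * D s x + conv (h n) (\<lambda>\<tau>. gw \<tau> x) s \<bullet> gw t x)
            \<le> (LINT x:\<Omega>|lborel. conv (h n) (\<lambda>\<tau>. f \<tau> x) s * w t x)"
          by blast
        then show ?thesis
        proof eventually_elim
          case (elim s)
          show ?case
          proof (cases "s \<in> {0<..<T}")
            case False
            then show ?thesis by (simp add: out CFG_out)
          next
            case s: True
            have "(LINT x:\<Omega>|lborel. w t x * D s x + conv (h n) (\<lambda>\<tau>. gw \<tau> x) s \<bullet> gw t x)
               = (LINT x|lborel. cw t x * cD s x + C s x \<bullet> cg t x)"
              by (rule space_integral_eq) (use s True in \<open>simp_all add: inside CFG_in out\<close>)
            moreover have "(LINT x:\<Omega>|lborel. conv (h n) (\<lambda>\<tau>. f \<tau> x) s * w t x) = (LINT x|lborel. F s x * cw t x)"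
              by (rule space_integral_eq) (use s True in \<open>simp_all add: inside CFG_in out\<close>)
            ultimately show ?thesis using elim s by simp
          qed
        qed
      qed
    qed
  qed
  have D_eq: "AE t in lborel. AE x in lborel. cD t x = time_cut T (\<lambda>t x. N * (v t x - time_conv H v t x)) t x"
  proof (rule weak_time_derivative_eq[OF sq_v out(7) sq(1) out(1),
        where V="\<lambda>t x. conv (conv k (h n)) (\<lambda>\<tau>. u \<tau> x - u0 x) t"])
    show "conv (conv k (h n)) (\<lambda>\<tau>. u \<tau> x - u0 x) t = (LINT s:{0<..<t}|lborel. line_conv K H (t - s) * v s x)"
      if "t \<in> {0<..<T}" "x \<in> \<Omega>" for t x
      unfolding conv_def[of "conv k (h n)"] set_lebesgue_integral_def
      by (intro Bochner_Integration.integral_cong refl)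
         (use that in \<open>auto simp: indicator_def conv_k inside\<close>)
    show "AE x\<in>\<Omega> in lborel. (LINT t:{0<..<T}|lborel. deriv \<phi> t * conv (conv k (h n)) (\<lambda>\<tau>. u \<tau> x - u0 x) t)
       = - (LINT t:{0<..<T}|lborel. \<phi> t * cD t x)" if \<phi>: "test_fun {0<..<T} \<phi>" for \<phi>
    proof -
      have "(LINT t:{0<..<T}|lborel. \<phi> t * cD t x) = (LINT t:{0<..<T}|lborel. \<phi> t * D t x)" if "x \<in> \<Omega>" for x
        unfolding set_lebesgue_integral_def
        by (intro Bochner_Integration.integral_cong refl) (use that in \<open>auto simp: indicator_def inside\<close>)
      moreover have "AE x\<in>\<Omega> in lborel. (LINT t:{0<..<T}|lborel. deriv \<phi> t * conv (conv k (h n)) (\<lambda>\<tau>. u \<tau> x - u0 x) t)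
        = - (LINT t:{0<..<T}|lborel. \<phi> t * D t x)"
        using D_weak \<phi> by (simp add: weak_time_deriv_def)
      ultimately show ?thesis
        by (auto elim!: eventually_mono)
    qed
  qed auto
  have "conv_form L cD cw = conv_form H v cw"
    by (rule time_derivative_term[OF sq_v sq(1,2) _ _ D_eq]) (auto simp: out)
  also have "\<dots> = conv_form H cu cw - conv_form H cu0 cw"
    unfolding v_def by (rule conv_form_diff_left[OF H_int sq(4,5,2)])
  finally have testD: "conv_form L cD cw = conv_form H cu cw - conv_form H cu0 cw" .
  have grad: "conv_form H G cg = N * (st_inner G G - conv_form H G G)"
    unfolding G_def by (rule gradient_term[OF sq(6)]) (simp add: out)
  define A where "A t = (LINT s:{0<..<t}|lborel. H s)" for t
  note [measurable] = integrable_measurable_borel[OF K_int] integrable_measurable_borel[OF H_int]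
    sq_integrable_measurable[OF sq_CFG(3)]
  \<comment> \<open>Each integral of the claim is rewritten for the truncated functions; off the cylinder all
    integrands vanish.\<close>
  have T1: "(LINT t:{0<..<T}|lborel. LINT x:\<Omega>|lborel. w t x * conv (h n) (\<lambda>\<tau>. u \<tau> x) t) = conv_form H cu cw"
    unfolding conv_form_eq_st_inner[OF H_int sq(4,2)] st_inner_def
    by (rule cylinder_integral_eq) (simp_all add: conv_h inside out mult.commute flip: cu_def)
  have T2: "(LINT t:{0<..<T}|lborel. LINT x:\<Omega>|lborel.
          (conv k (h n) (T - t) + conv k (h n) t) * (norm (bconv T l (\<lambda>\<tau>. gw \<tau> x) t))\<^sup>2)
     = (LINT t:{0<..<T}|lborel. LINT x|lborel. ((N - N * A (T - t)) + (N - N * A t)) * (norm (G t x))\<^sup>2)"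
  proof -
    have "(LINT t:{0<..<T}|lborel. LINT x:\<Omega>|lborel.
          (conv k (h n) (T - t) + conv k (h n) t) * (norm (bconv T l (\<lambda>\<tau>. gw \<tau> x) t))\<^sup>2)
      = (LINT t|lborel. LINT x|lborel. (line_conv K H (T - t) + line_conv K H t) * (norm (G t x))\<^sup>2)"
      by (rule cylinder_integral_eq) (simp_all add: conv_k CFG_in CFG_out)
    also have "\<dots> = (LINT t|lborel. window T t *\<^sub>R (LINT x|lborel. ((N - N * A (T - t)) + (N - N * A t)) * (norm (G t x))\<^sup>2))"
    proof (rule integral_cong_AE)
      show "AE t in lborel. (LINT x|lborel. (line_conv K H (T - t) + line_conv K H t) * (norm (G t x))\<^sup>2)
        = window T t *\<^sub>R (LINT x|lborel. ((N - N * A (T - t)) + (N - N * A t)) * (norm (G t x))\<^sup>2)"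
        using regularized_kernel_eq AE_reflect_shift[OF regularized_kernel_eq, of T]
      proof eventually_elim
        case (elim t)
        then show ?case
          by (cases "t \<in> {0<..<T}") (auto simp: A_def CFG_out)
      qed
      have [measurable]: "A \<in> borel_measurable borel"
        unfolding A_def by (intro borel_measurable_continuous_onI continuous_on_integral_upto H_int)
      show "(\<lambda>t. window T t *\<^sub>R (LINT x|lborel. ((N - N * A (T - t)) + (N - N * A t)) * (norm (G t x))\<^sup>2))
        \<in> borel_measurable lborel"
        by measurable
    qed measurable
    finally show ?thesis
      by (simp only: set_lebesgue_integral_def)
  qed
  have T3: "(LINT t:{0<..<T}|lborel. LINT s:{0<..<t}|lborel. LINT x:\<Omega>|lborel.
          (- dk n s) * (norm (bconv T l (\<lambda>\<tau>. gw \<tau> x) t - bconv T l (\<lambda>\<tau>. gw \<tau> x) (t - s)))\<^sup>2)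
     = (LINT t:{0<..<T}|lborel. LINT s:{0<..<t}|lborel. LINT x|lborel.
          (N * H s) * (norm (G t x - G (t - s) x))\<^sup>2)"
  proof -
    define d where "d s = window T s * dk n s" for s
    have lad: "loc_ac_deriv (conv k (h n)) (dk n)"
      by (rule assms(5)[OF assms(11)])
    have d_int: "integrable lborel d"
      using lad assms(1) by (simp add: loc_ac_deriv_def L1_loc_def set_integrable_def d_def[abs_def])
    note [measurable] = integrable_measurable_borel[OF d_int]
    obtain c where c: "AE t in lborel. 0 < t \<longrightarrow> conv k (h n) t = c + (LINT s:{0<..<t}|lborel. dk n s)"
      using lad by (auto simp: loc_ac_deriv_def)
    have "(LINT s:{0<..<t}|lborel. dk n s) = (LINT s:{0<..<t}|lborel. d s)" if "t \<in> {0<..<T}" for t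
      unfolding set_lebesgue_integral_def
      by (intro Bochner_Integration.integral_cong refl) (use that in \<open>auto simp: indicator_def d_def\<close>)
    then have "AE t in lborel. t \<in> {0<..<T} \<longrightarrow> line_conv K H t = c + (LINT s:{0<..<t}|lborel. d s)"
      using c by (auto simp: conv_k elim!: eventually_mono)
    note d_eq = kernel_derivative_eq[OF d_int this]
    show ?thesis
      unfolding set_lebesgue_integral_def[of lborel "{0<..<T}"]
    proof (intro Bochner_Integration.integral_cong refl)
      fix t
      show "window T t *\<^sub>R (LINT s:{0<..<t}|lborel. LINT x:\<Omega>|lborel.
          (- dk n s) * (norm (bconv T l (\<lambda>\<tau>. gw \<tau> x) t - bconv T l (\<lambda>\<tau>. gw \<tau> x) (t - s)))\<^sup>2)
        = window T t *\<^sub>R (LINT s:{0<..<t}|lborel. LINT x|lborel. (N * H s) * (norm (G t x - G (t - s) x))\<^sup>2)"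
      proof (cases "t \<in> {0<..<T}")
        case True
        have "(LINT s:{0<..<t}|lborel. LINT x:\<Omega>|lborel.
          (- dk n s) * (norm (bconv T l (\<lambda>\<tau>. gw \<tau> x) t - bconv T l (\<lambda>\<tau>. gw \<tau> x) (t - s)))\<^sup>2)
          = (LINT s|lborel. indicator {0<..<t} s *\<^sub>R (LINT x|lborel. (- d s) * (norm (G t x - G (t - s) x))\<^sup>2))"
          unfolding set_lebesgue_integral_def[of lborel "{0<..<t}"]
        proof (intro Bochner_Integration.integral_cong refl)
          fix s
          show "indicator {0<..<t} s *\<^sub>R (LINT x:\<Omega>|lborel.
            (- dk n s) * (norm (bconv T l (\<lambda>\<tau>. gw \<tau> x) t - bconv T l (\<lambda>\<tau>. gw \<tau> x) (t - s)))\<^sup>2)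
            = indicator {0<..<t} s *\<^sub>R (LINT x|lborel. (- d s) * (norm (G t x - G (t - s) x))\<^sup>2)"
          proof (cases "s \<in> {0<..<t}")
            case s: True
            then have st: "t - s \<in> {0<..<T}" "s \<in> {0<..<T}" using True by auto
            have "(LINT x:\<Omega>|lborel.
              (- dk n s) * (norm (bconv T l (\<lambda>\<tau>. gw \<tau> x) t - bconv T l (\<lambda>\<tau>. gw \<tau> x) (t - s)))\<^sup>2)
              = (LINT x|lborel. (- d s) * (norm (G t x - G (t - s) x))\<^sup>2)"
              by (rule space_integral_eq) (use st True in \<open>simp_all add: CFG_in CFG_out d_def\<close>)
            then show ?thesis by simp
          qed simp
        qed
        also have "\<dots> = (LINT s|lborel. indicator {0<..<t} s *\<^sub>R (LINT x|lborel. (N * H s) * (norm (G t x - G (t - s) x))\<^sup>2))"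
        proof (rule integral_cong_AE)
          show "AE s in lborel. indicator {0<..<t} s *\<^sub>R (LINT x|lborel. (- d s) * (norm (G t x - G (t - s) x))\<^sup>2)
            = indicator {0<..<t} s *\<^sub>R (LINT x|lborel. (N * H s) * (norm (G t x - G (t - s) x))\<^sup>2)"
            using d_eq
          proof eventually_elim
            case (elim s)
            show ?case
            proof (cases "s \<in> {0<..<t}")
              case s: True
              then have "- d s = N * H s" using elim True by auto
              then show ?thesis by (simp only:)
            qed simp
          qed
        qed measurable
        finally show ?thesis
          by (simp only: set_lebesgue_integral_def)
      qed simp
    qed
  qed
  have T4: "(LINT t:{0<..<T}|lborel. LINT x:\<Omega>|lborel. w t x * u0 x * conv (\<lambda>_. 1) (h n) t) = conv_form H cu0 cw"
    unfolding conv_form_eq_st_inner[OF H_int sq(5,2)] st_inner_def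
  proof (rule cylinder_integral_eq)
    fix t x assume tx: "t \<in> {0<..<T}" "x \<in> \<Omega>"
    have "conv (\<lambda>_. 1) (h n) t = (LINT s:{0<..<t}|lborel. H s)"
      unfolding conv_def set_lebesgue_integral_def
      by (intro Bochner_Integration.integral_cong refl) (use tx in \<open>auto simp: indicator_def H_def\<close>)
    also have "\<dots> = (LINT s|lborel. H (t - s) * window T s)"
      by (rule line_conv_H_window[OF tx(1), symmetric])
    finally have eq: "conv (\<lambda>_. 1) (h n) t = (LINT s|lborel. H (t - s) * window T s)" .
    have "time_conv H cu0 t x = (LINT s|lborel. u0 x * (H (t - s) * window T s))"
      unfolding time_conv_def line_conv_def
      by (intro Bochner_Integration.integral_cong refl)
         (use tx in \<open>auto simp: cu0_def cyl_cut_def indicator_def\<close>)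
    also have "\<dots> = u0 x * conv (\<lambda>_. 1) (h n) t"
      by (simp add: eq)
    finally have "time_conv H cu0 t x = u0 x * conv (\<lambda>_. 1) (h n) t" .
    then show "w t x * u0 x * conv (\<lambda>_. 1) (h n) t = time_conv H cu0 t x \<bullet> cw t x"
      using tx by (simp add: inside)
  qed (simp add: out)
  have T5: "(LINT t:{0<..<T}|lborel. LINT x:\<Omega>|lborel.
          conv (h n) (\<lambda>\<tau>. f \<tau> x) t * bconv T l (\<lambda>\<tau>. w \<tau> x) t) = conv_form L F cw"
    unfolding conv_form_eq_st_inner'[OF L_int sq_CFG(2) sq(2)] st_inner_def
    by (rule cylinder_integral_eq) (simp_all add: CFG_in CFG_out bconv_l flip: cw_def)
  have T6: "(LINT t:{0<..<T}|lborel. LINT x:\<Omega>|lborel.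
          (bconv T (h n) (\<lambda>\<tau>. gw \<tau> x) t - conv (h n) (\<lambda>\<tau>. gw \<tau> x) t)
          \<bullet> bconv T l (\<lambda>\<tau>. gw \<tau> x) t) = conv_form H G cg - conv_form L C cg"
  proof -
    have sqHg: "sq_integrable (time_conv (\<lambda>s. H (- s)) cg)"
      by (intro sq_integrable_time_conv integrable_reflect H_int sq)
    have "(LINT t:{0<..<T}|lborel. LINT x:\<Omega>|lborel.
          (bconv T (h n) (\<lambda>\<tau>. gw \<tau> x) t - conv (h n) (\<lambda>\<tau>. gw \<tau> x) t)
          \<bullet> bconv T l (\<lambda>\<tau>. gw \<tau> x) t)
       = st_inner G (\<lambda>t x. time_conv (\<lambda>s. H (- s)) cg t x - C t x)"
      unfolding st_inner_def
      by (rule cylinder_integral_eq) (simp_all add: CFG_in CFG_out bconv_h inner_commute flip: cg_def)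
    also have "\<dots> = st_inner G (time_conv (\<lambda>s. H (- s)) cg) - st_inner G C"
      by (rule st_inner_diff_right[OF sqHg sq_CFG(1,3)])
    also have "st_inner G (time_conv (\<lambda>s. H (- s)) cg) = conv_form H G cg"
      by (rule conv_form_eq_st_inner'[OF H_int sq_CFG(3) sq(6), symmetric])
    also have "st_inner G C = conv_form L C cg"
    proof -
      have "st_inner G C = st_inner (time_cut T C) (time_conv (\<lambda>s. L (- s)) cg)"
        by (simp add: G_def st_inner_time_cut st_inner_commute[of C])
      also have "time_cut T C = C"
        by (rule time_cut_eq) (simp add: CFG_out)
      also have "st_inner C (time_conv (\<lambda>s. L (- s)) cg) = conv_form L C cg"
        by (rule conv_form_eq_st_inner'[OF L_int sq_CFG(1) sq(6), symmetric])
      finally show ?thesis .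
    qed
    finally show ?thesis .
  qed
  have energy: "1/2 * (LINT t:{0<..<T}|lborel. LINT x|lborel. ((N - N * A (T - t)) + (N - N * A t)) * (norm (G t x))\<^sup>2)
    + 1/2 * (LINT t:{0<..<T}|lborel. LINT s:{0<..<t}|lborel. LINT x|lborel.
          (N * H s) * (norm (G t x - G (t - s) x))\<^sup>2)
    = N * (st_inner G G - conv_form H G G)"
    unfolding A_def by (rule energy_identity[OF sq_CFG(3)]) (simp add: CFG_out)
  show ?thesis
    unfolding T1 T2 T3 T4 T5 T6
    using main testD grad energy by linarith
qed

end
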